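(* There is an algorithm running in time polynomial in $n$ and $|\mathcal{S}|$ which, given an instance of the single-option optimal search problem (defined in the context), computes a (possibly randomized) partially-adaptive strategy whose expected total cost is at most $\frac{e}{e-1}$ times the expected total cost of the optimal non-adaptive strategy.
   Context: Optimal search problem (single option, unit probing times). There are $n$ boxes $\mathcal{B}=\{1,\dots,n\}$ and a finite list $\mathcal{S}$ of scenarios (repetitions allowed); the true scenario $s$ is drawn uniformly at random from $\mathcal{S}$ and is unknown. In scenario $s$, box $i$ has cost $c_{is}\ge 0$. A strategy probes boxes one at a time; probing a box takes one unit of time and reveals its cost in the realized scenario. At some point the strategy stops and selects one probed box. The total cost is the number of boxes probed plus the cost of the selected box; strategies are evaluated by expected total cost (over the scenario and any internal randomness). A non-adaptive (NA) strategy probes a fixed set $A\subseteq\mathcal{B}$ and selects the probed box of minimum cost (cost $|A|+\mathbb{E}_s[\min_{i\in A}c_{is}]$). A partially-adaptive (PA) strategy probes boxes in a fixed order that does not depend on observed costs, but may decide when to stop based on the costs observed so far (then selecting a minimum-cost probed box). A fully-adaptive (FA) strategy may choose each next box to probe, and when to stop, based on all costs observed so far. Strategies may be randomized. *)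

theory Defs
  imports "HOL-Probability.Probability_Mass_Function"
begin

section \<open>Optimal search with a single option and unit probing times\<close>

text \<open>A scenario is the cost vector of the boxes \<open>{1..n}\<close>; its values at other arguments are
  never used. An instance is \<open>n\<close> together with a list of scenarios, so repetitions are allowed.\<close>

type_synonym scenario = "nat \<Rightarrow> real"

definition search_instance :: "nat \<Rightarrow> scenario list \<Rightarrow> bool" where
  "search_instance n S \<longleftrightarrow> n \<ge> 1 \<and> S \<noteq> [] \<and> (\<forall>s\<in>set S. \<forall>i\<in>{1..n}. 0 \<le> s i)"

definition avg :: "scenario list \<Rightarrow> (scenario \<Rightarrow> real) \<Rightarrow> real" where
  "avg S f = (\<Sum>s\<leftarrow>S. f s) / real (length S)"

text \<open>The probed set has to be nonempty because a probed box must be selected.\<close>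

definition na_strategies :: "nat \<Rightarrow> nat set set" where
  "na_strategies n = {A. A \<subseteq> {1..n} \<and> A \<noteq> {}}"

definition na_cost :: "scenario list \<Rightarrow> nat set \<Rightarrow> real" where
  "na_cost S A = real (card A) + avg S (\<lambda>s. Min (s ` A))"

definition opt_na_cost :: "nat \<Rightarrow> scenario list \<Rightarrow> real" where
  "opt_na_cost n S = Min (na_cost S ` na_strategies n)"

text \<open>A deterministic partially-adaptive strategy is a probing order and a stopping rule, which
  sees the list of the costs observed so far. After the last box the strategy stops in any case.\<close>

type_synonym pa_strategy = "nat list \<times> (real list \<Rightarrow> bool)"

definition is_pa :: "nat \<Rightarrow> pa_strategy \<Rightarrow> bool" where
  "is_pa n \<pi> \<longleftrightarrow> distinct (fst \<pi>) \<and> set (fst \<pi>) = {1..n}"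

definition observed :: "nat list \<Rightarrow> scenario \<Rightarrow> nat \<Rightarrow> real list" where
  "observed \<sigma> s t = map s (take t \<sigma>)"

definition pa_stop_time :: "pa_strategy \<Rightarrow> scenario \<Rightarrow> nat" where
  "pa_stop_time \<pi> s =
     (LEAST t. 1 \<le> t \<and> (t \<ge> length (fst \<pi>) \<or> snd \<pi> (observed (fst \<pi>) s t)))"

definition pa_cost_in :: "pa_strategy \<Rightarrow> scenario \<Rightarrow> real" where
  "pa_cost_in \<pi> s =
     real (pa_stop_time \<pi> s) + Min (set (observed (fst \<pi>) s (pa_stop_time \<pi> s)))"

definition pa_cost :: "scenario list \<Rightarrow> pa_strategy \<Rightarrow> real" where
  "pa_cost S \<pi> = avg S (pa_cost_in \<pi>)"

text \<open>A randomized partially-adaptive strategy is a distribution over deterministic ones.\<close>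

definition expected_pa_cost :: "scenario list \<Rightarrow> pa_strategy pmf \<Rightarrow> real" where
  "expected_pa_cost S D = measure_pmf.expectation D (pa_cost S)"

section \<open>The machine model: structured programs on a real RAM\<close>

text \<open>The memory consists of two-dimensional arrays of natural numbers and of real numbers;
  a scalar variable is the entry with indices 0 and 0. Real arithmetic is exact and has unit cost.
  As usual for a real RAM there is no way back from the reals to the natural numbers other than
  comparison (in particular no rounding), and there are no real constants beyond those computable
  from natural numbers, so that a program carries no noncomputable advice.\<close>

type_synonym vname = string

record store =
  nats :: "vname \<Rightarrow> nat \<Rightarrow> nat \<Rightarrow> nat"
  reals :: "vname \<Rightarrow> nat \<Rightarrow> nat \<Rightarrow> real"

datatype nexp =
    NConst nat
  | NAt vname nexp nexp
  | NPlus nexp nexp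
  | NMinus nexp nexp

datatype rexp =
    RNat nexp
  | RAt vname nexp nexp
  | RPlus rexp rexp
  | RMinus rexp rexp
  | RTimes rexp rexp
  | RDivide rexp rexp

datatype bexp =
    NLess nexp nexp
  | RLess rexp rexp
  | BNot bexp
  | BAnd bexp bexp

datatype com =
    Skip
  | NAssign vname nexp nexp nexp
  | RAssign vname nexp nexp rexp
  | Seq com com
  | Cond bexp com com
  | While bexp com

primrec nval :: "nexp \<Rightarrow> store \<Rightarrow> nat" where
  "nval (NConst k) st = k"
| "nval (NAt x a b) st = nats st x (nval a st) (nval b st)"
| "nval (NPlus a b) st = nval a st + nval b st"
| "nval (NMinus a b) st = nval a st - nval b st"

primrec rval :: "rexp \<Rightarrow> store \<Rightarrow> real" where
  "rval (RNat a) st = real (nval a st)"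
| "rval (RAt x a b) st = reals st x (nval a st) (nval b st)"
| "rval (RPlus a b) st = rval a st + rval b st"
| "rval (RMinus a b) st = rval a st - rval b st"
| "rval (RTimes a b) st = rval a st * rval b st"
| "rval (RDivide a b) st = rval a st / rval b st"

primrec bval :: "bexp \<Rightarrow> store \<Rightarrow> bool" where
  "bval (NLess a b) st \<longleftrightarrow> nval a st < nval b st"
| "bval (RLess a b) st \<longleftrightarrow> rval a st < rval b st"
| "bval (BNot b) st \<longleftrightarrow> \<not> bval b st"
| "bval (BAnd a b) st \<longleftrightarrow> bval a st \<and> bval b st"

definition upd :: "(vname \<Rightarrow> nat \<Rightarrow> nat \<Rightarrow> 'a) \<Rightarrow> vname \<Rightarrow> nat \<Rightarrow> nat \<Rightarrow> 'a \<Rightarrow> vname \<Rightarrow> nat \<Rightarrow> nat \<Rightarrow> 'a" where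
  "upd M x i j v = M(x := (M x)(i := (M x i)(j := v)))"

text \<open>\<open>exec c st t st'\<close>: started in \<open>st\<close>, \<open>c\<close> halts in \<open>st'\<close> after \<open>t\<close> time units. Every
  assignment and every test costs 1. The expressions occurring in a fixed program have bounded
  size, so charging each of their operations separately would only change a constant factor.\<close>

inductive exec :: "com \<Rightarrow> store \<Rightarrow> nat \<Rightarrow> store \<Rightarrow> bool" where
  Skip: "exec Skip st 1 st"
| NAssign: "exec (NAssign x a b e) st 1
     (st\<lparr>nats := upd (nats st) x (nval a st) (nval b st) (nval e st)\<rparr>)"
| RAssign: "exec (RAssign x a b e) st 1
     (st\<lparr>reals := upd (reals st) x (nval a st) (nval b st) (rval e st)\<rparr>)"
| Seq: "exec c1 st t1 st1 \<Longrightarrow> exec c2 st1 t2 st2 \<Longrightarrow> exec (Seq c1 c2) st (t1 + t2) st2"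
| CondTrue: "bval b st \<Longrightarrow> exec c1 st t st' \<Longrightarrow> exec (Cond b c1 c2) st (1 + t) st'"
| CondFalse: "\<not> bval b st \<Longrightarrow> exec c2 st t st' \<Longrightarrow> exec (Cond b c1 c2) st (1 + t) st'"
| WhileFalse: "\<not> bval b st \<Longrightarrow> exec (While b c) st 1 st"
| WhileTrue: "bval b st \<Longrightarrow> exec c st t1 st1 \<Longrightarrow> exec (While b c) st1 t2 st2 \<Longrightarrow>
     exec (While b c) st (1 + t1 + t2) st2"

lemma exec_deterministic:
  "exec c st t st' \<Longrightarrow> exec c st u st'' \<Longrightarrow> u = t \<and> st'' = st'"
proof (induction arbitrary: u st'' rule: exec.induct)
  case (Seq c1 st t1 st1 c2 t2 st2)
  from Seq.prems Seq.IH show ?case by (cases rule: exec.cases) blast+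
next
  case (WhileTrue b st c t1 st1 t2 st2)
  from WhileTrue.prems WhileTrue.IH WhileTrue.hyps show ?case by (cases rule: exec.cases) blast+
qed (erule exec.cases; blast)+

section \<open>Computing a randomized partially-adaptive strategy\<close>

text \<open>The input consists of \<open>n\<close>, the number of scenarios, the cost matrix (boxes are numbered
  from 1, scenarios from 0) and a string of coin flips. All other memory is 0.\<close>

definition input_store :: "nat \<Rightarrow> scenario list \<Rightarrow> bool list \<Rightarrow> store" where
  "input_store n S \<omega> =
     \<lparr>nats = (\<lambda>x i j.
        if x = ''n'' \<and> i = 0 \<and> j = 0 then n
        else if x = ''m'' \<and> i = 0 \<and> j = 0 then length S
        else if x = ''coin'' \<and> i < length \<omega> \<and> j = 0 then of_bool (\<omega> ! i)
        else 0),
      reals = (\<lambda>x i j.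
        if x = ''cost'' \<and> i \<in> {1..n} \<and> j < length S then (S ! j) i else 0)\<rparr>"

definition reveal :: "real list \<Rightarrow> store \<Rightarrow> store" where
  "reveal xs st =
     \<lparr>nats = upd (nats st) ''t'' 0 0 (length xs),
      reals = (reals st)(''obs'' := (\<lambda>k l. if k < length xs \<and> l = 0 then xs ! k else 0))\<rparr>"

text \<open>An algorithm consists of two programs. The first one, \<open>plan\<close>, is run before any box is
  probed and leaves the probing order in memory; hence the order cannot depend on observed costs.
  The second one, \<open>test\<close>, evaluates the stopping rule: it is run on the memory left by \<open>plan\<close>
  (including the coin flips) extended by the costs observed so far. Both run within time \<open>T\<close>.\<close>

definition computes_pa ::
    "com \<Rightarrow> com \<Rightarrow> nat \<Rightarrow> nat \<Rightarrow> scenario list \<Rightarrow> bool list \<Rightarrow> pa_strategy \<Rightarrow> bool" where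
  "computes_pa plan test T n S \<omega> \<pi> \<longleftrightarrow>
     (\<exists>t st. exec plan (input_store n S \<omega>) t st \<and> t \<le> T \<and>
        fst \<pi> = map (\<lambda>k. nats st ''order'' k 0) [0..<n] \<and>
        (\<forall>s\<in>set S. \<forall>j\<in>{1..n}. \<exists>t' st'.
           exec test (reveal (observed (fst \<pi>) s j) st) t' st' \<and> t' \<le> T \<and>
           (snd \<pi> (observed (fst \<pi>) s j) \<longleftrightarrow> nats st' ''stop'' 0 0 \<noteq> 0)))"

text \<open>The number of coin flips provided is the time bound itself. It must not be an arbitrary
  function of the input, since the length of the random string could carry advice.\<close>

definition computes_randomized_pa ::
    "com \<Rightarrow> com \<Rightarrow> nat \<Rightarrow> nat \<Rightarrow> scenario list \<Rightarrow> pa_strategy pmf \<Rightarrow> bool" where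
  "computes_randomized_pa plan test T n S D \<longleftrightarrow>
     (\<exists>strat. (\<forall>\<omega>. length \<omega> = T \<longrightarrow> is_pa n (strat \<omega>) \<and> computes_pa plan test T n S \<omega> (strat \<omega>)) \<and>
        D = map_pmf strat (pmf_of_set {\<omega> :: bool list. length \<omega> = T}))"

end

(* Idea. Guess the size k of an optimal set A. The linear program "open k boxes fractionally and
   assign every scenario" is a zero-sum game between boxes and dual prices of the scenarios; playing
   best responses against slowly moving prices for polynomially many rounds solves it up to a small
   constant error. Opening the box of a random round at each step, a scenario is hit after k probes
   in expectation, and the method of conditional expectations turns this into one fixed order whose
   average cost min_t (t + Y_t), with Y_t the cheapest of the first t boxes, is at most OPT + 1/3.
   The rule "stop once 1/Y_1 + ... + 1/Y_t >= alpha" with density e^alpha / (e - 1) on [0,1] costs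
   at most e/(e-1) min_t (t + Y_t) - 1/(e-1), since time is discrete; as e <= 3 this surplus absorbs
   the 1/3. Only the breakpoints of alpha matter, so the best one is found by trying all of them,
   and no coin is used. *)

theory Submission
  imports Defs
begin

section \<open>Verifying real RAM programs with time bounds\<close>

text \<open>The running time may depend only on n and the number of scenarios, while the costs are
  arbitrary reals, so an iterative method first needs bounded data. Subtracting the cheapest cost of
  a scenario shifts all strategies alike in that scenario, and an excess above n can be cut off;
  what remains lies between 0 and n. In the prices v the dual objective is
  \<open>(\<Sum>s. v s) - k * max i (\<Sum>s. max 0 (v s - D i s))\<close>. Its subgradient in
  coordinate s is 1, reduced by k if the maximizing box costs less than v s, which is exactly the
  price update. Conversely, the fraction of rounds in which a box is picked, times k, is its
  fractional opening, and a scenario is served in the rounds that hit it. The allowance of 1/3 of a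
  probe is spent as 1/8 on the step length of the ascent and 5/24 on hits that a scenario still
  misses when the ascent ends. An optimal set A enters the analysis only as an adversary; the
  algorithm needs nothing of it but its size.\<close>

definition runs :: "com \<Rightarrow> store \<Rightarrow> nat \<Rightarrow> (store \<Rightarrow> bool) \<Rightarrow> bool" where
  "runs c st T Q \<longleftrightarrow> (\<exists>t st'. exec c st t st' \<and> t \<le> T \<and> Q st')"

primrec nat_writes :: "com \<Rightarrow> vname set" where
  "nat_writes Skip = {}"
| "nat_writes (NAssign x a b e) = {x}"
| "nat_writes (RAssign x a b e) = {}"
| "nat_writes (Seq c1 c2) = nat_writes c1 \<union> nat_writes c2"
| "nat_writes (Cond b c1 c2) = nat_writes c1 \<union> nat_writes c2"
| "nat_writes (While b c) = nat_writes c"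

primrec real_writes :: "com \<Rightarrow> vname set" where
  "real_writes Skip = {}"
| "real_writes (NAssign x a b e) = {}"
| "real_writes (RAssign x a b e) = {x}"
| "real_writes (Seq c1 c2) = real_writes c1 \<union> real_writes c2"
| "real_writes (Cond b c1 c2) = real_writes c1 \<union> real_writes c2"
| "real_writes (While b c) = real_writes c"

text \<open>Footprints are sets of array names, read off the syntax by \<open>nat_writes\<close> and
  \<open>real_writes\<close>. The rules for sequences and loops can then supply for free that all
  other arrays keep their contents.\<close>

definition frame :: "store \<Rightarrow> store \<Rightarrow> vname set \<Rightarrow> vname set \<Rightarrow> bool" where
  "frame st st' X Y \<longleftrightarrow>
     (\<forall>x. x \<notin> X \<longrightarrow> nats st' x = nats st x) \<and> (\<forall>x. x \<notin> Y \<longrightarrow> reals st' x = reals st x)"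

lemma upd_apply: "upd M x i j v x' i' j' = (if x' = x \<and> i' = i \<and> j' = j then v else M x' i' j')"
  by (auto simp: upd_def)

lemma upd_other: "x' \<noteq> x \<Longrightarrow> upd M x i j v x' = M x'"
  by (auto simp: upd_def)

lemma frame_refl: "frame st st X Y"
  by (simp add: frame_def)

lemma frame_trans: "frame st st' X Y \<Longrightarrow> frame st' st'' X' Y' \<Longrightarrow> X \<subseteq> Z \<Longrightarrow> X' \<subseteq> Z \<Longrightarrow>
    Y \<subseteq> Z' \<Longrightarrow> Y' \<subseteq> Z' \<Longrightarrow> frame st st'' Z Z'"
  unfolding frame_def by (metis subsetD)

lemma frame_nupd: "x \<in> X \<Longrightarrow> frame st (st'\<lparr>nats := upd (nats st') x i j v\<rparr>) X Y \<longleftrightarrow> frame st st' X Y"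
  unfolding frame_def by (simp add: upd_def) (metis)

lemma exec_frame: "exec c st t st' \<Longrightarrow> frame st st' (nat_writes c) (real_writes c)"
  by (induction rule: exec.induct) (auto simp: frame_def upd_other)

lemma runs_mono: "runs c st T Q \<Longrightarrow> (\<And>st'. frame st st' (nat_writes c) (real_writes c) \<Longrightarrow> Q st' \<Longrightarrow> Q' st') \<Longrightarrow> T \<le> T' \<Longrightarrow>
    runs c st T' Q'"
  unfolding runs_def using exec_frame by (meson order.trans)

lemma runs_Seq:
  assumes "runs c1 st Ta Q1"
    and "\<And>st1. Q1 st1 \<Longrightarrow> frame st st1 (nat_writes c1) (real_writes c1) \<Longrightarrow> runs c2 st1 Tb Q"
    and "Ta + Tb \<le> T"
  shows "runs (Seq c1 c2) st T Q"
proof -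
  from assms(1) obtain t1 st1 where 1: "exec c1 st t1 st1" "t1 \<le> Ta" "Q1 st1"
    unfolding runs_def by blast
  with assms(2) exec_frame obtain t2 st2 where 2: "exec c2 st1 t2 st2" "t2 \<le> Tb" "Q st2"
    unfolding runs_def by blast
  from 1 2 assms(3) show ?thesis unfolding runs_def
    by (meson add_mono exec.Seq order.trans)
qed

section \<open>Symbolic execution of straight-line code with a time budget\<close>

lemma exec_Skip: "exec Skip st t st' \<longleftrightarrow> t = 1 \<and> st' = st"
  by (blast intro: exec.intros elim: exec.cases)

lemma exec_NAssign: "exec (NAssign x a b e) st t st' \<longleftrightarrow>
    t = 1 \<and> st' = st\<lparr>nats := upd (nats st) x (nval a st) (nval b st) (nval e st)\<rparr>"
  by (blast intro: exec.intros elim: exec.cases)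

lemma exec_RAssign: "exec (RAssign x a b e) st t st' \<longleftrightarrow>
    t = 1 \<and> st' = st\<lparr>reals := upd (reals st) x (nval a st) (nval b st) (rval e st)\<rparr>"
  by (blast intro: exec.intros elim: exec.cases)

lemma exec_Seq: "exec (Seq c1 c2) st t st' \<longleftrightarrow>
    (\<exists>t1 t2 st1. exec c1 st t1 st1 \<and> exec c2 st1 t2 st' \<and> t = t1 + t2)"
  by (blast intro: exec.intros elim: exec.cases)

lemma exec_Cond: "exec (Cond b c1 c2) st t st' \<longleftrightarrow>
    (\<exists>t1. exec (if bval b st then c1 else c2) st t1 st' \<and> t = 1 + t1)"
  by (cases "bval b st"; simp only: if_True if_False) (blast intro: exec.intros elim: exec.cases)+

lemma runs_Skip [simp]: "runs Skip st T Q \<longleftrightarrow> 1 \<le> T \<and> Q st"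
  unfolding runs_def exec_Skip by auto

lemma runs_NAssign [simp]: "runs (NAssign x a b e) st T Q \<longleftrightarrow>
    1 \<le> T \<and> Q (st\<lparr>nats := upd (nats st) x (nval a st) (nval b st) (nval e st)\<rparr>)"
  unfolding runs_def exec_NAssign by auto

lemma runs_RAssign [simp]: "runs (RAssign x a b e) st T Q \<longleftrightarrow>
    1 \<le> T \<and> Q (st\<lparr>reals := upd (reals st) x (nval a st) (nval b st) (rval e st)\<rparr>)"
  unfolding runs_def exec_RAssign by auto

lemma one_add_le_iff: "1 + t \<le> T \<longleftrightarrow> 1 \<le> T \<and> t \<le> T - (1::nat)"
  by auto

lemma runs_Cond [simp]: "runs (Cond b c1 c2) st T Q \<longleftrightarrow>
    1 \<le> T \<and> (if bval b st then runs c1 st (T - 1) Q else runs c2 st (T - 1) Q)"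
proof -
  have "runs (Cond b c1 c2) st T Q \<longleftrightarrow>
      (\<exists>t st'. exec (if bval b st then c1 else c2) st t st' \<and> 1 + t \<le> T \<and> Q st')"
    unfolding runs_def exec_Cond by blast
  also have "\<dots> \<longleftrightarrow> 1 \<le> T \<and> runs (if bval b st then c1 else c2) st (T - 1) Q"
    unfolding runs_def one_add_le_iff by blast
  finally show ?thesis by simp
qed

lemma runs_Seq_iff: "runs (Seq c1 c2) st T Q \<longleftrightarrow>
    (\<exists>t st'. exec c1 st t st' \<and> t \<le> T \<and> runs c2 st' (T - t) Q)"
proof -
  have *: "t1 + t2 \<le> T \<longleftrightarrow> t1 \<le> T \<and> t2 \<le> T - t1" for t1 t2 :: nat by auto
  show ?thesis unfolding runs_def exec_Seq using * by blast
qed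

lemma runs_Seq_Skip [simp]: "runs (Seq Skip c) st T Q \<longleftrightarrow> 1 \<le> T \<and> runs c st (T - 1) Q"
  unfolding runs_Seq_iff exec_Skip by auto

lemma runs_Seq_NAssign [simp]: "runs (Seq (NAssign x a b e) c) st T Q \<longleftrightarrow>
    1 \<le> T \<and> runs c (st\<lparr>nats := upd (nats st) x (nval a st) (nval b st) (nval e st)\<rparr>) (T - 1) Q"
  unfolding runs_Seq_iff[of "NAssign x a b e"] exec_NAssign by auto

lemma runs_Seq_RAssign [simp]: "runs (Seq (RAssign x a b e) c) st T Q \<longleftrightarrow>
    1 \<le> T \<and> runs c (st\<lparr>reals := upd (reals st) x (nval a st) (nval b st) (rval e st)\<rparr>) (T - 1) Q"
  unfolding runs_Seq_iff[of "RAssign x a b e"] exec_RAssign by auto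

text \<open>Reassociating to the right exposes an atomic command at the head, which the simplifier
  can execute while deducting its cost from the budget.\<close>

lemma runs_Seq_Seq [simp]: "runs (Seq (Seq a b) c) st T Q \<longleftrightarrow> runs (Seq a (Seq b c)) st T Q"
proof -
  have "exec (Seq (Seq a b) c) st t st' \<longleftrightarrow> exec (Seq a (Seq b c)) st t st'" for t st'
    unfolding exec_Seq by (metis add.assoc)
  then show ?thesis unfolding runs_def by blast
qed

lemma runs_Seq_Cond [simp]: "runs (Seq (Cond b c1 c2) c) st T Q \<longleftrightarrow>
    1 \<le> T \<and> (if bval b st then runs (Seq c1 c) st (T - 1) Q else runs (Seq c2 c) st (T - 1) Q)"
proof -
  have "exec (Seq (Cond b c1 c2) c) st t st' \<longleftrightarrow>
      exec (Cond b (Seq c1 c) (Seq c2 c)) st t st'" for t st'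
    unfolding exec_Seq exec_Cond by (cases "bval b st"; simp add: exec_Seq) (metis add_Suc)+
  then have "runs (Seq (Cond b c1 c2) c) st T Q = runs (Cond b (Seq c1 c) (Seq c2 c)) st T Q"
    unfolding runs_def by blast
  then show ?thesis by simp
qed

section \<open>Counting, summing and maximizing loops\<close>

abbreviation nv :: "vname \<Rightarrow> nexp" where "nv x \<equiv> NAt x (NConst 0) (NConst 0)"
abbreviation rv :: "vname \<Rightarrow> rexp" where "rv x \<equiv> RAt x (NConst 0) (NConst 0)"
abbreviation nsuc :: "nexp \<Rightarrow> nexp" where "nsuc a \<equiv> NPlus a (NConst 1)"
abbreviation setn :: "vname \<Rightarrow> nexp \<Rightarrow> com" where "setn x \<equiv> NAssign x (NConst 0) (NConst 0)"
abbreviation setr :: "vname \<Rightarrow> rexp \<Rightarrow> com" where "setr x \<equiv> RAssign x (NConst 0) (NConst 0)"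

text \<open>The bound is a real expression because \<open>nexp\<close> has no multiplication, while
  \<open>60 * n ^ 4\<close> rounds have to be counted.\<close>

definition for_loop :: "vname \<Rightarrow> rexp \<Rightarrow> com \<Rightarrow> com" where
  "for_loop x e c = Seq (setn x (NConst 0))
     (While (RLess (RNat (nv x)) e) (Seq c (setn x (nsuc (nv x)))))"

lemma nat_writes_for [simp]: "nat_writes (for_loop x e c) = insert x (nat_writes c)"
  by (auto simp: for_loop_def)

lemma real_writes_for [simp]: "real_writes (for_loop x e c) = real_writes c"
  by (auto simp: for_loop_def)

text \<open>The time consists of one initial assignment, b + 1 tests, and b rounds of body and
  increment. The bound is reevaluated in every test, hence \<open>bnd\<close> covers all states that
  differ from \<open>st\<close> only inside the footprint. The body establishes
  \<open>I (Suc j)\<close> before the counter is incremented, hence \<open>Ix\<close>.\<close>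

lemma runs_for:
  assumes x: "x \<notin> nat_writes c"
    and bnd: "\<And>st'. frame st st' (insert x (nat_writes c)) (real_writes c) \<Longrightarrow> rval e st' = real b"
    and Ix: "\<And>j st v. I j (st\<lparr>nats := upd (nats st) x 0 0 v\<rparr>) = I j st"
    and init: "I 0 st"
    and body: "\<And>j st'. j < b \<Longrightarrow> I j st' \<Longrightarrow> frame st st' (insert x (nat_writes c)) (real_writes c) \<Longrightarrow>
       nats st' x 0 0 = j \<Longrightarrow> runs c st' B (I (Suc j))"
    and T: "2 + b * (B + 2) \<le> T"
  shows "runs (for_loop x e c) st T (I b)"
proof -
  let ?w = "While (RLess (RNat (nv x)) e) (Seq c (setn x (nsuc (nv x))))"
  have "runs ?w st' (1 + q * (B + 2)) (I b)"
    if "q + j = b" "I j st'" "frame st st' (insert x (nat_writes c)) (real_writes c)" "nats st' x 0 0 = j" for q j st'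
    using that
  proof (induction q arbitrary: j st')
    case 0
    then have "\<not> bval (RLess (RNat (nv x)) e) st'" using bnd[of st'] by simp
    from exec.WhileFalse[OF this] 0 show ?case unfolding runs_def by auto
  next
    case (Suc q)
    then have g: "bval (RLess (RNat (nv x)) e) st'" using bnd[of st'] by simp
    from Suc.prems have "j < b" by simp
    from body[OF this Suc.prems(2-4)] obtain t1 st1 where 1: "exec c st' t1 st1" "t1 \<le> B" "I (Suc j) st1"
      unfolding runs_def by blast
    let ?st2 = "st1\<lparr>nats := upd (nats st1) x 0 0 (Suc j)\<rparr>"
    have f1: "frame st' st1 (nat_writes c) (real_writes c)" using exec_frame 1 by blast
    have xx: "nats st1 x 0 0 = j" using f1 x Suc.prems by (simp add: frame_def)
    have f: "frame st ?st2 (insert x (nat_writes c)) (real_writes c)"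
      using frame_trans[OF Suc.prems(3) f1] by (simp add: frame_nupd subset_insertI)
    have "runs ?w ?st2 (1 + q * (B + 2)) (I b)"
      using Suc.prems(1) 1 f by (intro Suc.IH[of "Suc j"]) (auto simp: Ix upd_apply)
    then obtain t2 st2 where 2: "exec ?w ?st2 t2 st2" "t2 \<le> 1 + q * (B + 2)" "I b st2"
      unfolding runs_def by blast
    have "exec (setn x (nsuc (nv x))) st1 1 ?st2"
      using exec.NAssign[of x "NConst 0" "NConst 0" "nsuc (nv x)" st1] xx by simp
    from exec.WhileTrue[OF g exec.Seq[OF 1(1) this] 2(1)]
    have "exec ?w st' (1 + (t1 + 1) + t2) st2" .
    moreover have "1 + (t1 + 1) + t2 \<le> 1 + Suc q * (B + 2)" using 1 2 by simp
    ultimately show ?case using 2 unfolding runs_def by blast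
  qed
  from this[of b 0 "st\<lparr>nats := upd (nats st) x 0 0 0\<rparr>"]
  have "runs ?w (st\<lparr>nats := upd (nats st) x 0 0 0\<rparr>) (1 + b * (B + 2)) (I b)"
    by (simp add: Ix init frame_nupd frame_refl upd_apply)
  then have "runs (for_loop x e c) st (2 + b * (B + 2)) (I b)"
    unfolding for_loop_def by simp
  with T show ?thesis by (blast intro: runs_mono)
qed

definition sum_loop :: "vname \<Rightarrow> vname \<Rightarrow> rexp \<Rightarrow> bexp \<Rightarrow> rexp \<Rightarrow> com" where
  "sum_loop acc x e b r = Seq (setr acc (RNat (NConst 0)))
     (for_loop x e (Cond b (setr acc (RPlus (rv acc) r)) Skip))"

lemma nat_writes_sum_loop [simp]: "nat_writes (sum_loop acc x e b r) = {x}"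
  by (auto simp: sum_loop_def)

lemma real_writes_sum_loop [simp]: "real_writes (sum_loop acc x e b r) = {acc}"
  by (auto simp: sum_loop_def)

lemma runs_sum_loop:
  assumes bnd: "\<And>st'. frame st st' {x} {acc} \<Longrightarrow> rval e st' = real N"
    and ev: "\<And>j st'. j < N \<Longrightarrow> frame st st' {x} {acc} \<Longrightarrow> nats st' x 0 0 = j \<Longrightarrow>
      bval b st' = P j \<and> rval r st' = R j"
    and T: "3 + 4 * N \<le> T"
  shows "runs (sum_loop acc x e b r) st T (\<lambda>st'. reals st' acc 0 0 = (\<Sum>j<N. if P j then R j else 0))"
proof -
  let ?c = "Cond b (setr acc (RPlus (rv acc) r)) Skip"
  let ?st = "st\<lparr>reals := upd (reals st) acc 0 0 0\<rparr>"
  have f: "frame st st' {x} {acc}" if "frame ?st st' (insert x (nat_writes ?c)) (real_writes ?c)" for st'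
    using that by (auto simp: frame_def upd_other)
  have "runs (for_loop x e ?c) ?st (2 + N * (2 + 2))
     (\<lambda>st'. reals st' acc 0 0 = (\<Sum>j<N. if P j then R j else 0))"
  proof (rule runs_for[where b = N and B = 2])
    show "x \<notin> nat_writes ?c" by simp
    show "rval e st' = real N" if "frame ?st st' (insert x (nat_writes ?c)) (real_writes ?c)" for st'
      using bnd f that by blast
    fix j st'
    assume j: "j < N" "reals st' acc 0 0 = (\<Sum>j<j. if P j then R j else 0)"
      "frame ?st st' (insert x (nat_writes ?c)) (real_writes ?c)" "nats st' x 0 0 = j"
    then have "bval b st' = P j \<and> rval r st' = R j" using ev f by blast
    with j show "runs ?c st' 2 (\<lambda>st'. reals st' acc 0 0 = (\<Sum>j<Suc j. if P j then R j else 0))"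
      by (simp add: upd_apply)
  qed (auto simp: upd_apply)
  then show ?thesis using T unfolding sum_loop_def
    by (auto elim!: runs_mono)
qed

text \<open>Not merely some maximizer: the recursion copies the scan of \<open>argmax_loop\<close>,
  including its preference for the smaller index, so that everything defined through it is exactly
  what the program computes.\<close>

primrec argmax :: "(nat \<Rightarrow> real) \<Rightarrow> nat \<Rightarrow> nat" where
  "argmax f 0 = 0"
| "argmax f (Suc b) = (if f (argmax f b) < f b then b else argmax f b)"

lemma argmax_less: "0 < b \<Longrightarrow> argmax f b < b"
proof (induction b)
  case (Suc b)
  then show ?case by (cases b) auto
qed simp

lemma argmax_ge: "j < b \<Longrightarrow> f j \<le> f (argmax f b)"
  by (induction b) (auto simp: less_Suc_eq not_less intro: order.trans less_imp_le)

lemma argmax_le: "argmax f b \<le> b"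
  using argmax_less[of b f] by (cases "b = 0") auto

definition argmax_loop :: "vname \<Rightarrow> vname \<Rightarrow> rexp \<Rightarrow> vname \<Rightarrow> vname \<Rightarrow> com \<Rightarrow> com" where
  "argmax_loop y x e vals acc c = Seq (setn y (NConst 0)) (for_loop x e
     (Seq c (Seq (RAssign vals (nv x) (NConst 0) (rv acc))
       (Cond (RLess (RAt vals (nv y) (NConst 0)) (RAt vals (nv x) (NConst 0)))
         (setn y (nv x)) Skip))))"

lemma nat_writes_argmax_loop [simp]: "nat_writes (argmax_loop y x e vals acc c) = insert x (insert y (nat_writes c))"
  by (auto simp: argmax_loop_def)

lemma real_writes_argmax_loop [simp]: "real_writes (argmax_loop y x e vals acc c) = insert vals (real_writes c)"
  by (auto simp: argmax_loop_def)

text \<open>\<open>J\<close> carries what the body produces besides its value. By \<open>Jn\<close>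
  it has to survive changes of the counter, of the current maximizer and of the table
  \<open>vals\<close>, which the loop itself writes.\<close>

lemma runs_argmax_loop:
  assumes d: "x \<notin> nat_writes c" "y \<notin> nat_writes c" "x \<noteq> y" "vals \<notin> real_writes c"
    and bnd: "\<And>st'. frame st st' (insert x (insert y (nat_writes c))) (insert vals (real_writes c)) \<Longrightarrow> rval e st' = real N"
    and Jn: "\<And>j s s'. J j s \<Longrightarrow> frame s s' {x, y} {vals} \<Longrightarrow> J j s'"
    and J0: "J 0 st"
    and body: "\<And>j st'. j < N \<Longrightarrow> J j st' \<Longrightarrow>
       frame st st' (insert x (insert y (nat_writes c))) (insert vals (real_writes c)) \<Longrightarrow> nats st' x 0 0 = j \<Longrightarrow>
       runs c st' B (\<lambda>st''. reals st'' acc 0 0 = f j \<and> J (Suc j) st'')"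
    and T: "3 + N * (B + 5) \<le> T"
  shows "runs (argmax_loop y x e vals acc c) st T (\<lambda>st'. nats st' y 0 0 = argmax f N \<and> J N st' \<and>
           (\<forall>i<N. reals st' vals i 0 = f i))"
proof -
  let ?t = "Seq (RAssign vals (nv x) (NConst 0) (rv acc))
       (Cond (RLess (RAt vals (nv y) (NConst 0)) (RAt vals (nv x) (NConst 0)))
         (setn y (nv x)) Skip)"
  let ?c = "Seq c ?t"
  let ?I = "\<lambda>b st'. nats st' y 0 0 = argmax f b \<and> J b st' \<and> (\<forall>i<b. reals st' vals i 0 = f i)"
  let ?st = "st\<lparr>nats := upd (nats st) y 0 0 0\<rparr>"
  have f: "frame st st' (insert x (insert y (nat_writes c))) (insert vals (real_writes c))"
    if "frame ?st st' (insert x (nat_writes ?c)) (real_writes ?c)" for st'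
    using that by (auto simp: frame_def upd_other)
  have "runs (for_loop x e ?c) ?st (2 + N * ((B + 3) + 2)) (?I N)"
  proof (rule runs_for[where b = N and B = "B + 3"])
    show "x \<notin> nat_writes ?c" using d by simp
    show "rval e st' = real N" if "frame ?st st' (insert x (nat_writes ?c)) (real_writes ?c)" for st'
      using bnd f that by blast
    show "?I 0 ?st" using Jn[OF J0, of ?st] by (simp add: upd_apply frame_def upd_other)
    show "?I j (st\<lparr>nats := upd (nats st) x 0 0 v\<rparr>) = ?I j st" for j st v
      using d Jn[of j st "st\<lparr>nats := upd (nats st) x 0 0 v\<rparr>"] Jn[of j "st\<lparr>nats := upd (nats st) x 0 0 v\<rparr>" st]
      by (auto simp: upd_apply frame_def upd_other)
    fix j st'
    assume j: "j < N" "?I j st'"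
      "frame ?st st' (insert x (nat_writes ?c)) (real_writes ?c)" "nats st' x 0 0 = j"
    show "runs ?c st' (B + 3) (?I (Suc j))"
    proof (rule runs_Seq[where Tb = 3, OF body[of j st']])
      fix st1 assume h: "reals st1 acc 0 0 = f j \<and> J (Suc j) st1" and fr: "frame st' st1 (nat_writes c) (real_writes c)"
      have 1: "nats st1 x 0 0 = j" "nats st1 y 0 0 = argmax f j" "\<forall>i<j. reals st1 vals i 0 = f i"
        using j fr d by (auto simp: frame_def)
      \<comment> \<open>\<open>argmax f j = j\<close> happens only for j = 0, where the new table
        entry is compared with itself.\<close>
      have a: "reals st1 vals (argmax f j) 0 = f (argmax f j)" if "argmax f j \<noteq> j"
        using 1 argmax_le[of f j] that by (simp add: le_neq_implies_less)
      have J: "J (Suc (nats st1 x 0 0)) s'" if "frame st1 s' {x, y} {vals}" for s'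
        using h Jn that 1(1) by blast
      show "runs ?t st1 3 (?I (Suc j))"
        using h 1 a by (auto simp: upd_apply less_Suc_eq frame_def upd_other intro!: J)
    qed (use j f in auto)
  qed simp
  then show ?thesis using T unfolding argmax_loop_def
    by (auto elim!: runs_mono simp: algebra_simps)
qed

section \<open>The stopping rule\<close>

text \<open>Costs are numbered from 0, so t probes reveal c 0, ..., c (t - 1). The value at t = 0
  only starts the recursion; \<open>run_min c 1\<close> is again \<open>c 0\<close>.\<close>

primrec run_min :: "(nat \<Rightarrow> real) \<Rightarrow> nat \<Rightarrow> real" where
  "run_min c 0 = c 0"
| "run_min c (Suc t) = min (run_min c t) (c t)"

text \<open>The clock of the ski-rental rule: at price Y a probe advances it by 1 / Y, so that price
  times advance is the cost of one probe.\<close>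

primrec recip_sum :: "(nat \<Rightarrow> real) \<Rightarrow> nat \<Rightarrow> real" where
  "recip_sum c 0 = 0"
| "recip_sum c (Suc t) = recip_sum c t + 1 / run_min c (Suc t)"

text \<open>Multiplying out avoids the junk value 1 / 0 = 0 in \<open>recip_sum\<close>: a box of cost 0 always stops.\<close>

definition stops :: "(nat \<Rightarrow> real) \<Rightarrow> real \<Rightarrow> nat \<Rightarrow> bool" where
  "stops c \<alpha> t \<longleftrightarrow> run_min c t * (\<alpha> - recip_sum c (t - 1)) \<le> 1"

text \<open>The cost of the stopping rule when at most \<open>r\<close> further probes are possible after
  the first \<open>t\<close> ones.\<close>

primrec stop_cost :: "(nat \<Rightarrow> real) \<Rightarrow> real \<Rightarrow> nat \<Rightarrow> nat \<Rightarrow> real" where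
  "stop_cost c \<alpha> 0 t = real t + run_min c t"
| "stop_cost c \<alpha> (Suc r) t = (if stops c \<alpha> t then real t + run_min c t else stop_cost c \<alpha> r (Suc t))"

lemma run_min_nonneg: "(\<And>t. 0 \<le> c t) \<Longrightarrow> 0 \<le> run_min c t"
  by (induction t) auto

lemma recip_sum_nonneg: "(\<And>t. 0 \<le> c t) \<Longrightarrow> 0 \<le> recip_sum c t"
  by (induction t) (auto simp: run_min_nonneg simp del: run_min.simps)

lemma stops_Suc_iff:
  assumes "\<And>t. 0 \<le> c t"
  shows "stops c \<alpha> (Suc u) \<longleftrightarrow> run_min c (Suc u) = 0 \<or> \<alpha> \<le> recip_sum c (Suc u)"
proof (cases "run_min c (Suc u) = 0")
  case False
  then have "0 < run_min c (Suc u)" using run_min_nonneg[of c "Suc u", OF assms] by linarith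
  then show ?thesis unfolding stops_def by (simp add: field_simps del: run_min.simps)
qed (simp add: stops_def del: run_min.simps)

text \<open>One more probe raises the rent by 1 and advances the clock by 1 / y, which lowers y
  times the remaining distance by 1. The bound is therefore conserved until the rule stops, and a
  falling price can only decrease it.\<close>

lemma stop_cost_le:
  assumes c: "\<And>t. 0 \<le> c t" and "recip_sum c u \<le> \<alpha>"
  shows "stop_cost c \<alpha> r (Suc u) \<le> real (Suc u) + run_min c (Suc u) * (1 + \<alpha> - recip_sum c u)"
  using assms(2)
proof (induction r arbitrary: u)
  case 0
  have "0 \<le> run_min c (Suc u) * (\<alpha> - recip_sum c u)" using 0 run_min_nonneg[of c "Suc u", OF c]
    by (intro mult_nonneg_nonneg) auto
  then show ?case by (simp add: algebra_simps del: run_min.simps)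
next
  case (Suc r)
  show ?case
  proof (cases "stops c \<alpha> (Suc u)")
    case True
    have "0 \<le> run_min c (Suc u) * (\<alpha> - recip_sum c u)" using Suc.prems run_min_nonneg[of c "Suc u", OF c]
      by (intro mult_nonneg_nonneg) auto
    with True show ?thesis by (simp add: algebra_simps del: run_min.simps)
  next
    case False
    define y where "y = run_min c (Suc u)"
    have y: "0 < y" and a: "recip_sum c (Suc u) \<le> \<alpha>"
      using False run_min_nonneg[of c "Suc u", OF c] unfolding stops_Suc_iff[of c, OF c] y_def by linarith+
    have A: "recip_sum c (Suc u) = recip_sum c u + 1 / y" by (simp add: y_def)
    have "stop_cost c \<alpha> r (Suc (Suc u)) \<le> real (Suc (Suc u)) + run_min c (Suc (Suc u)) * (1 + \<alpha> - recip_sum c (Suc u))"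
      by (rule Suc.IH[OF a])
    also have "run_min c (Suc (Suc u)) * (1 + \<alpha> - recip_sum c (Suc u)) \<le> y * (1 + \<alpha> - recip_sum c (Suc u))"
      using a by (intro mult_right_mono) (auto simp: y_def)
    also have "real (Suc (Suc u)) + y * (1 + \<alpha> - recip_sum c (Suc u)) = real (Suc u) + y * (1 + \<alpha> - recip_sum c u)"
      using y unfolding A by (simp add: field_simps)
    finally show ?thesis using False by (simp add: y_def del: run_min.simps recip_sum.simps)
  qed
qed

section \<open>Averaging over the threshold with density proportional to exp\<close>

lemma has_integral_affine_exp:
  fixes a p q :: real
  assumes "a \<le> b"
  shows "((\<lambda>x. (p + q + q * (x - a)) * exp x) has_integral (p + q * (b - a)) * exp b - p * exp a) {a..b}"
proof -
  have "((\<lambda>x. (p + q + q * (x - a)) * exp x) has_integral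
      (p + q * (b - a)) * exp b - (p + q * (a - a)) * exp a) {a..b}"
    using assms
    by (intro fundamental_theorem_of_calculus)
      (auto intro!: derivative_eq_intros simp: has_real_derivative_iff_has_vector_derivative[symmetric] algebra_simps)
  then show ?thesis by simp
qed

lemma has_integral_const_exp:
  fixes a p :: real
  assumes "a \<le> b"
  shows "((\<lambda>x. p * exp x) has_integral p * (exp b - exp a)) {a..b}"
  using has_integral_affine_exp[OF assms, of p 0] by (simp add: algebra_simps)

text \<open>Convexity: the tangent at x lies below the graph. The integral bound uses the tangents
  at 1 and at the end of the current clock step.\<close>

lemma exp_tangent: "exp x * (1 + (y - x)) \<le> exp (y::real)"
  using exp_ge_add_one_self[of "y - x"] mult_left_mono[of "1 + (y - x)" "exp (y - x)" "exp x"]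
  by (simp add: exp_add[symmetric])

text \<open>This is the ski-rental argument with a falling price. A threshold with density proportional
  to \<open>exp \<alpha>\<close> makes the rent and the expected purchases of each step cost at most a factor e in total;
  the term \<open>- exp (recip_sum c u)\<close> is the gain from moving in unit steps. It pays for all
  additive errors of the algorithm.\<close>

lemma stop_cost_integral:
  assumes c: "\<And>t. 0 \<le> c t" and "recip_sum c u \<le> 1"
  shows "\<exists>I. ((\<lambda>\<alpha>. stop_cost c \<alpha> r (Suc u) * exp \<alpha>) has_integral I) {recip_sum c u..1} \<and>
    (\<forall>v. u \<le> v \<and> v \<le> u + r \<longrightarrow>
      I \<le> real u * (exp 1 - exp (recip_sum c u)) + exp 1 * real (Suc v - u) - exp (recip_sum c u) + exp 1 * run_min c (Suc v))"
  using assms(2)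
proof (induction r arbitrary: u)
  case (0 u)
  define a y where "a = recip_sum c u" and "y = run_min c (Suc u)"
  have a: "0 \<le> a" "a \<le> 1" and y: "0 \<le> y" using recip_sum_nonneg[of c u, OF c] run_min_nonneg[of c "Suc u", OF c] 0
    by (auto simp: a_def y_def)
  have "exp 1 * a \<le> exp a" using exp_tangent[of 1 a] by simp
  then have "y * (exp 1 - exp a) \<le> y * exp 1" using y by (intro mult_left_mono) auto
  then have "(real u + 1 + y) * (exp 1 - exp a) \<le> real u * (exp 1 - exp a) + exp 1 - exp a + exp 1 * y"
    by (simp add: algebra_simps)
  then show ?case using has_integral_const_exp[OF a(2), of "real (Suc u) + y"]
    by (intro exI[of _ "(real (Suc u) + y) * (exp 1 - exp a)"])
       (auto simp: a_def y_def algebra_simps simp del: run_min.simps)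
next
  case (Suc r u)
  define a y where "a = recip_sum c u" and "y = run_min c (Suc u)"
  have a: "0 \<le> a" "a \<le> 1" and y: "0 \<le> y" using recip_sum_nonneg[of c u, OF c] run_min_nonneg[of c "Suc u", OF c] Suc.prems
    by (auto simp: a_def y_def)
  \<comment> \<open>The comparison time v = u, needed in both cases below:
    \<open>stop_cost_le\<close> is integrated against exp.\<close>
  have now: "I \<le> real u * (exp 1 - exp a) + exp 1 - exp a + exp 1 * y"
    if "((\<lambda>\<alpha>. stop_cost c \<alpha> (Suc r) (Suc u) * exp \<alpha>) has_integral I) {a..1}" for I
  proof -
    have "I \<le> (real (Suc u) + y * (1 - a)) * exp 1 - real (Suc u) * exp a"
    proof (rule has_integral_le[OF that has_integral_affine_exp[OF a(2)]])
      fix \<alpha> assume "\<alpha> \<in> {a..1}"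
      then show "stop_cost c \<alpha> (Suc r) (Suc u) * exp \<alpha> \<le> (real (Suc u) + y + y * (\<alpha> - a)) * exp \<alpha>"
        using stop_cost_le[of c u \<alpha> "Suc r", OF c]
        by (intro mult_right_mono) (auto simp: a_def y_def algebra_simps simp del: run_min.simps stop_cost.simps)
    qed
    moreover have "0 \<le> y * a * exp 1" using a y by simp
    ultimately show ?thesis by (simp add: algebra_simps)
  qed
  show ?case
  \<comment> \<open>Either the clock reaches 1 in this step and every remaining threshold stops now,
    or the thresholds split at a + 1 / y. The product form puts y = 0 into the first case.\<close>
  proof (cases "y * (1 - a) \<le> 1")
    case True
    let ?I = "(real (Suc u) + y) * (exp 1 - exp a)"
    have I: "((\<lambda>\<alpha>. stop_cost c \<alpha> (Suc r) (Suc u) * exp \<alpha>) has_integral ?I) {a..1}"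
    proof (rule has_integral_eq[OF _ has_integral_const_exp[OF a(2)]])
      fix \<alpha> assume "\<alpha> \<in> {a..1}"
      then have "y * (\<alpha> - a) \<le> y * (1 - a)" using y by (intro mult_left_mono) auto
      then have "stops c \<alpha> (Suc u)" using True by (simp add: stops_def a_def y_def del: run_min.simps)
      then show "(real (Suc u) + y) * exp \<alpha> = stop_cost c \<alpha> (Suc r) (Suc u) * exp \<alpha>"
        by (simp add: y_def del: run_min.simps)
    qed
    have "?I \<le> real u * (exp 1 - exp a) + exp 1 * real (Suc v - u) - exp a + exp 1 * run_min c (Suc v)"
      if v: "u < v" for v
    proof -
      have "y * (exp 1 - exp a) \<le> y * (exp 1 * (1 - a))"
        using exp_tangent[of 1 a] y by (intro mult_left_mono) (auto simp: algebra_simps)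
      also have "\<dots> \<le> exp 1" using True mult_left_mono[OF True, of "exp 1"] by (simp add: algebra_simps)
      finally have "?I \<le> real u * (exp 1 - exp a) + exp 1 * 2 - exp a" by (simp add: algebra_simps)
      \<comment> \<open>As u < v, at least two units of exp 1 are available: one for the rent of
        this step and one for the purchases.\<close>
      moreover have "exp 1 * 2 \<le> exp 1 * real (Suc v - u)" using v by (intro mult_left_mono) auto
      moreover have "0 \<le> exp 1 * run_min c (Suc v)" using run_min_nonneg[of c "Suc v", OF c] by simp
      ultimately show ?thesis by linarith
    qed
    moreover have "?I \<le> real u * (exp 1 - exp a) + exp 1 * real (Suc v - u) - exp a + exp 1 * run_min c (Suc v)"
      if v: "u = v" for v using now[OF I] v by (simp add: y_def del: run_min.simps)
    ultimately have "?I \<le> real u * (exp 1 - exp a) + exp 1 * real (Suc v - u) - exp a + exp 1 * run_min c (Suc v)"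
      if "u \<le> v \<and> v \<le> u + Suc r" for v using that le_neq_implies_less[of u v] by blast
    with I show ?thesis unfolding a_def by blast
  next
    case False
    then have y0: "0 < y" using y by (cases "y = 0") auto
    define a' where "a' = a + 1 / y"
    have A: "recip_sum c (Suc u) = a'" by (simp add: a_def y_def a'_def)
    have a': "a \<le> a'" "a' \<le> 1" using False y0 by (auto simp: a'_def field_simps)
    obtain I' where I': "((\<lambda>\<alpha>. stop_cost c \<alpha> r (Suc (Suc u)) * exp \<alpha>) has_integral I') {a'..1}"
      and le: "\<And>v. Suc u \<le> v \<Longrightarrow> v \<le> Suc u + r \<Longrightarrow>
        I' \<le> real (Suc u) * (exp 1 - exp a') + exp 1 * real (Suc v - Suc u) - exp a' + exp 1 * run_min c (Suc v)"
      using Suc.IH[of "Suc u"] a' unfolding A by blast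
    let ?I = "(real (Suc u) + y) * (exp a' - exp a) + I'"
    have st: "stops c \<alpha> (Suc u) \<longleftrightarrow> \<alpha> \<le> a'" for \<alpha>
      unfolding stops_Suc_iff[of c, OF c] using y0 A by (simp add: y_def del: run_min.simps recip_sum.simps)
    have 1: "((\<lambda>\<alpha>. stop_cost c \<alpha> (Suc r) (Suc u) * exp \<alpha>) has_integral (real (Suc u) + y) * (exp a' - exp a)) {a..a'}"
      by (rule has_integral_eq[OF _ has_integral_const_exp[OF a'(1)]])
         (auto simp: st y_def simp del: run_min.simps)
    \<comment> \<open>At \<alpha> = a' the rule still stops at once, so the two integrands may
      differ at this single point.\<close>
    have 2: "((\<lambda>\<alpha>. stop_cost c \<alpha> (Suc r) (Suc u) * exp \<alpha>) has_integral I') {a'..1}"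
      by (rule has_integral_spike_finite[OF _ _ I', of "{a'}"]) (auto simp: st)
    have I: "((\<lambda>\<alpha>. stop_cost c \<alpha> (Suc r) (Suc u) * exp \<alpha>) has_integral ?I) {a..1}"
      by (rule has_integral_combine[OF a' 1 2])
    have "?I \<le> real u * (exp 1 - exp a) + exp 1 * real (Suc v - u) - exp a + exp 1 * run_min c (Suc v)"
      if v: "u < v" "v \<le> u + Suc r" for v
    proof -
      \<comment> \<open>The tangent at a' bounds the purchases of this step, y (exp a' - exp a), by
        exp a', which the term - exp a' of the induction hypothesis absorbs exactly.\<close>
      have "exp a' * (1 - 1 / y) \<le> exp a" using exp_tangent[of a' a] by (simp add: a'_def)
      then have "y * (exp a' * (1 - 1 / y)) \<le> y * exp a" using y by (intro mult_left_mono)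
      moreover have "y * (exp a' * (1 - 1 / y)) = exp a' * (y - 1)" using y0 by (simp add: algebra_simps)
      ultimately have "y * (exp a' - exp a) \<le> exp a'" by (simp add: algebra_simps)
      moreover have "real (Suc v - u) = 1 + real (Suc v - Suc u)" using v by auto
      ultimately show ?thesis using le[of v] v by (simp add: algebra_simps del: run_min.simps)
    qed
    moreover have "?I \<le> real u * (exp 1 - exp a) + exp 1 * real (Suc v - u) - exp a + exp 1 * run_min c (Suc v)"
      if v: "u = v" for v using now[OF I] v by (simp add: y_def del: run_min.simps)
    ultimately have "?I \<le> real u * (exp 1 - exp a) + exp 1 * real (Suc v - u) - exp a + exp 1 * run_min c (Suc v)"
      if "u \<le> v \<and> v \<le> u + Suc r" for v using that le_neq_implies_less[of u v] by blast
    with I show ?thesis unfolding a_def by blast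
  qed
qed

section \<open>Reduction to finitely many thresholds\<close>

lemma candidate_threshold:
  fixes c :: "nat \<Rightarrow> nat \<Rightarrow> real" and m n :: nat
  assumes c: "\<And>s t. s < m \<Longrightarrow> 0 \<le> c s t" and \<alpha>: "\<alpha> \<le> 1"
  obtains \<beta> where "\<beta> = 1 \<or> (\<exists>s<m. \<exists>t\<in>{1..n}. \<beta> = recip_sum (c s) t)"
    and "\<And>s r u. s < m \<Longrightarrow> u + r < n \<Longrightarrow> stop_cost (c s) \<beta> r (Suc u) = stop_cost (c s) \<alpha> r (Suc u)"
proof -
  define B where "B = {a \<in> (\<lambda>(s, t). recip_sum (c s) t) ` ({..<m} \<times> {1..n}). \<alpha> \<le> a}"
  have "finite ((\<lambda>(s, t). recip_sum (c s) t) ` ({..<m} \<times> {1..n}))"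
    by (intro finite_imageI finite_cartesian_product) simp_all
  then have fin: "finite B" unfolding B_def by (rule rev_finite_subset) auto
  \<comment> \<open>Raising \<alpha> to the next breakpoint passes no other one, so all decisions
    stay the same. If no breakpoint lies at or above \<alpha>, all thresholds from \<alpha> on
    behave alike and 1 is taken.\<close>
  define \<beta> where "\<beta> = (if B = {} then 1 else Min B)"
  have \<beta>: "\<beta> = 1 \<and> B = {} \<or> \<beta> \<in> B" using Min_in[OF fin] by (auto simp: \<beta>_def)
  have BD: "\<alpha> \<le> b \<and> (\<exists>s<m. \<exists>t\<in>{1..n}. b = recip_sum (c s) t)" if "b \<in> B" for b
    using that unfolding B_def by (auto simp: image_iff)
  have ge: "\<alpha> \<le> \<beta>" using \<alpha> \<beta> BD by blast
  have chosen_box: "\<beta> = 1 \<or> (\<exists>s<m. \<exists>t\<in>{1..n}. \<beta> = recip_sum (c s) t)"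
    using \<beta> BD by blast
  have st: "stops (c s) \<beta> (Suc u) = stops (c s) \<alpha> (Suc u)" if s: "s < m" and u: "u < n" for s u
  proof -
    have "\<beta> \<le> recip_sum (c s) (Suc u)" if "\<alpha> \<le> recip_sum (c s) (Suc u)"
    proof -
      have "recip_sum (c s) (Suc u) \<in> B"
        using that s u unfolding B_def by (auto intro!: image_eqI[of _ _ "(s, Suc u)"] simp del: recip_sum.simps)
      then show ?thesis using fin by (auto simp: \<beta>_def)
    qed
    then show ?thesis using ge stops_Suc_iff[of "c s", OF c[OF s]] by auto
  qed
  have "stop_cost (c s) \<beta> r (Suc u) = stop_cost (c s) \<alpha> r (Suc u)" if "s < m" "u + r < n" for s r u
    using that by (induction r arbitrary: u) (auto simp: st simp del: run_min.simps)
  then show thesis using chosen_box that by blast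
qed

text \<open>If no candidate beats V, then no threshold in [0, 1] does, and the constant V integrates
  against exp to V (exp 1 - 1). The times \<open>t s\<close> may be chosen with knowledge of the
  scenario; each scenario contributes a surplus of 1.\<close>

lemma best_threshold:
  fixes c :: "nat \<Rightarrow> nat \<Rightarrow> real" and m n :: nat
  assumes c: "\<And>s t. s < m \<Longrightarrow> 0 \<le> c s t" and n: "0 < n"
    and opt: "\<And>\<beta>. \<beta> = 1 \<or> (\<exists>s<m. \<exists>t\<in>{1..n}. \<beta> = recip_sum (c s) t) \<Longrightarrow> V \<le> (\<Sum>s<m. stop_cost (c s) \<beta> (n - 1) 1)"
    and t: "\<And>s. s < m \<Longrightarrow> t s \<in> {1..n}"
  shows "V * (exp 1 - 1) \<le> exp 1 * (\<Sum>s<m. real (t s) + run_min (c s) (t s)) - real m"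
proof -
  have "\<exists>I. ((\<lambda>\<alpha>. stop_cost (c s) \<alpha> (n - 1) 1 * exp \<alpha>) has_integral I) {0..1} \<and>
      I \<le> exp 1 * (real (t s) + run_min (c s) (t s)) - 1" if s: "s < m" for s
  proof -
    obtain v where v: "t s = Suc v" "v \<le> n - 1" using t[OF s] by (cases "t s") auto
    from stop_cost_integral[of "c s" 0 "n - 1"] c[OF s] v show ?thesis
      by (force simp: algebra_simps simp del: run_min.simps)
  qed
  then obtain I where I: "\<And>s. s < m \<Longrightarrow> ((\<lambda>\<alpha>. stop_cost (c s) \<alpha> (n - 1) 1 * exp \<alpha>) has_integral I s) {0..1}"
    "\<And>s. s < m \<Longrightarrow> I s \<le> exp 1 * (real (t s) + run_min (c s) (t s)) - 1" by metis
  have 1: "((\<lambda>\<alpha>. \<Sum>s<m. stop_cost (c s) \<alpha> (n - 1) 1 * exp \<alpha>) has_integral (\<Sum>s<m. I s)) {0..1}"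
    using I(1) by (intro has_integral_sum) auto
  have 2: "((\<lambda>\<alpha>. V * exp \<alpha>) has_integral V * (exp 1 - exp 0)) {0..1}"
    by (rule has_integral_const_exp) simp
  have "V * (exp 1 - exp 0) \<le> (\<Sum>s<m. I s)"
  proof (rule has_integral_le[OF 2 1])
    fix \<alpha> :: real assume \<alpha>: "\<alpha> \<in> {0..1}"
    then have "\<alpha> \<le> 1" by simp
    from candidate_threshold[where m = m and c = c and n = n, OF c this]
    obtain \<beta> where \<beta>0: "\<beta> = 1 \<or> (\<exists>s<m. \<exists>t\<in>{1..n}. \<beta> = recip_sum (c s) t)"
      and \<beta>: "\<And>s r u. s < m \<Longrightarrow> u + r < n \<Longrightarrow> stop_cost (c s) \<beta> r (Suc u) = stop_cost (c s) \<alpha> r (Suc u)"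
      by blast
    have "V \<le> (\<Sum>s<m. stop_cost (c s) \<beta> (n - 1) 1)" using opt[OF \<beta>0] .
    also have "\<dots> = (\<Sum>s<m. stop_cost (c s) \<alpha> (n - 1) 1)"
      using \<beta>[of _ 0 "n - 1"] n by (intro sum.cong) auto
    finally show "V * exp \<alpha> \<le> (\<Sum>s<m. stop_cost (c s) \<alpha> (n - 1) 1 * exp \<alpha>)"
      by (simp add: sum_distrib_right[symmetric])
  qed
  also have "\<dots> \<le> (\<Sum>s<m. exp 1 * (real (t s) + run_min (c s) (t s)) - 1)"
    by (rule sum_mono) (auto intro: I)
  finally show ?thesis by (simp add: sum_subtractf sum_distrib_left)
qed

section \<open>Dual ascent and rounding\<close>

text \<open>The number of rounds is \<open>12 n * 5 n ^ 3\<close>. The dual prices stay below \<open>5 n ^ 3\<close>, so that a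
  scenario loses at most the fraction \<open>1 / (12 n)\<close> of its hits.\<close>

definition rounds :: "nat \<Rightarrow> nat" where
  "rounds n = 60 * n ^ 4"

context
  fixes n m :: nat and D :: "nat \<Rightarrow> nat \<Rightarrow> real"
begin

text \<open>For a guessed size \<open>k\<close> of the optimal set, \<open>dual_price k j s\<close> is the price offered by scenario
  \<open>s\<close> in round \<open>j\<close>: it rises by 1 per round and drops by \<open>k\<close> whenever the picked box is cheaper.\<close>

definition pick :: "(nat \<Rightarrow> real) \<Rightarrow> nat" where
  "pick v = Suc (argmax (\<lambda>i. \<Sum>s<m. if D (Suc i) s < v s then v s - D (Suc i) s else 0) n)"

primrec dual_price :: "nat \<Rightarrow> nat \<Rightarrow> nat \<Rightarrow> real" where
  "dual_price k 0 = (\<lambda>s. 0)"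
| "dual_price k (Suc j) = (\<lambda>s. dual_price k j s + 1 - (if D (pick (dual_price k j)) s < dual_price k j s then real k else 0))"

definition hit :: "nat \<Rightarrow> nat \<Rightarrow> nat \<Rightarrow> bool" where
  "hit k j s \<longleftrightarrow> D (pick (dual_price k j)) s < dual_price k j s"

definition hit_count :: "nat \<Rightarrow> nat \<Rightarrow> real" where
  "hit_count k s = (\<Sum>j<rounds n. if hit k j s then 1 else 0)"

definition hit_cost :: "nat \<Rightarrow> nat \<Rightarrow> real" where
  "hit_cost k s = (\<Sum>j<rounds n. if hit k j s then D (pick (dual_price k j)) s else 0)"

text \<open>The expected cost of a scenario under boxes from uniformly random rounds, stopping at
  the first hit; one probe costs \<open>4 n ^ 2\<close>.\<close>

definition est_cost :: "nat \<Rightarrow> nat \<Rightarrow> real" where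
  "est_cost k s = (4 * real n * real n * real (rounds n) + hit_cost k s) / hit_count k s"

text \<open>The maximized quantity is a saving: a newly hit scenario exchanges its estimated cost
  for that of the box that hits it.\<close>

definition best_round :: "nat \<Rightarrow> nat set \<Rightarrow> nat" where
  "best_round k X = argmax (\<lambda>j. \<Sum>s<m. if s \<notin> X \<and> hit k j s then est_cost k s - D (pick (dual_price k j)) s else 0) (rounds n)"

primrec stopped :: "nat \<Rightarrow> nat \<Rightarrow> nat set" where
  "stopped k 0 = {}"
| "stopped k (Suc p) = stopped k p \<union> {s. s < m \<and> hit k (best_round k (stopped k p)) s}"

definition chosen_box :: "nat \<Rightarrow> nat \<Rightarrow> nat" where
  "chosen_box k p = pick (dual_price k (best_round k (stopped k p)))"

end

lemma pick_range: "1 \<le> n \<Longrightarrow> pick n m D v \<in> {1..n}"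
  by (auto simp: pick_def Suc_le_eq intro!: argmax_less)

section \<open>Convergence of the dual ascent\<close>

locale dual_ascent =
  fixes n m :: nat and D :: "nat \<Rightarrow> nat \<Rightarrow> real" and A :: "nat set" and best :: "nat \<Rightarrow> nat" and k :: nat
  assumes n: "1 \<le> n"
    and D_nonneg: "\<And>i s. i \<in> {1..n} \<Longrightarrow> s < m \<Longrightarrow> 0 \<le> D i s"
    and D_le: "\<And>i s. i \<in> {1..n} \<Longrightarrow> s < m \<Longrightarrow> D i s \<le> 4 * real n ^ 3"
    and A: "A \<subseteq> {1..n}" "card A = k" "A \<noteq> {}"
    and best: "\<And>s. s < m \<Longrightarrow> best s \<in> A"
begin

abbreviation "N \<equiv> rounds n"
abbreviation "V \<equiv> dual_price n m D k"
abbreviation "pk j \<equiv> pick n m D (V j)"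
abbreviation "h \<equiv> hit n m D k"
abbreviation "U \<equiv> est_cost n m D k"
abbreviation "L \<equiv> 4 * real n * real n"

lemma finA: "finite A"
  using A finite_subset by blast

lemma k: "1 \<le> k" "k \<le> n"
  using A finA card_mono[of "{1..n}" A] by (auto simp: Suc_le_eq card_gt_0_iff)

lemma V_Suc: "V (Suc j) s = V j s + 1 - real k * (if h j s then 1 else 0)"
  by (simp add: hit_def)

text \<open>A price rises only in a round that does not hit, where it is at most the cost of the
  picked box; a hit changes it by 1 - k, which is not positive.\<close>

lemma V_le: "s < m \<Longrightarrow> V j s \<le> 4 * real n ^ 3 + 1"
proof (induction j)
  case (Suc j)
  show ?case
  proof (cases "h j s")
    case True
    then show ?thesis using Suc k by (simp add: V_Suc del: dual_price.simps)
  next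
    case False
    then have "V j s \<le> D (pk j) s" by (simp add: hit_def)
    also have "\<dots> \<le> 4 * real n ^ 3" using D_le[OF pick_range[OF n] Suc.prems] .
    finally show ?thesis using False by (simp add: V_Suc del: dual_price.simps)
  qed
qed simp

text \<open>The profit v s - D (best s) s of every scenario is covered by its own box in A, and A
  has k boxes, so the most profitable box earns at least a 1/k share of the total.\<close>

lemma pick_good:
  "(\<Sum>s<m. v s - D (best s) s) \<le>
    real k * (\<Sum>s<m. if D (pick n m D v) s < v s then v s - D (pick n m D v) s else 0)"
proof -
  define f where "f i = (\<Sum>s<m. if D i s < v s then v s - D i s else 0)" for i
  have "(\<Sum>s<m. v s - D (best s) s) \<le> (\<Sum>s<m. \<Sum>i\<in>A. if D i s < v s then v s - D i s else 0)"
  proof (rule sum_mono)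
    fix s assume "s \<in> {..<m}"
    then have b: "best s \<in> A" using best by auto
    have "v s - D (best s) s \<le> (if D (best s) s < v s then v s - D (best s) s else 0)" by simp
    also have "\<dots> \<le> (\<Sum>i\<in>A. if D i s < v s then v s - D i s else 0)"
      by (rule member_le_sum[OF b _ finA]) auto
    finally show "v s - D (best s) s \<le> (\<Sum>i\<in>A. if D i s < v s then v s - D i s else 0)" .
  qed
  also have "\<dots> = (\<Sum>i\<in>A. f i)" unfolding f_def by (rule sum.swap)
  also have "\<dots> \<le> (\<Sum>i\<in>A. f (pick n m D v))"
  proof (rule sum_mono)
    fix i assume "i \<in> A"
    then obtain i' where "i = Suc i'" "i' < n" using A by (cases i) auto
    then show "f i \<le> f (pick n m D v)"
      using argmax_ge[of i' n "\<lambda>i. f (Suc i)"] by (simp add: pick_def f_def)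
  qed
  finally show ?thesis using A by (simp add: f_def)
qed

text \<open>Telescoping the squares of the prices.\<close>

lemma V_square: "(\<Sum>j<J. V j s * (1 - real k * (if h j s then 1 else 0))) \<ge> - (real J * real k ^ 2 / 2)"
proof -
  define d where "d j = 1 - real k * (if h j s then 1 else 0)" for j
  have "(V J s)\<^sup>2 \<le> 2 * (\<Sum>j<J. V j s * d j) + real J * real k ^ 2"
  proof (induction J)
    case (Suc J)
    have "\<bar>d J\<bar> \<le> real k" using k by (auto simp: d_def)
    then have "(d J)\<^sup>2 \<le> real k ^ 2" by (metis abs_le_square_iff abs_of_nat)
    moreover have "V (Suc J) s = V J s + d J" by (simp add: V_Suc d_def del: dual_price.simps)
    ultimately have "(V (Suc J) s)\<^sup>2 \<le> (V J s)\<^sup>2 + 2 * (V J s * d J) + real k ^ 2"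
      by (simp add: power2_eq_square algebra_simps del: dual_price.simps)
    with Suc show ?case by (simp add: algebra_simps del: dual_price.simps)
  qed simp
  moreover have "0 \<le> (V J s)\<^sup>2" by simp
  ultimately have "- (real J * real k ^ 2 / 2) \<le> (\<Sum>j<J. V j s * d j)" by linarith
  then show ?thesis by (simp add: d_def)
qed

text \<open>The regret bound of subgradient ascent. When \<open>pick_good\<close> is summed over the
  rounds, the prices on both sides collect to V j s times the step 1 - k or 1, which
  \<open>V_square\<close> bounds from below. The unit step length costs k ^ 2 / 2 per round and
  scenario.\<close>

lemma hit_cost_sum: "real k * (\<Sum>s<m. hit_cost n m D k s) \<le> real N * ((\<Sum>s<m. D (best s) s) + real m * real k ^ 2 / 2)"
proof -
  define H where "H j s = (if h j s then 1 else 0 :: real)" for j s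
  have *: "(\<Sum>s<m. V j s - D (best s) s) \<le> (\<Sum>s<m. real k * (H j s * (V j s - D (pk j) s)))" for j
    using pick_good[of "V j"] unfolding sum_distrib_left
    by (rule order.trans) (auto simp: H_def hit_def intro!: sum_mono)
  have "(\<Sum>j<N. \<Sum>s<m. V j s - D (best s) s) \<le> (\<Sum>j<N. \<Sum>s<m. real k * (H j s * (V j s - D (pk j) s)))"
    by (rule sum_mono[OF *])
  then have "(\<Sum>s<m. \<Sum>j<N. V j s - D (best s) s) \<le> (\<Sum>s<m. \<Sum>j<N. real k * (H j s * (V j s - D (pk j) s)))"
    by (simp only: sum.swap[of _ "{..<m}"])
  moreover have **: "(\<Sum>j<N. real k * (H j s * (V j s - D (pk j) s))) \<le>
      (\<Sum>j<N. V j s - D (best s) s) + real N * D (best s) s + real N * real k ^ 2 / 2 - real k * hit_cost n m D k s" for s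
  proof -
    have "real k * hit_cost n m D k s = (\<Sum>j<N. real k * (H j s * D (pk j) s))"
      unfolding hit_cost_def sum_distrib_left by (intro sum.cong) (auto simp: H_def)
    moreover have "- (real N * real k ^ 2 / 2) \<le> (\<Sum>j<N. V j s * (1 - real k * H j s))"
      using V_square[where J = N and s = s] by (simp add: H_def)
    ultimately show ?thesis by (simp add: sum_subtractf algebra_simps sum.distrib)
  qed
  have "(\<Sum>s<m. \<Sum>j<N. real k * (H j s * (V j s - D (pk j) s))) \<le>
      (\<Sum>s<m. (\<Sum>j<N. V j s - D (best s) s) + real N * D (best s) s + real N * real k ^ 2 / 2 - real k * hit_cost n m D k s)"
    by (rule sum_mono[OF **])
  ultimately have "(\<Sum>s<m. \<Sum>j<N. V j s - D (best s) s) \<le>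
      (\<Sum>s<m. (\<Sum>j<N. V j s - D (best s) s) + real N * D (best s) s + real N * real k ^ 2 / 2 - real k * hit_cost n m D k s)"
    by linarith
  then show ?thesis by (simp add: sum.distrib sum_subtractf sum_distrib_left algebra_simps)
qed

text \<open>The final price is N minus k times the number of hits, and it is at most 5 n ^ 3 = N /
  (12 n).\<close>

lemma hit_count_ge:
  assumes "s < m"
  shows "real N * (12 * real n - 1) \<le> 12 * real n * (real k * hit_count n m D k s)"
proof -
  have "V J s = real J - real k * (\<Sum>j<J. if h j s then 1 else 0)" for J
    by (induction J) (simp_all add: V_Suc algebra_simps del: dual_price.simps(2))
  from this[of N] have "real N - real k * hit_count n m D k s \<le> 4 * real n ^ 3 + 1"
    using V_le[OF assms, of N] by (simp add: hit_count_def)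
  also have "\<dots> \<le> 5 * real n ^ 3" using n by simp
  finally have "12 * real n * (real N - real k * hit_count n m D k s) \<le> 12 * real n * (5 * real n ^ 3)"
    by (intro mult_left_mono) auto
  moreover have "12 * real n * (5 * real n ^ 3) = real N"
    by (simp add: rounds_def power4_eq_xxxx power3_eq_cube)
  ultimately show ?thesis by (simp add: algebra_simps)
qed

lemma N_pos: "0 < N"
  using n by (simp add: rounds_def)

lemma hit_count_pos: "s < m \<Longrightarrow> 0 < hit_count n m D k s"
proof -
  assume "s < m"
  have "0 < real N * (12 * real n - 1)" using N_pos n by simp
  also note hit_count_ge[OF \<open>s < m\<close>]
  finally show ?thesis by (simp add: zero_less_mult_iff)
qed

text \<open>With exactly N / k hits, the estimate of a scenario would be L k plus k / N times its
  \<open>hit_cost\<close>, which \<open>hit_cost_sum\<close> controls. Missing hits inflate this by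
  at most the factor 12 n / (12 n - 1). The error L m / 3 is made up of L m / 8, from k ^ 2 / 2
  \<le> n ^ 2 / 2 = L / 8, and of 5 L m / 24 for the inflation.\<close>

lemma est_cost_sum: "(\<Sum>s<m. U s) \<le> L * real m * real k + (\<Sum>s<m. D (best s) s) + L * real m / 3"
proof -
  define B where "B = (\<Sum>s<m. D (best s) s)"
  define E where "E = L * real m * real k + B + real m * real k ^ 2 / 2"
  have n1: "0 < 12 * real n - 1" using n by linarith
  have hc: "0 \<le> hit_cost n m D k s" if "s < m" for s
    unfolding hit_cost_def using D_nonneg[OF pick_range[OF n] that] by (intro sum_nonneg) auto
  have U1: "real N * (12 * real n - 1) * U s \<le> 12 * real n * real k * (L * real N + hit_cost n m D k s)" if s: "s < m" for s
  proof -
    have "0 \<le> U s" unfolding est_cost_def using hc[OF s] hit_count_pos[OF s] by simp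
    from mult_right_mono[OF hit_count_ge[OF s] this]
    have "real N * (12 * real n - 1) * U s \<le> 12 * real n * real k * (hit_count n m D k s * U s)" by (simp add: mult.assoc)
    also have "hit_count n m D k s * U s = L * real N + hit_cost n m D k s"
      unfolding est_cost_def using hit_count_pos[OF s] by simp
    finally show ?thesis .
  qed
  have "real N * ((12 * real n - 1) * (\<Sum>s<m. U s)) = (\<Sum>s<m. real N * (12 * real n - 1) * U s)"
    by (simp add: sum_distrib_left mult.assoc)
  also have "\<dots> \<le> (\<Sum>s<m. 12 * real n * real k * (L * real N + hit_cost n m D k s))"
    using U1 by (intro sum_mono) auto
  also have "\<dots> = 12 * real n * (L * real N * real m * real k + real k * (\<Sum>s<m. hit_cost n m D k s))"
    by (simp add: sum.distrib sum_distrib_left[symmetric] algebra_simps)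
  also have "\<dots> \<le> 12 * real n * (L * real N * real m * real k + real N * (B + real m * real k ^ 2 / 2))"
    using hit_cost_sum by (intro mult_left_mono add_left_mono) (auto simp: B_def)
  also have "\<dots> = real N * (12 * real n * E)" by (simp add: E_def algebra_simps)
  finally have 1: "(12 * real n - 1) * (\<Sum>s<m. U s) \<le> 12 * real n * E"
    using N_pos by (simp add: mult_le_cancel_left_pos)
  have "B \<le> (\<Sum>s<m. 4 * real n ^ 3)" unfolding B_def
    using D_le best A by (intro sum_mono) blast
  then have B: "B \<le> L * real m * real n" by (simp add: power3_eq_cube algebra_simps)
  have kn: "real k ^ 2 \<le> real n * real n" using k by (simp add: power2_eq_square mult_mono)
  have k2: "real m * real k ^ 2 / 2 \<le> L * real m / 8"
    using mult_left_mono[OF kn, of "real m"] by (simp add: algebra_simps)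
  have "L * real m * real k \<le> L * real m * real n" using k by (intro mult_left_mono) auto
  then have E: "E \<le> L * real m * (2 * real n + 1 / 8)"
    using B k2 by (simp add: E_def algebra_simps)
  \<comment> \<open>5 / 24 is what 1 / 3 leaves after 1 / 8. The comparison is tightest at n = 1; it
    is the reason for the factor 12 in the number of rounds.\<close>
  have "2 * real n + 1 / 8 \<le> (12 * real n - 1) * (5 / 24)" using n by simp
  then have "L * real m * (2 * real n + 1 / 8) \<le> L * real m * ((12 * real n - 1) * (5 / 24))"
    by (intro mult_left_mono) auto
  with E have "12 * real n * E \<le> (12 * real n - 1) * E + L * real m * ((12 * real n - 1) * (5 / 24))"
    by (simp add: algebra_simps)
  also have "\<dots> = (12 * real n - 1) * (E + L * real m * (5 / 24))" by (simp only: distrib_left mult_ac)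
  finally have "(\<Sum>s<m. U s) \<le> E + L * real m * (5 / 24)"
    using 1 n1 by (meson mult_le_cancel_left_pos order.trans)
  then show ?thesis using k2 unfolding E_def B_def by linarith
qed

section \<open>Derandomized rounding\<close>

abbreviation "X \<equiv> stopped n m D k"
abbreviation "cd \<equiv> chosen_box n m D k"

text \<open>\<open>est_cost\<close> is chosen such that the savings U s - D, summed over all rounds
  that hit s, give L N. An average round thus saves the price L of a probe for every remaining
  scenario, and the best round saves no less.\<close>

lemma best_round_good:
  assumes Y: "R = {s. s < m \<and> s \<notin> Y}" and j: "j = best_round n m D k Y"
  shows "L * real (card R) \<le> (\<Sum>s\<in>R. if h j s then U s - D (pk j) s else 0)"
proof -
  define f where "f j = (\<Sum>s<m. if s \<notin> Y \<and> h j s then U s - D (pk j) s else 0)" for j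
  have fR: "f j = (\<Sum>s\<in>R. if h j s then U s - D (pk j) s else 0)" for j
    unfolding f_def by (rule sum.mono_neutral_cong_right) (auto simp: Y)
  have "real N * (L * real (card R)) = (\<Sum>s\<in>R. L * real N)" by simp
  also have "\<dots> = (\<Sum>s\<in>R. hit_count n m D k s * U s - hit_cost n m D k s)"
  proof (rule sum.cong)
    fix s assume "s \<in> R"
    then have "hit_count n m D k s \<noteq> 0" using hit_count_pos[of s] by (simp add: Y)
    then show "L * real N = hit_count n m D k s * U s - hit_cost n m D k s" by (simp add: est_cost_def)
  qed simp
  also have "\<dots> = (\<Sum>s\<in>R. \<Sum>j<N. if h j s then U s - D (pk j) s else 0)"
    unfolding hit_count_def hit_cost_def sum_distrib_right sum_subtractf[symmetric]
    by (intro sum.cong) auto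
  also have "\<dots> = (\<Sum>j<N. f j)" unfolding fR by (rule sum.swap)
  also have "\<dots> \<le> (\<Sum>i<N. f j)"
    unfolding j best_round_def by (rule sum_mono) (auto simp: f_def intro!: argmax_ge)
  finally have "real N * (L * real (card R)) \<le> real N * f j" by simp
  then show ?thesis using N_pos unfolding fR by simp
qed

text \<open>Derandomization: a scenario not yet hit after \<open>p\<close> probes is charged \<open>L p\<close> plus its expected
  remaining cost \<open>U s\<close>, and the best round does not increase the total charge.\<close>

lemma rounding:
  obtains g where "\<And>s. s < m \<Longrightarrow> \<exists>p<m. L * real (Suc p) + D (cd p) s \<le> g s"
    and "(\<Sum>s<m. g s) \<le> L * real m * real k + (\<Sum>s<m. D (best s) s) + L * real m / 3"
proof -
  define R where "R p = {s. s < m \<and> s \<notin> X p}" for p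
  have finR: "finite (R p)" for p unfolding R_def by auto
  have L: "0 < L" using n by simp
  have "\<exists>g. (\<forall>s<m. s \<in> R p \<longrightarrow> g s = L * real p + U s) \<and>
      (\<forall>s<m. s \<notin> R p \<longrightarrow> (\<exists>q<p. L * real (Suc q) + D (cd q) s \<le> g s)) \<and>
      (\<Sum>s<m. g s) \<le> (\<Sum>s<m. U s)" for p
  proof (induction p)
    case 0
    show ?case by (rule exI[of _ U]) (auto simp: R_def)
  next
    case (Suc p)
    then obtain g where g: "\<And>s. s < m \<Longrightarrow> s \<in> R p \<Longrightarrow> g s = L * real p + U s"
      "\<And>s. s < m \<Longrightarrow> s \<notin> R p \<Longrightarrow> \<exists>q<p. L * real (Suc q) + D (cd q) s \<le> g s"
      "(\<Sum>s<m. g s) \<le> (\<Sum>s<m. U s)" by blast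
    define j where "j = best_round n m D k (X p)"
    have cd: "cd p = pk j" by (simp add: chosen_box_def j_def)
    \<comment> \<open>The new probe charges L to every remaining scenario; those that it hits
      exchange the estimate for the cost actually found.\<close>
    define g' where "g' s = (if s \<in> R p then g s + L - (if h j s then U s - D (pk j) s else 0) else g s)" for s
    have RS: "s \<in> R (Suc p) \<longleftrightarrow> s \<in> R p \<and> \<not> h j s" for s by (auto simp: R_def j_def)
    define e where "e s = (if h j s then U s - D (pk j) s else 0)" for s
    have g'e: "g' s = g s + (if s \<in> R p then L - e s else 0)" for s by (simp add: g'_def e_def)
    have "(\<Sum>s<m. if s \<in> R p then L - e s else 0) = (\<Sum>s\<in>R p. L - e s)"
      by (rule sum.mono_neutral_cong_right) (auto simp: R_def)
    then have "(\<Sum>s<m. g' s) = (\<Sum>s<m. g s) + (L * real (card (R p)) - (\<Sum>s\<in>R p. e s))"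
      by (simp add: g'e sum.distrib sum_subtractf)
    moreover have "L * real (card (R p)) \<le> (\<Sum>s\<in>R p. e s)"
      unfolding e_def by (rule best_round_good[OF R_def[of p] j_def])
    ultimately have "(\<Sum>s<m. g' s) \<le> (\<Sum>s<m. U s)" using g(3) by linarith
    moreover have "g' s = L * real (Suc p) + U s" if "s < m" "s \<in> R (Suc p)" for s
      using that g(1) by (auto simp: RS g'_def algebra_simps)
    moreover have "\<exists>q<Suc p. L * real (Suc q) + D (cd q) s \<le> g' s" if s: "s < m" "s \<notin> R (Suc p)" for s
    proof (cases "s \<in> R p")
      case True
      then have "h j s" using s RS by auto
      then have "g' s = L * real (Suc p) + D (cd p) s"
        using True g(1)[OF s(1)] by (auto simp: g'_def cd algebra_simps)
      then show ?thesis by (intro exI[of _ p]) auto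
    next
      case False
      then show ?thesis using g(2)[OF s(1)] by (auto simp: g'_def less_Suc_eq)
    qed
    ultimately show ?case by blast
  qed
  \<comment> \<open>While scenarios remain, a round without new hits would save 0 instead of L for
    each of them. Every probe thus settles at least one scenario, and m probes suffice.\<close>
  moreover have "R m = {}"
  proof -
    have "card (R p) \<le> m - p" for p
    proof (induction p)
      case 0
      show ?case by (simp add: R_def)
    next
      case (Suc p)
      define j where "j = best_round n m D k (X p)"
      have sub: "R (Suc p) \<subseteq> R p" by (auto simp: R_def)
      show ?case
      proof (cases "R p = {}")
        case True
        then show ?thesis using sub by simp
      next
        case False
        have "R (Suc p) \<noteq> R p"
        proof
          assume "R (Suc p) = R p"
          then have "\<not> h j s" if "s \<in> R p" for s using that by (auto simp: R_def j_def)
          then have "(\<Sum>s\<in>R p. if h j s then U s - D (pk j) s else 0) = 0" by (intro sum.neutral) auto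
          then have "L * real (card (R p)) \<le> 0" using best_round_good[OF R_def[of p] j_def] by linarith
          then show False using L False finR[of p] by (simp add: mult_le_0_iff card_gt_0_iff)
        qed
        then have "card (R (Suc p)) < card (R p)" using sub finR by (intro psubset_card_mono) auto
        then show ?thesis using Suc by simp
      qed
    qed
    from this[of m] show ?thesis using finR[of m] by simp
  qed
  ultimately obtain g where "\<forall>s<m. \<exists>q<m. L * real (Suc q) + D (cd q) s \<le> g s" "(\<Sum>s<m. g s) \<le> (\<Sum>s<m. U s)"
    by (metis empty_iff)
  then show thesis using est_cost_sum that by (meson order.trans)
qed

end

section \<open>The computed strategy and its cost\<close>

text \<open>\<open>remdups\<close> keeps last occurrences; between two reversals it keeps first
  ones, so that no box is moved to a later position.\<close>

definition dedup :: "'a list \<Rightarrow> 'a list" where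
  "dedup xs = rev (remdups (rev xs))"

lemma dedup_Nil [simp]: "dedup [] = []"
  by (simp add: dedup_def)

lemma dedup_snoc: "dedup (xs @ [x]) = (if x \<in> set xs then dedup xs else dedup xs @ [x])"
  by (simp add: dedup_def)

lemma set_dedup [simp]: "set (dedup xs) = set xs"
  by (simp add: dedup_def)

lemma distinct_dedup: "distinct (dedup xs)"
  by (simp add: dedup_def)

text \<open>Deleting repetitions moves a box only forward in the order; a box chosen for step p is
  therefore seen after at most p + 1 probes.\<close>

lemma dedup_position:
  "p < length xs \<Longrightarrow> \<exists>q\<le>p. q < length (dedup xs) \<and> dedup xs ! q = xs ! p"
proof (induction xs rule: rev_induct)
  case (snoc x xs)
  have len: "length (dedup xs) \<le> length xs" by (simp add: dedup_def) (metis length_remdups_leq length_rev)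
  show ?case
  proof (cases "p < length xs")
    case True
    then obtain q where "q \<le> p" "q < length (dedup xs)" "dedup xs ! q = xs ! p" using snoc.IH by blast
    then show ?thesis using True by (intro exI[of _ q]) (auto simp: dedup_snoc nth_append)
  next
    case False
    then have p: "p = length xs" using snoc.prems by simp
    show ?thesis
    proof (cases "x \<in> set xs")
      case True
      then obtain q where "q < length (dedup xs)" "dedup xs ! q = x" by (metis in_set_conv_nth set_dedup)
      then show ?thesis using True p len by (intro exI[of _ q]) (auto simp: dedup_snoc)
    next
      case False
      then show ?thesis using p len by (intro exI[of _ "length (dedup xs)"]) (auto simp: dedup_snoc)
    qed
  qed
qed simp

text \<open>The disjunct i = 0 is present because \<open>run_min c 0\<close> already reads
  \<open>c 0\<close>.\<close>

lemma run_min_cong: "\<forall>i. i < t \<or> i = 0 \<longrightarrow> c i = c' i \<Longrightarrow> run_min c t = run_min c' t"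
  by (induction t) auto

lemma recip_sum_cong: "\<forall>i. i < t \<or> i = 0 \<longrightarrow> c i = c' i \<Longrightarrow> recip_sum c t = recip_sum c' t"
proof (induction t)
  case (Suc t)
  moreover have "run_min c (Suc t) = run_min c' (Suc t)" by (rule run_min_cong) (use Suc.prems in auto)
  ultimately show ?case by (simp add: less_Suc_eq del: run_min.simps)
qed simp

lemma stops_cong: "\<forall>i. i < t \<or> i = 0 \<longrightarrow> c i = c' i \<Longrightarrow> stops c \<alpha> t = stops c' \<alpha> t"
  unfolding stops_def using run_min_cong[of t c c'] recip_sum_cong[of "t - 1" c c'] by simp

lemma run_min_Min: "1 \<le> t \<Longrightarrow> run_min c t = Min (c ` {..<t})"
proof (induction t)
  case (Suc t)
  show ?case
  proof (cases t)
    case (Suc u)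
    then show ?thesis using Suc.IH by (simp add: lessThan_Suc min.commute)
  qed (simp add: lessThan_Suc)
qed simp

lemma run_min_le: "p < t \<Longrightarrow> run_min c t \<le> c p"
  by (induction t) (auto simp: less_Suc_eq min_le_iff_disj)

section \<open>The stopping rule as a partially-adaptive strategy\<close>

definition stop_rule :: "real \<Rightarrow> real list \<Rightarrow> bool" where
  "stop_rule \<alpha> xs = stops (\<lambda>p. xs ! p) \<alpha> (length xs)"

text \<open>The recursion and \<open>LEAST\<close> both search for the first stopping time from t
  on; t + r = n makes the forced stop of the recursion fall on the last box.\<close>

lemma stop_cost_LEAST:
  assumes "t + r = n"
  shows "stop_cost c \<alpha> r t = real (LEAST t'. t \<le> t' \<and> (n \<le> t' \<or> stops c \<alpha> t')) +
    run_min c (LEAST t'. t \<le> t' \<and> (n \<le> t' \<or> stops c \<alpha> t'))"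
  using assms
proof (induction r arbitrary: t)
  case 0
  then have "(LEAST t'. t \<le> t' \<and> (n \<le> t' \<or> stops c \<alpha> t')) = t" by (intro Least_equality) auto
  then show ?case by simp
next
  case (Suc r)
  show ?case
  proof (cases "stops c \<alpha> t")
    case True
    then have "(LEAST t'. t \<le> t' \<and> (n \<le> t' \<or> stops c \<alpha> t')) = t" by (intro Least_equality) auto
    then show ?thesis using True by simp
  next
    case False
    then have "(t \<le> t' \<and> (n \<le> t' \<or> stops c \<alpha> t')) = (Suc t \<le> t' \<and> (n \<le> t' \<or> stops c \<alpha> t'))" for t'
      using Suc.prems by (cases "t = t'") auto
    then show ?thesis using False Suc.IH[of "Suc t"] Suc.prems by simp
  qed
qed

lemma pa_cost_in_eq_stop_cost:
  assumes n: "1 \<le> n" and len: "length \<sigma> = n" and c: "\<And>t. t < n \<Longrightarrow> c t = s (\<sigma> ! t)"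
  shows "pa_cost_in (\<sigma>, stop_rule \<alpha>) s = stop_cost c \<alpha> (n - 1) 1"
proof -
  have obs: "length (observed \<sigma> s t) = t" "p < t \<Longrightarrow> observed \<sigma> s t ! p = c p" if "t \<le> n" for t p
    using that len c by (auto simp: observed_def)
  have st: "stop_rule \<alpha> (observed \<sigma> s t) = stops c \<alpha> t" if "1 \<le> t" "t \<le> n" for t
    unfolding stop_rule_def using that obs[of t] by (auto intro!: stops_cong)
  have mn: "Min (set (observed \<sigma> s t)) = run_min c t" if "1 \<le> t" "t \<le> n" for t
  proof -
    have "set (observed \<sigma> s t) = c ` {..<t}" using obs[OF that(2)] by (auto simp: set_conv_nth image_iff) metis+
    then show ?thesis using run_min_Min[OF that(1)] by simp
  qed
  have eq: "(1 \<le> t \<and> (length \<sigma> \<le> t \<or> stop_rule \<alpha> (observed \<sigma> s t))) = (1 \<le> t \<and> (n \<le> t \<or> stops c \<alpha> t))" for t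
    using st[of t] len by (cases "t \<le> n") auto
  define T where "T = (LEAST t. 1 \<le> t \<and> (n \<le> t \<or> stops c \<alpha> t))"
  have T: "1 \<le> T" "T \<le> n"
    using LeastI[of "\<lambda>t. 1 \<le> t \<and> (n \<le> t \<or> stops c \<alpha> t)" n] Least_le[of "\<lambda>t. 1 \<le> t \<and> (n \<le> t \<or> stops c \<alpha> t)" n] n
    by (auto simp: T_def)
  have "pa_stop_time (\<sigma>, stop_rule \<alpha>) s = T"
    unfolding pa_stop_time_def T_def by (simp only: fst_conv snd_conv eq)
  then show ?thesis using stop_cost_LEAST[of 1 "n - 1" n c \<alpha>] n mn[OF T]
    by (simp add: pa_cost_in_def T_def)
qed

section \<open>The order and the threshold that the program selects\<close>

context
  fixes n :: nat and S :: "scenario list"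
begin

text \<open>Written as a prefix minimum over all boxes because the program obtains it from the same
  loop as every other trajectory; the shift is due to boxes starting at 1.\<close>

definition min_cost :: "nat \<Rightarrow> real" where
  "min_cost s = run_min (\<lambda>p. (S ! s) (Suc p)) n"

text \<open>Capping at \<open>n\<close> is harmless, since probing everything costs only \<open>n\<close> above the minimum. Scaling
  by \<open>4 n ^ 2\<close> makes the step size 1 of the dual ascent small enough.\<close>

definition excess :: "nat \<Rightarrow> nat \<Rightarrow> real" where
  "excess i s = 4 * real n * real n * min ((S ! s) i - min_cost s) (real n)"

text \<open>All boxes are appended after the chosen ones, so that every box occurs in the order.\<close>

definition probe_seq :: "nat \<Rightarrow> nat \<Rightarrow> nat" where
  "probe_seq k p = (if p < length S then chosen_box n (length S) excess k p else Suc (p - length S))"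

definition probe_order :: "nat \<Rightarrow> nat list" where
  "probe_order k = dedup (map (probe_seq k) [0..<length S + n])"

text \<open>The value 0 beyond the last box keeps the sequence nonnegative everywhere, as the
  ski-rental lemmas demand.\<close>

definition seen_cost :: "nat \<Rightarrow> nat \<Rightarrow> nat \<Rightarrow> real" where
  "seen_cost k s t = (if t < n then (S ! s) (probe_order k ! t) else 0)"

text \<open>Negated because the search loops maximize; 0 - x is the expression that the program
  accumulates.\<close>

definition neg_total_cost :: "nat \<Rightarrow> real \<Rightarrow> real" where
  "neg_total_cost k \<alpha> = (\<Sum>s<length S. 0 - stop_cost (seen_cost k s) \<alpha> (n - 1) 1)"

text \<open>Index 0 stands for the threshold 1, the only candidate that is not a breakpoint.\<close>

definition threshold :: "nat \<Rightarrow> nat \<Rightarrow> nat \<Rightarrow> real" where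
  "threshold k s t = (if t = 0 then 1 else recip_sum (seen_cost k s) t)"

text \<open>The search over guess, scenario and time is split into three nested maximizations over
  one index, each of which is one \<open>argmax_loop\<close>.\<close>

definition best_time :: "nat \<Rightarrow> nat \<Rightarrow> nat" where
  "best_time k s = argmax (\<lambda>t. neg_total_cost k (threshold k s t)) (Suc n)"

definition scenario_threshold :: "nat \<Rightarrow> nat \<Rightarrow> real" where
  "scenario_threshold k s = threshold k s (best_time k s)"

definition best_scenario :: "nat \<Rightarrow> nat" where
  "best_scenario k = argmax (\<lambda>s. neg_total_cost k (scenario_threshold k s)) (length S)"

definition guess_threshold :: "nat \<Rightarrow> real" where
  "guess_threshold k = scenario_threshold k (best_scenario k)"

definition best_guess :: nat where
  "best_guess = argmax (\<lambda>k. neg_total_cost (Suc k) (guess_threshold (Suc k))) n"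

end

section \<open>The approximation guarantee\<close>

locale search =
  fixes n :: nat and S :: "scenario list"
  assumes inst: "search_instance n S"
begin

abbreviation "m \<equiv> length S"

lemma n: "1 \<le> n" and m: "0 < m" and cost_nonneg: "s < m \<Longrightarrow> i \<in> {1..n} \<Longrightarrow> 0 \<le> (S ! s) i"
  using inst by (auto simp: search_instance_def)

lemma min_cost_le: "i \<in> {1..n} \<Longrightarrow> min_cost n S s \<le> (S ! s) i"
  using run_min_le[of "i - 1" n "\<lambda>p. (S ! s) (Suc p)"] by (auto simp: min_cost_def)

lemma min_cost_attained: "\<exists>i\<in>{1..n}. (S ! s) i = min_cost n S s"
proof -
  have "min_cost n S s \<in> (\<lambda>p. (S ! s) (Suc p)) ` {..<n}"
    unfolding min_cost_def run_min_Min[OF n] using n by (intro Min_in) (auto simp: lessThan_empty_iff)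
  then show ?thesis by force
qed

lemma excess_nonneg: "i \<in> {1..n} \<Longrightarrow> 0 \<le> excess n S i s"
  using min_cost_le by (auto simp: excess_def)

lemma excess_le: "excess n S i s \<le> 4 * real n ^ 3"
  using mult_left_mono[of "min ((S ! s) i - min_cost n S s) (real n)" "real n" "4 * real n * real n"]
  by (simp add: excess_def power3_eq_cube)

lemma chosen_box_range: "chosen_box n m' D k p \<in> {1..n}"
  unfolding chosen_box_def by (rule pick_range[OF n])

lemma set_probe_order: "set (probe_order n S k) = {1..n}"
proof
  show "set (probe_order n S k) \<subseteq> {1..n}"
    using chosen_box_range by (fastforce simp: probe_order_def probe_seq_def)
  show "{1..n} \<subseteq> set (probe_order n S k)"
  proof
    fix i assume "i \<in> {1..n}"
    then have "m + (i - 1) < m + n" "probe_seq n S k (m + (i - 1)) = i" by (auto simp: probe_seq_def)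
    then show "i \<in> set (probe_order n S k)" unfolding probe_order_def set_dedup set_map set_upt
      by (metis atLeastLessThan_iff image_eqI zero_le)
  qed
qed

lemma distinct_probe_order: "distinct (probe_order n S k)"
  unfolding probe_order_def by (rule distinct_dedup)

lemma length_probe_order: "length (probe_order n S k) = n"
  using distinct_card[OF distinct_probe_order] set_probe_order by simp

lemma seen_cost_nonneg: "s < m \<Longrightarrow> 0 \<le> seen_cost n S k s t"
  using cost_nonneg set_probe_order nth_mem[of t "probe_order n S k"] by (auto simp: seen_cost_def length_probe_order)

text \<open>The fallback for a capped excess: all boxes occur in the order, so any box, in
  particular the cheapest one, is seen by time n.\<close>

lemma order_good:
  assumes "s < m" "i \<in> {1..n}"
  shows "\<exists>t\<in>{1..n}. real t + run_min (seen_cost n S k s) t \<le> real n + (S ! s) i"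
proof -
  have "i \<in> set (probe_order n S k)" using assms set_probe_order by simp
  then obtain q where q: "q < n" "probe_order n S k ! q = i" by (metis in_set_conv_nth length_probe_order)
  then have "run_min (seen_cost n S k s) (Suc q) \<le> (S ! s) i" using run_min_le[of q "Suc q" "seen_cost n S k s"] by (simp add: seen_cost_def)
  then show ?thesis using q by (intro bexI[of _ "Suc q"]) (auto simp del: run_min.simps)
qed

lemma order_cand:
  assumes "s < m" "p < m"
  shows "\<exists>t\<in>{1..n}. real t + run_min (seen_cost n S k s) t \<le> real (Suc p) + (S ! s) (chosen_box n m (excess n S) k p)"
proof -
  have "p < length (map (probe_seq n S k) [0..<m + n])" using assms by simp
  from dedup_position[OF this] obtain q where
    q: "q \<le> p" "q < n" "probe_order n S k ! q = chosen_box n m (excess n S) k p"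
    using assms length_probe_order[of k] by (auto simp: probe_order_def[symmetric] probe_seq_def)
  then have "run_min (seen_cost n S k s) (Suc q) \<le> (S ! s) (chosen_box n m (excess n S) k p)"
    using run_min_le[of q "Suc q" "seen_cost n S k s"] by (simp add: seen_cost_def)
  then show ?thesis using q by (intro bexI[of _ "Suc q"]) (auto simp del: run_min.simps)
qed

text \<open>\<open>rounding\<close> speaks of scaled and capped excesses; adding the scenario
  minimum back and dividing by L returns to costs. The cap is harmless on both sides: it can only
  lower the cost of A, and for the computed order \<open>order_good\<close> replaces a capped
  box.\<close>

lemma order_bound:
  assumes A: "A \<in> na_strategies n"
  shows "\<exists>t. (\<forall>s<m. t s \<in> {1..n}) \<and>
    (\<Sum>s<m. real (t s) + run_min (seen_cost n S (card A) s) (t s)) \<le> real m * (na_cost S A + 1 / 3)"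
proof -
  have A': "A \<subseteq> {1..n}" "A \<noteq> {}" "finite A" using A finite_subset by (auto simp: na_strategies_def)
  have "\<exists>i\<in>A. (S ! s) i = Min ((S ! s) ` A)" for s
    using Min_in[of "(S ! s) ` A"] A' by (metis empty_is_image finite_imageI imageE)
  then obtain best where bestA: "\<And>s. best s \<in> A" and best_Min: "\<And>s. (S ! s) (best s) = Min ((S ! s) ` A)" by metis
  interpret dual_ascent n m "excess n S" A best "card A"
    by unfold_locales (use n A' bestA excess_nonneg excess_le in auto)
  obtain g where g: "\<And>s. s < m \<Longrightarrow> \<exists>p<m. L * real (Suc p) + excess n S (cd p) s \<le> g s"
    and gs: "(\<Sum>s<m. g s) \<le> L * real m * real (card A) + (\<Sum>s<m. excess n S (best s) s) + L * real m / 3"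
    by (rule rounding) blast
  have L: "0 < L" using n by simp
  have "\<exists>t\<in>{1..n}. L * (real t + run_min (seen_cost n S (card A) s) t) \<le> g s + L * min_cost n S s" if s: "s < m" for s
  proof -
    obtain p where p: "p < m" "L * real (Suc p) + excess n S (cd p) s \<le> g s" using g[OF s] by blast
    show ?thesis
    proof (cases "(S ! s) (cd p) - min_cost n S s \<le> real n")
      case True
      then have D: "excess n S (cd p) s = L * ((S ! s) (cd p) - min_cost n S s)" by (simp add: excess_def)
      obtain t where t: "t \<in> {1..n}" "real t + run_min (seen_cost n S (card A) s) t \<le> real (Suc p) + (S ! s) (cd p)"
        using order_cand[OF s p(1)] by blast
      have "L * (real t + run_min (seen_cost n S (card A) s) t) \<le> L * (real (Suc p) + (S ! s) (cd p))"
        using t L by (intro mult_left_mono) auto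
      also have "\<dots> = L * real (Suc p) + excess n S (cd p) s + L * min_cost n S s" unfolding D by (simp add: algebra_simps)
      finally show ?thesis using p t by (meson add_right_mono order.trans)
    next
      case False
      then have D: "excess n S (cd p) s = L * real n" by (simp add: excess_def)
      \<comment> \<open>The cap is active, so \<open>g s\<close> already contains L n, which pays
        for probing until the cheapest box is seen.\<close>
      obtain i where i: "i \<in> {1..n}" "(S ! s) i = min_cost n S s" using min_cost_attained by blast
      obtain t where t: "t \<in> {1..n}" "real t + run_min (seen_cost n S (card A) s) t \<le> real n + min_cost n S s"
        using order_good[OF s i(1)] unfolding i(2) by blast
      have "L * (real t + run_min (seen_cost n S (card A) s) t) \<le> L * (real n + min_cost n S s)"
        using t L by (intro mult_left_mono) auto
      also have "\<dots> = excess n S (cd p) s + L * min_cost n S s" unfolding D by (simp add: algebra_simps)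
      also have "\<dots> \<le> g s + L * min_cost n S s" using p L by (smt (verit) mult_nonneg_nonneg of_nat_0_le_iff)
      finally show ?thesis using t by blast
    qed
  qed
  then obtain t where t: "\<And>s. s < m \<Longrightarrow> t s \<in> {1..n}"
    "\<And>s. s < m \<Longrightarrow> L * (real (t s) + run_min (seen_cost n S (card A) s) (t s)) \<le> g s + L * min_cost n S s" by metis
  have "L * (\<Sum>s<m. real (t s) + run_min (seen_cost n S (card A) s) (t s)) \<le> (\<Sum>s<m. g s + L * min_cost n S s)"
    unfolding sum_distrib_left using t by (intro sum_mono) auto
  also have "\<dots> \<le> L * real m * real (card A) + (\<Sum>s<m. excess n S (best s) s + L * min_cost n S s) + L * real m / 3"
    using gs by (simp add: sum.distrib)
  also have "(\<Sum>s<m. excess n S (best s) s + L * min_cost n S s) \<le> (\<Sum>s<m. L * Min ((S ! s) ` A))"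
  proof (rule sum_mono)
    fix s
    have "L * min ((S ! s) (best s) - min_cost n S s) (real n) \<le> L * ((S ! s) (best s) - min_cost n S s)"
      using L by (intro mult_left_mono) auto
    then show "excess n S (best s) s + L * min_cost n S s \<le> L * Min ((S ! s) ` A)"
      unfolding excess_def best_Min[symmetric] by (simp add: algebra_simps)
  qed
  finally have "L * (\<Sum>s<m. real (t s) + run_min (seen_cost n S (card A) s) (t s)) \<le>
      L * (real m * real (card A) + (\<Sum>s<m. Min ((S ! s) ` A)) + real m / 3)"
    by (simp add: sum_distrib_left[symmetric] algebra_simps)
  then have "(\<Sum>s<m. real (t s) + run_min (seen_cost n S (card A) s) (t s)) \<le>
      real m * real (card A) + (\<Sum>s<m. Min ((S ! s) ` A)) + real m / 3"
    using L by (rule mult_left_le_imp_le)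
  also have "(\<Sum>s<m. Min ((S ! s) ` A)) = real m * avg S (\<lambda>s. Min (s ` A))"
    using m by (simp add: avg_def sum_list_sum_nth atLeast0LessThan)
  finally show ?thesis using t(1) by (intro exI[of _ t]) (auto simp: na_cost_def algebra_simps)
qed

lemma neg_total_cost_best:
  assumes k: "k \<in> {1..n}" and \<beta>: "\<beta> = 1 \<or> (\<exists>s<m. \<exists>t\<in>{1..n}. \<beta> = recip_sum (seen_cost n S k s) t)"
  shows "neg_total_cost n S k \<beta> \<le> neg_total_cost n S (Suc (best_guess n S)) (guess_threshold n S (Suc (best_guess n S)))"
proof -
  obtain s t where st: "s < m" "t < Suc n" "\<beta> = threshold n S k s t"
  proof (cases "\<beta> = 1")
    case True
    \<comment> \<open>The threshold 1 has index 0 in every scenario, and scenario 0 exists.\<close>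
    then show ?thesis using that[of 0 0] m by (simp add: threshold_def)
  next
    case False
    then obtain s t where "s < m" "t \<in> {1..n}" "\<beta> = recip_sum (seen_cost n S k s) t" using \<beta> by blast
    then show ?thesis using that[of s t] by (auto simp: threshold_def)
  qed
  have "neg_total_cost n S k \<beta> \<le> neg_total_cost n S k (scenario_threshold n S k s)"
    using argmax_ge[OF st(2), of "\<lambda>t. neg_total_cost n S k (threshold n S k s t)"] st by (simp add: scenario_threshold_def best_time_def)
  also have "\<dots> \<le> neg_total_cost n S k (guess_threshold n S k)"
    using argmax_ge[OF st(1), of "\<lambda>s. neg_total_cost n S k (scenario_threshold n S k s)"] by (simp add: guess_threshold_def best_scenario_def)
  also have "\<dots> \<le> neg_total_cost n S (Suc (best_guess n S)) (guess_threshold n S (Suc (best_guess n S)))"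
    using argmax_ge[of "k - 1" n "\<lambda>k. neg_total_cost n S (Suc k) (guess_threshold n S (Suc k))"] k by (auto simp: best_guess_def)
  finally show ?thesis .
qed

definition best_strategy :: pa_strategy where
  "best_strategy = (probe_order n S (Suc (best_guess n S)), stop_rule (guess_threshold n S (Suc (best_guess n S))))"

lemma is_pa_best_strategy: "is_pa n best_strategy"
  by (simp add: is_pa_def best_strategy_def distinct_probe_order set_probe_order)

lemma pa_cost_best_strategy: "pa_cost S best_strategy = - neg_total_cost n S (Suc (best_guess n S)) (guess_threshold n S (Suc (best_guess n S))) / real m"
proof -
  have "pa_cost_in best_strategy (S ! s) = stop_cost (seen_cost n S (Suc (best_guess n S)) s) (guess_threshold n S (Suc (best_guess n S))) (n - 1) 1" for s
    unfolding best_strategy_def by (rule pa_cost_in_eq_stop_cost[OF n length_probe_order]) (simp add: seen_cost_def)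
  then show ?thesis
    by (simp add: pa_cost_def avg_def sum_list_sum_nth atLeast0LessThan neg_total_cost_def sum_negf)
qed

theorem best_strategy_cost: "pa_cost S best_strategy \<le> exp 1 / (exp 1 - 1) * opt_na_cost n S"
proof -
  have fin: "finite (na_strategies n)"
    by (rule finite_subset[of _ "Pow {1..n}"]) (auto simp: na_strategies_def)
  have "na_strategies n \<noteq> {}" using n by (auto simp: na_strategies_def)
  then obtain A where A: "A \<in> na_strategies n" "opt_na_cost n S = na_cost S A"
    unfolding opt_na_cost_def using fin Min_in[of "na_cost S ` na_strategies n"] by fastforce
  define k where "k = card A"
  have k: "k \<in> {1..n}"
    using A card_mono[of "{1..n}" A] finite_subset[of A "{1..n}"]
    by (auto simp: k_def na_strategies_def Suc_le_eq card_gt_0_iff)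
  obtain t where t: "\<And>s. s < m \<Longrightarrow> t s \<in> {1..n}"
    "(\<Sum>s<m. real (t s) + run_min (seen_cost n S k s) (t s)) \<le> real m * (opt_na_cost n S + 1 / 3)"
    using order_bound[OF A(1)] unfolding A(2) k_def by blast
  \<comment> \<open>k, the size of an optimal set, is one of the guesses, so the selected strategy
    costs at most as much as any candidate threshold on the order for k.\<close>
  have "real m * pa_cost S best_strategy * (exp 1 - 1) \<le>
      exp 1 * (\<Sum>s<m. real (t s) + run_min (seen_cost n S k s) (t s)) - real m"
  proof (rule best_threshold[where n = n])
    show "real m * pa_cost S best_strategy \<le> (\<Sum>s<m. stop_cost (seen_cost n S k s) \<beta> (n - 1) 1)"
      if "\<beta> = 1 \<or> (\<exists>s<m. \<exists>t\<in>{1..n}. \<beta> = recip_sum (seen_cost n S k s) t)" for \<beta>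
      using neg_total_cost_best[OF k that] m by (simp add: pa_cost_best_strategy neg_total_cost_def[of n S k] sum_negf)
  qed (use n t seen_cost_nonneg in auto)
  also have "\<dots> \<le> exp 1 * (real m * (opt_na_cost n S + 1 / 3)) - real m"
    using t(2) by simp
  \<comment> \<open>exp 1 / 3 \<le> 1: the surplus of 1 per scenario pays for the error of the
    order.\<close>
  also have "\<dots> \<le> real m * (exp 1 * opt_na_cost n S)"
    using mult_left_mono[OF exp_le, of "real m"] by (simp add: algebra_simps)
  finally have "pa_cost S best_strategy * (exp 1 - 1) \<le> exp 1 * opt_na_cost n S"
    using m by (simp add: mult.assoc)
  moreover have "1 < exp (1::real)" by simp
  ultimately show ?thesis by (simp add: field_simps)
qed

end

section \<open>The programs\<close>

text \<open>One loop serves three purposes: the scenario minimum, the simulation of an order on a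
  known scenario, and the stopping test on observed costs. \<open>tt\<close> is cleared before the
  first read so that entry 0 receives \<open>c 0\<close>, as in \<open>run_min\<close>.\<close>

definition traj :: "nexp \<Rightarrow> rexp \<Rightarrow> rexp \<Rightarrow> com" where
  "traj sx src e = Seq (setn ''tt'' (NConst 0)) (Seq (RAssign ''Y'' sx (NConst 0) src)
     (Seq (RAssign ''A'' sx (NConst 0) (RNat (NConst 0)))
       (for_loop ''tt'' e
         (Seq (RAssign ''Y'' sx (nsuc (nv ''tt'')) src)
         (Seq (Cond (RLess (RAt ''Y'' sx (nv ''tt'')) (RAt ''Y'' sx (nsuc (nv ''tt''))))
                (RAssign ''Y'' sx (nsuc (nv ''tt'')) (RAt ''Y'' sx (nv ''tt''))) Skip)
           (RAssign ''A'' sx (nsuc (nv ''tt''))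
             (RPlus (RAt ''A'' sx (nv ''tt''))
               (RDivide (RNat (NConst 1)) (RAt ''Y'' sx (nsuc (nv ''tt'')))))))))))"

lemma nat_writes_traj [simp]: "nat_writes (traj sx src e) = {''tt''}"
  by (auto simp: traj_def)

lemma real_writes_traj [simp]: "real_writes (traj sx src e) = {''Y'', ''A''}"
  by (auto simp: traj_def)

text \<open>Preservation of the other rows lets a loop over the scenarios accumulate their
  trajectories.\<close>

lemma runs_traj:
  assumes sx: "\<And>st'. frame st st' {''tt''} {''Y'', ''A''} \<Longrightarrow> nval sx st' = s"
    and e: "\<And>st'. frame st st' {''tt''} {''Y'', ''A''} \<Longrightarrow> rval e st' = real b"
    and src: "\<And>j st'. frame st st' {''tt''} {''Y'', ''A''} \<Longrightarrow> nats st' ''tt'' 0 0 = j \<Longrightarrow> j < b \<Longrightarrow>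
      rval src st' = c j"
    and b: "0 < b" and T: "5 + 6 * b \<le> T"
  shows "runs (traj sx src e) st T (\<lambda>st'.
    (\<forall>t\<le>b. reals st' ''Y'' s t = run_min c t \<and> reals st' ''A'' s t = recip_sum c t) \<and>
    (\<forall>s'. s' \<noteq> s \<longrightarrow> reals st' ''Y'' s' = reals st ''Y'' s' \<and> reals st' ''A'' s' = reals st ''A'' s'))"
proof -
  let ?I = "\<lambda>j st'. (\<forall>t\<le>j. reals st' ''Y'' s t = run_min c t \<and> reals st' ''A'' s t = recip_sum c t) \<and>
    (\<forall>s'. s' \<noteq> s \<longrightarrow> reals st' ''Y'' s' = reals st ''Y'' s' \<and> reals st' ''A'' s' = reals st ''A'' s')"
  let ?body = "Seq (RAssign ''Y'' sx (nsuc (nv ''tt'')) src)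
         (Seq (Cond (RLess (RAt ''Y'' sx (nv ''tt'')) (RAt ''Y'' sx (nsuc (nv ''tt''))))
                (RAssign ''Y'' sx (nsuc (nv ''tt'')) (RAt ''Y'' sx (nv ''tt''))) Skip)
           (RAssign ''A'' sx (nsuc (nv ''tt''))
             (RPlus (RAt ''A'' sx (nv ''tt''))
               (RDivide (RNat (NConst 1)) (RAt ''Y'' sx (nsuc (nv ''tt'')))))))"
  define st1 where "st1 = st\<lparr>nats := upd (nats st) ''tt'' 0 0 0\<rparr>"
  have fr: "frame st st1 {''tt''} {''Y'', ''A''}" by (simp add: st1_def frame_nupd frame_refl)
  have s1: "nval sx st1 = s" using sx fr by blast
  have src1: "rval src st1 = c 0" using src[OF fr, of 0] b by (simp add: st1_def upd_apply)
  define st2 where "st2 = st1\<lparr>reals := upd (reals st1) ''Y'' s 0 (c 0)\<rparr>"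
  have fr2: "frame st st2 {''tt''} {''Y'', ''A''}" using fr by (auto simp: st2_def frame_def upd_other)
  have s2: "nval sx st2 = s" using sx fr2 by blast
  define st3 where "st3 = st2\<lparr>reals := upd (reals st2) ''A'' s 0 0\<rparr>"
  have fr3: "frame st st3 {''tt''} {''Y'', ''A''}" using fr2 by (auto simp: st3_def frame_def upd_other)
  have f: "frame st st' {''tt''} {''Y'', ''A''}"
    if "frame st3 st' {''tt''} {''Y'', ''A''}" for st'
    using frame_trans[OF fr3 that] by blast
  have "runs (for_loop ''tt'' e ?body) st3 (2 + b * (4 + 2)) (?I b)"
  proof (rule runs_for[where I = "?I" and b = b and B = 4])
    show "rval e st' = real b" if "frame st3 st' (insert ''tt'' (nat_writes ?body)) (real_writes ?body)" for st'
      using e[OF f] that by (simp add: insert_commute)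
    show "?I 0 st3" by (simp add: st3_def st2_def st1_def upd_apply upd_def)
    show "?I j (st\<lparr>nats := upd (nats st) ''tt'' 0 0 v\<rparr>) = ?I j st" for j st v by simp
    fix j st'
    assume j: "j < b" "?I j st'" "frame st3 st' (insert ''tt'' (nat_writes ?body)) (real_writes ?body)"
      and tt: "nats st' ''tt'' 0 0 = j"
    have f0: "frame st st' {''tt''} {''Y'', ''A''}" using f j(3) by (simp add: insert_commute)
    have s': "nval sx (st'\<lparr>reals := r\<rparr>) = s" if "\<And>x. x \<noteq> ''Y'' \<Longrightarrow> x \<noteq> ''A'' \<Longrightarrow> r x = reals st' x" for r
      by (rule sx) (use f0 that in \<open>auto simp: frame_def\<close>)
    have ss: "nval sx st' = s" using sx[OF f0] .
    have cc: "rval src st' = c j" using src[OF f0 tt j(1)] .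
    show "runs ?body st' 4 (?I (Suc j))"
      using j(2) by (auto simp: ss cc tt s' upd_apply upd_other le_Suc_eq min_def fun_eq_iff)
  qed simp_all
  then show ?thesis using T unfolding traj_def
    by (auto simp: s1 src1 s2 st1_def[symmetric] st2_def[symmetric] st3_def[symmetric] elim!: runs_mono)
qed

section \<open>Programs for the dual ascent and the rounding\<close>

abbreviation n_expr :: rexp where "n_expr \<equiv> RNat (nv ''n'')"
abbreviation m_expr :: rexp where "m_expr \<equiv> RNat (nv ''m'')"
abbreviation rounds_expr :: rexp where
  "rounds_expr \<equiv> RTimes (RNat (NConst 60)) (RTimes (RTimes n_expr n_expr) (RTimes n_expr n_expr))"
abbreviation scale_expr :: rexp where
  "scale_expr \<equiv> RTimes (RTimes (RNat (NConst 4)) n_expr) n_expr"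
abbreviation picked :: "vname \<Rightarrow> nexp" where "picked j \<equiv> NAt ''pk'' (nv j) (NConst 0)"
abbreviation hit_test :: "vname \<Rightarrow> bexp" where
  "hit_test j \<equiv> RLess (RAt ''D'' (picked j) (nv ''s'')) (RAt ''V'' (nv j) (nv ''s''))"

definition compute_excess :: com where
  "compute_excess = for_loop ''s'' m_expr
     (Seq (traj (nv ''s'') (RAt ''cost'' (nsuc (nv ''tt'')) (nv ''s'')) n_expr)
       (for_loop ''i'' n_expr
         (Seq (RAssign ''D'' (nsuc (nv ''i'')) (nv ''s'')
                (RMinus (RAt ''cost'' (nsuc (nv ''i'')) (nv ''s'')) (RAt ''Y'' (nv ''s'') (nv ''n''))))
         (Seq (Cond (RLess n_expr (RAt ''D'' (nsuc (nv ''i'')) (nv ''s'')))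
                (RAssign ''D'' (nsuc (nv ''i'')) (nv ''s'') n_expr) Skip)
           (RAssign ''D'' (nsuc (nv ''i'')) (nv ''s'')
             (RTimes scale_expr (RAt ''D'' (nsuc (nv ''i'')) (nv ''s''))))))))"

lemma nat_writes_compute_excess [simp]: "nat_writes compute_excess = {''s'', ''tt'', ''i''}"
  by (auto simp: compute_excess_def)

lemma real_writes_compute_excess [simp]: "real_writes compute_excess = {''Y'', ''A'', ''D''}"
  by (auto simp: compute_excess_def)

text \<open>The prices of all rounds are stored, since later parts ask again whether round j hit
  scenario s. The counter \<open>k\<close> starts at 0, so the size subtracted on a hit is its
  successor.\<close>

definition ascend :: com where
  "ascend = Seq (for_loop ''s'' m_expr (RAssign ''V'' (NConst 0) (nv ''s'') (RNat (NConst 0))))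
     (for_loop ''j'' rounds_expr
       (Seq (argmax_loop ''bi'' ''i'' n_expr ''va'' ''acc''
              (sum_loop ''acc'' ''s'' m_expr
                (RLess (RAt ''D'' (nsuc (nv ''i'')) (nv ''s'')) (RAt ''V'' (nv ''j'') (nv ''s'')))
                (RMinus (RAt ''V'' (nv ''j'') (nv ''s'')) (RAt ''D'' (nsuc (nv ''i'')) (nv ''s'')))))
       (Seq (NAssign ''pk'' (nv ''j'') (NConst 0) (nsuc (nv ''bi'')))
         (for_loop ''s'' m_expr
           (Seq (RAssign ''V'' (nsuc (nv ''j'')) (nv ''s'')
                  (RPlus (RAt ''V'' (nv ''j'') (nv ''s'')) (RNat (NConst 1))))
             (Cond (hit_test ''j'')
               (RAssign ''V'' (nsuc (nv ''j'')) (nv ''s'')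
                 (RMinus (RAt ''V'' (nsuc (nv ''j'')) (nv ''s'')) (RNat (nsuc (nv ''k''))))) Skip))))))"

lemma nat_writes_ascend [simp]: "nat_writes ascend = {''s'', ''j'', ''i'', ''bi'', ''pk''}"
  by (auto simp: ascend_def)

lemma real_writes_ascend [simp]: "real_writes ascend = {''V'', ''va'', ''acc''}"
  by (auto simp: ascend_def)

text \<open>\<open>X\<close> marks the scenarios already hit. Memory is shared by all guesses, so
  the marks are cleared here.\<close>

definition estimate :: com where
  "estimate = for_loop ''s'' m_expr
     (Seq (sum_loop ''H'' ''j'' rounds_expr (hit_test ''j'') (RNat (NConst 1)))
     (Seq (sum_loop ''SD'' ''j'' rounds_expr (hit_test ''j'') (RAt ''D'' (picked ''j'') (nv ''s'')))
     (Seq (RAssign ''U'' (nv ''s'') (NConst 0)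
            (RDivide (RPlus (RTimes scale_expr rounds_expr) (rv ''SD'')) (rv ''H'')))
       (NAssign ''X'' (nv ''s'') (NConst 0) (NConst 0)))))"

lemma nat_writes_estimate [simp]: "nat_writes estimate = {''s'', ''j'', ''X''}"
  by (auto simp: estimate_def)

lemma real_writes_estimate [simp]: "real_writes estimate = {''H'', ''SD'', ''U''}"
  by (auto simp: estimate_def)

definition choose_boxes :: com where
  "choose_boxes = for_loop ''p'' m_expr
     (Seq (argmax_loop ''bj'' ''j'' rounds_expr ''vb'' ''acc''
            (sum_loop ''acc'' ''s'' m_expr
              (BAnd (NLess (NAt ''X'' (nv ''s'') (NConst 0)) (NConst 1)) (hit_test ''j''))
              (RMinus (RAt ''U'' (nv ''s'') (NConst 0)) (RAt ''D'' (picked ''j'') (nv ''s'')))))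
     (Seq (NAssign ''cd'' (nv ''p'') (NConst 0) (picked ''bj''))
       (for_loop ''s'' m_expr
         (Cond (hit_test ''bj'') (NAssign ''X'' (nv ''s'') (NConst 0) (NConst 1)) Skip))))"

lemma nat_writes_choose_boxes [simp]: "nat_writes choose_boxes = {''s'', ''j'', ''X'', ''p'', ''bj'', ''cd''}"
  by (auto simp: choose_boxes_def)

lemma real_writes_choose_boxes [simp]: "real_writes choose_boxes = {''vb'', ''acc''}"
  by (auto simp: choose_boxes_def)

text \<open>\<open>ord\<close> has one row per guess because the best guess is known only after the
  last one, whereas \<open>used\<close> is reset for each. Testing \<open>used\<close> while
  appending performs \<open>dedup\<close> online.\<close>

definition build_order :: com where
  "build_order = Seq (for_loop ''p'' n_expr (NAssign ''cd'' (NPlus (nv ''m'') (nv ''p'')) (NConst 0) (nsuc (nv ''p''))))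
     (Seq (for_loop ''p'' n_expr (NAssign ''used'' (nsuc (nv ''p'')) (NConst 0) (NConst 0)))
     (Seq (setn ''len'' (NConst 0))
       (for_loop ''p'' (RPlus m_expr n_expr)
         (Cond (NLess (NAt ''used'' (NAt ''cd'' (nv ''p'') (NConst 0)) (NConst 0)) (NConst 1))
           (Seq (NAssign ''ord'' (nv ''k'') (nv ''len'') (NAt ''cd'' (nv ''p'') (NConst 0)))
           (Seq (NAssign ''used'' (NAt ''cd'' (nv ''p'') (NConst 0)) (NConst 0) (NConst 1))
             (setn ''len'' (nsuc (nv ''len'')))))
           Skip))))"

lemma nat_writes_build_order [simp]: "nat_writes build_order = {''p'', ''cd'', ''used'', ''len'', ''ord''}"
  by (auto simp: build_order_def)

lemma real_writes_build_order [simp]: "real_writes build_order = {}"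
  by (auto simp: build_order_def)

section \<open>Correctness and running time of the ascent and the rounding\<close>

context search
begin

definition input_ok :: "store \<Rightarrow> bool" where
  "input_ok st \<longleftrightarrow> nats st ''n'' 0 0 = n \<and> nats st ''m'' 0 0 = m \<and>
     (\<forall>i\<in>{1..n}. \<forall>s<m. reals st ''cost'' i s = (S ! s) i)"

definition excess_ok :: "store \<Rightarrow> bool" where
  "excess_ok st \<longleftrightarrow> input_ok st \<and> (\<forall>i\<in>{1..n}. \<forall>s<m. reals st ''D'' i s = excess n S i s)"

lemma input_ok_frame: "input_ok st \<Longrightarrow> frame st st' X Y \<Longrightarrow> ''n'' \<notin> X \<Longrightarrow> ''m'' \<notin> X \<Longrightarrow> ''cost'' \<notin> Y \<Longrightarrow> input_ok st'"
  unfolding input_ok_def frame_def by simp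

lemma excess_ok_frame: "excess_ok st \<Longrightarrow> frame st st' X Y \<Longrightarrow> ''n'' \<notin> X \<Longrightarrow> ''m'' \<notin> X \<Longrightarrow> ''cost'' \<notin> Y \<Longrightarrow>
    ''D'' \<notin> Y \<Longrightarrow> excess_ok st'"
  unfolding excess_ok_def using input_ok_frame[of st st' X Y] by (simp add: frame_def)

lemma excess_ok_input_ok: "excess_ok st \<Longrightarrow> input_ok st"
  by (simp add: excess_ok_def)

lemma input_ok_vals:
  assumes "input_ok st"
  shows "rval n_expr st = real n" "rval m_expr st = real m" "rval rounds_expr st = real (rounds n)"
    "rval scale_expr st = 4 * real n * real n" "nval (nv ''n'') st = n" "nval (nv ''m'') st = m"
  using assms by (simp_all add: input_ok_def rounds_def power4_eq_xxxx mult.assoc)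

lemma runs_compute_excess:
  assumes st: "input_ok st"
  shows "runs compute_excess st (2 + m * (9 + 12 * n)) excess_ok"
proof -
  let ?I = "\<lambda>c st'. \<forall>s<c. \<forall>i\<in>{1..n}. reals st' ''D'' i s = excess n S i s"
  have "runs compute_excess st (2 + m * ((7 + 12 * n) + 2)) (?I m)"
    unfolding compute_excess_def
  proof (rule runs_for[where I = ?I and b = m and B = "7 + 12 * n"], goal_cases)
    case (2 st')
    with st show ?case by (intro input_ok_vals(2)) (erule input_ok_frame, auto)
  next
    case (5 s st1)
    have i1: "input_ok st1" using st 5(3) by (rule input_ok_frame) auto
    show ?case
    proof (rule runs_Seq[where Ta = "5 + 6 * n" and Tb = "2 + n * 6"], rule runs_traj[where s = s and b = n and c = "\<lambda>p. (S ! s) (Suc p)"], goal_cases)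
      case (1 st')
      then show ?case using 5 by (simp add: frame_def)
    next
      case (2 st')
      with i1 show ?case by (intro input_ok_vals(1)) (erule input_ok_frame, auto)
    next
      case (3 j st')
      then have "input_ok st'" using i1 by (auto intro: input_ok_frame)
      moreover have "nats st' ''s'' 0 0 = s" using 3 5 by (simp add: frame_def)
      ultimately show ?case using 3 5 by (simp add: input_ok_def)
    next
      case 4
      show ?case using n by simp
    next
      case 5
      show ?case by (rule order_refl)
    next
      case (6 st2)
      let ?J = "\<lambda>j st'. (\<forall>s'<s. \<forall>i\<in>{1..n}. reals st' ''D'' i s' = excess n S i s') \<and>
        (\<forall>i\<in>{1..j}. reals st' ''D'' i s = excess n S i s)"
      have i2: "input_ok st2" using i1 6(2) by (rule input_ok_frame) auto
      have s2: "nats st2 ''s'' 0 0 = s" using 5 6(2) by (simp add: frame_def)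
      have Y2: "reals st2 ''Y'' s n = min_cost n S s" using 6(1) by (simp add: min_cost_def)
      have D2: "?J 0 st2" using 5 6(2) by (simp add: frame_def)
      show ?case
      proof (rule runs_mono[where T = "2 + n * 6"], rule runs_for[where I = ?J and b = n and B = 4], goal_cases)
        case (2 st')
        with i2 show ?case by (intro input_ok_vals(1)) (erule input_ok_frame, auto)
      next
        case 4
        show ?case by (rule D2)
      next
        case (5 i st')
        have i': "input_ok st'" using i2 5(3) by (rule input_ok_frame) auto
        have s': "nats st' ''s'' 0 0 = s" using s2 5(3) by (simp add: frame_def)
        have Y': "reals st' ''Y'' s n = min_cost n S s" using Y2 5(3) by (simp add: frame_def)
        have c': "reals st' ''cost'' (Suc i) s = (S ! s) (Suc i)" using i' 5 \<open>s < m\<close> by (simp add: input_ok_def)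
        have n': "nats st' ''n'' 0 0 = n" using i' by (simp add: input_ok_def)
        show ?case using 5(2,4)
          by (auto simp: s' Y' c' n' upd_apply excess_def min_def le_Suc_eq atLeastAtMostSuc_conv)
      next
        case (7 st')
        then show ?case by (auto simp: less_Suc_eq)
      qed (auto)
    next
      case 7
      show ?case by simp
    qed
  qed (auto)
  then show ?thesis
  proof (rule runs_mono)
    fix st' assume "frame st st' (nat_writes compute_excess) (real_writes compute_excess)" "?I m st'"
    then show "excess_ok st'" using st by (auto simp: excess_ok_def intro: input_ok_frame)
  qed simp
qed


abbreviation "NR \<equiv> rounds n"
abbreviation "price k \<equiv> dual_price n m (excess n S) k"
abbreviation "picked_box k j \<equiv> pick n m (excess n S) (dual_price n m (excess n S) k j)"

text \<open>Prices are one round ahead of picks: J rounds produce J picks and J + 1 price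
  vectors.\<close>

definition lp_done :: "nat \<Rightarrow> nat \<Rightarrow> store \<Rightarrow> bool" where
  "lp_done k J st \<longleftrightarrow> (\<forall>j<J. nats st ''pk'' j 0 = picked_box k j) \<and> (\<forall>j\<le>J. \<forall>s<m. reals st ''V'' j s = price k j s)"

lemma lp_done_frame: "lp_done k J st \<Longrightarrow> frame st st' X Y \<Longrightarrow> ''pk'' \<notin> X \<Longrightarrow> ''V'' \<notin> Y \<Longrightarrow> lp_done k J st'"
  unfolding lp_done_def frame_def by simp

lemma runs_ascend:
  assumes st: "excess_ok st" and k: "nats st ''k'' 0 0 = k'" "k = Suc k'"
  shows "runs ascend st (4 + 3 * m + NR * (8 + 8 * n + 4 * n * m + 5 * m)) (lp_done k NR)"
  unfolding ascend_def
proof (rule runs_Seq[where Ta = "2 + m * 3" and Tb = "2 + NR * (8 + 8 * n + 4 * n * m + 5 * m)" and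
      ?Q1.0 = "\<lambda>st'. \<forall>s<m. reals st' ''V'' 0 s = 0"], goal_cases)
  case 1
  show ?case
    by (rule runs_for[where b = m and B = 1])
       (use st in \<open>auto simp: frame_def excess_ok_def input_ok_def upd_apply less_Suc_eq\<close>)
next
  case (2 st0)
  have d0: "excess_ok st0" using st 2(2) by (rule excess_ok_frame) auto
  have k0: "nats st0 ''k'' 0 0 = k'" using k 2(2) by (simp add: frame_def)
  show ?case
  proof (rule runs_for[where I = "lp_done k" and b = NR and B = "6 + 8 * n + 4 * n * m + 5 * m"], goal_cases)
    case (2 st')
    with d0 show ?case by (intro input_ok_vals(3) excess_ok_input_ok) (erule excess_ok_frame, auto)
  next
    case (3 j st v)
    show ?case by (simp add: lp_done_def upd_other)
  next
    case 4
    show ?case using 2(1) by (simp add: lp_done_def)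
  next
    case (5 j st1)
    have d1: "excess_ok st1" using d0 5(3) by (rule excess_ok_frame) auto
    have k1: "nats st1 ''k'' 0 0 = k'" using k0 5(3) by (simp add: frame_def)
    have V1: "\<forall>s<m. reals st1 ''V'' j s = price k j s" using 5(2) by (simp add: lp_done_def)
    define f where "f i = (\<Sum>s<m. if excess n S (Suc i) s < price k j s then price k j s - excess n S (Suc i) s else 0)" for i
    have pk: "picked_box k j = Suc (argmax f n)" unfolding pick_def f_def ..
    show ?case
    proof (rule runs_Seq[where Ta = "3 + n * ((3 + 4 * m) + 5)" and Tb = "3 + 5 * m"],
           rule runs_argmax_loop[where f = f and J = "\<lambda>_ _. True" and B = "3 + 4 * m" and N = n], goal_cases)
      case (5 st')
      with d1 show ?case by (intro input_ok_vals(1) excess_ok_input_ok) (erule excess_ok_frame, auto)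
    next
      case (8 i st2)
      have d2: "excess_ok st2" using d1 8(3) by (rule excess_ok_frame) auto
      have j2: "nats st2 ''j'' 0 0 = j" using 5(4) 8(3) by (simp add: frame_def)
      have V2: "\<forall>s<m. reals st2 ''V'' j s = price k j s" using V1 8(3) by (simp add: frame_def)
      show ?case unfolding f_def
      proof (rule runs_mono, rule runs_sum_loop[where N = m and P = "\<lambda>s. excess n S (Suc i) s < price k j s" and
            R = "\<lambda>s. price k j s - excess n S (Suc i) s" and T = "3 + 4 * m"], goal_cases)
        case (1 st')
        with d2 show ?case by (intro input_ok_vals(2) excess_ok_input_ok) (erule excess_ok_frame, auto)
      next
        case (2 s st')
        then have "excess_ok st'" using d2 by (auto intro: excess_ok_frame)
        then show ?case using 2 j2 V2 8(1,4) by (simp add: frame_def excess_ok_def)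
      qed auto
    next
      case (10 st3)
      have d3: "excess_ok st3" using d1 10(2) by (rule excess_ok_frame) auto
      have k3: "nats st3 ''k'' 0 0 = k'" using k1 10(2) by (simp add: frame_def)
      have j3: "nats st3 ''j'' 0 0 = j" using 5(4) 10(2) by (simp add: frame_def)
      have lp3: "lp_done k j st3" using 5(2) 10(2) by (rule lp_done_frame) auto
      have b3: "Suc (nats st3 ''bi'' 0 0) = picked_box k j" using 10(1) pk by simp
      define st4 where "st4 = st3\<lparr>nats := upd (nats st3) ''pk'' j 0 (picked_box k j)\<rparr>"
      have fr4: "frame st3 st4 {''pk''} {}" by (simp add: st4_def frame_nupd frame_refl)
      have d4: "excess_ok st4" using d3 fr4 by (rule excess_ok_frame) auto
      have k4: "nats st4 ''k'' 0 0 = k'" using k3 fr4 by (simp add: frame_def)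
      have j4: "nats st4 ''j'' 0 0 = j" using j3 fr4 by (simp add: frame_def)
      have pk4: "\<forall>i<Suc j. nats st4 ''pk'' i 0 = picked_box k i"
        using lp3 by (auto simp: st4_def upd_apply lp_done_def less_Suc_eq)
      have V4: "\<forall>i\<le>j. \<forall>s<m. reals st4 ''V'' i s = price k i s" using lp3 by (simp add: st4_def lp_done_def)
      let ?body = "Seq (RAssign ''V'' (nsuc (nv ''j'')) (nv ''s'')
                  (RPlus (RAt ''V'' (nv ''j'') (nv ''s'')) (RNat (NConst 1))))
             (Cond (hit_test ''j'')
               (RAssign ''V'' (nsuc (nv ''j'')) (nv ''s'')
                 (RMinus (RAt ''V'' (nsuc (nv ''j'')) (nv ''s'')) (RNat (nsuc (nv ''k''))))) Skip)"
      let ?I = "\<lambda>c st'. (\<forall>i\<le>j. \<forall>s<m. reals st' ''V'' i s = price k i s) \<and>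
         (\<forall>s<c. reals st' ''V'' (Suc j) s = price k (Suc j) s)"
      have "runs (for_loop ''s'' m_expr ?body) st4 (2 + m * (3 + 2)) (?I m)"
      proof (rule runs_for[where I = ?I and b = m and B = 3], goal_cases)
        case (2 st')
        with d4 show ?case by (intro input_ok_vals(2) excess_ok_input_ok) (erule excess_ok_frame, auto)
      next
        case (5 s st')
        have d': "excess_ok st'" using d4 5(3) by (rule excess_ok_frame) auto
        have j': "nats st' ''j'' 0 0 = j" using j4 5(3) by (simp add: frame_def)
        have k': "nats st' ''k'' 0 0 = k'" using k4 5(3) by (simp add: frame_def)
        have pk': "nats st' ''pk'' j 0 = picked_box k j" using pk4 5(3) by (simp add: frame_def)
        have "picked_box k j \<in> {1..n}" by (rule pick_range[OF n])
        then have D': "reals st' ''D'' (picked_box k j) s = excess n S (picked_box k j) s" using d' 5(1) by (simp add: excess_ok_def)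
        have V': "reals st' ''V'' j s = price k j s" using 5(1,2) by blast
        show ?case using 5(1,2) by (auto simp: 5(4) j' k' pk' D' V' k(2)[symmetric] upd_apply less_Suc_eq)
      qed (use V4 in auto)
      then have "runs (for_loop ''s'' m_expr ?body) st4 (2 + 5 * m) (lp_done k (Suc j))"
      proof (rule runs_mono, goal_cases)
        case (1 st')
        then show ?case using pk4 by (auto simp: lp_done_def frame_def le_Suc_eq)
      qed simp
      then show ?case by (simp add: b3 j3 st4_def)
    qed (auto simp: algebra_simps)
  qed (auto simp: algebra_simps)
qed (auto)

definition u_done :: "nat \<Rightarrow> store \<Rightarrow> bool" where
  "u_done k st \<longleftrightarrow> excess_ok st \<and> lp_done k NR st \<and> (\<forall>s<m. reals st ''U'' s 0 = est_cost n m (excess n S) k s)"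

lemma u_done_frame: "u_done k st \<Longrightarrow> frame st st' X Y \<Longrightarrow> ''n'' \<notin> X \<Longrightarrow> ''m'' \<notin> X \<Longrightarrow> ''cost'' \<notin> Y \<Longrightarrow>
    ''D'' \<notin> Y \<Longrightarrow> ''pk'' \<notin> X \<Longrightarrow> ''V'' \<notin> Y \<Longrightarrow> ''U'' \<notin> Y \<Longrightarrow> u_done k st'"
  unfolding u_done_def using excess_ok_frame[of st st' X Y] lp_done_frame[of k NR st st' X Y] by (simp add: frame_def)

lemma hit_test_val:
  assumes "excess_ok st" "lp_done k NR st" "nats st jv 0 0 = j" "j < NR" "nats st ''s'' 0 0 = s" "s < m"
  shows "bval (hit_test jv) st = hit n m (excess n S) k j s" "rval (RAt ''D'' (picked jv) (nv ''s'')) st = excess n S (picked_box k j) s"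
proof -
  have "reals st ''D'' (picked_box k j) s = excess n S (picked_box k j) s" using assms pick_range[OF n] by (simp add: excess_ok_def)
  moreover have "nats st ''pk'' j 0 = picked_box k j" "reals st ''V'' j s = price k j s"
    using assms by (simp_all add: lp_done_def)
  ultimately show "bval (hit_test jv) st = hit n m (excess n S) k j s"
    "rval (RAt ''D'' (picked jv) (nv ''s'')) st = excess n S (picked_box k j) s"
    using assms by (simp_all add: hit_def)
qed

lemma runs_estimate:
  assumes st: "excess_ok st" and lp: "lp_done k NR st"
  shows "runs estimate st (2 + m * (10 + 8 * NR)) (\<lambda>st'. u_done k st' \<and> (\<forall>s<m. nats st' ''X'' s 0 = 0))"
proof -
  let ?I = "\<lambda>c st'. \<forall>s<c. reals st' ''U'' s 0 = est_cost n m (excess n S) k s \<and> nats st' ''X'' s 0 = 0"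
  have "runs estimate st (2 + m * (8 + 8 * NR + 2)) (?I m)"
    unfolding estimate_def
  proof (rule runs_for[where I = ?I and b = m and B = "8 + 8 * NR"], goal_cases)
    case (2 st')
    with st show ?case by (intro input_ok_vals(2) excess_ok_input_ok) (erule excess_ok_frame, auto)
  next
    case (3 j st v)
    show ?case by (simp add: upd_other)
  next
    case (5 s st1)
    have d1: "excess_ok st1" using st 5(3) by (rule excess_ok_frame) auto
    have lp1: "lp_done k NR st1" using lp 5(3) by (rule lp_done_frame) auto
    show ?case
    proof (rule runs_Seq[where Ta = "3 + 4 * NR" and Tb = "5 + 4 * NR"],
        rule runs_sum_loop[where N = NR and P = "\<lambda>j. hit n m (excess n S) k j s" and R = "\<lambda>_. 1"], goal_cases)
      case (1 st')
      with d1 show ?case by (intro input_ok_vals(3) excess_ok_input_ok) (erule excess_ok_frame, auto)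
    next
      case (2 j st')
      have "excess_ok st'" using d1 2(2) by (rule excess_ok_frame) auto
      moreover have "lp_done k NR st'" using lp1 2(2) by (rule lp_done_frame) auto
      moreover have "nats st' ''s'' 0 0 = s" using 2(2) 5(4) by (simp add: frame_def)
      ultimately show ?case using hit_test_val(1)[of st' k "''j''" j s] 2 5(1) by simp
    next
      case 3
      show ?case by simp
    next
      case (4 st2)
      have d2: "excess_ok st2" using d1 4(2) by (rule excess_ok_frame) auto
      have lp2: "lp_done k NR st2" using lp1 4(2) by (rule lp_done_frame) auto
      have s2: "nats st2 ''s'' 0 0 = s" using 4(2) 5(4) by (simp add: frame_def)
      have I2: "?I s st2" using 4(2) 5(2) by (simp add: frame_def)
      have H2: "reals st2 ''H'' 0 0 = hit_count n m (excess n S) k s" using 4(1) by (simp add: hit_count_def)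
      show ?case
      proof (rule runs_Seq[where Ta = "3 + 4 * NR" and Tb = 2],
          rule runs_sum_loop[where N = NR and P = "\<lambda>j. hit n m (excess n S) k j s" and R = "\<lambda>j. excess n S (picked_box k j) s"], goal_cases)
        case (1 st')
        with d2 show ?case by (intro input_ok_vals(3) excess_ok_input_ok) (erule excess_ok_frame, auto)
      next
        case (2 j st')
        have "excess_ok st'" using d2 2(2) by (rule excess_ok_frame) auto
        moreover have "lp_done k NR st'" using lp2 2(2) by (rule lp_done_frame) auto
        moreover have "nats st' ''s'' 0 0 = s" using 2(2) s2 by (simp add: frame_def)
        ultimately show ?case using hit_test_val[of st' k "''j''" j s] 2 5(1) by simp
      next
        case 3
        show ?case by simp
      next
        case (4 st3)
        have d3: "excess_ok st3" using d2 4(2) by (rule excess_ok_frame) auto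
        have s3: "nats st3 ''s'' 0 0 = s" using s2 4(2) by (simp add: frame_def)
        have I3: "?I s st3" using 4(2) I2 by (simp add: frame_def)
        have H3: "reals st3 ''H'' 0 0 = hit_count n m (excess n S) k s" using 4(2) H2 by (simp add: frame_def)
        have SD3: "reals st3 ''SD'' 0 0 = hit_cost n m (excess n S) k s" using 4(1) by (simp add: hit_cost_def)
        have n3: "real (nats st3 ''n'' 0 0) = real n" using d3 by (simp add: excess_ok_def input_ok_def)
        have N: "60 * (real n * real n * (real n * real n)) = real NR"
          by (simp add: rounds_def power4_eq_xxxx mult.assoc)
        show ?case using I3 by (auto simp: s3 H3 SD3 n3 N est_cost_def upd_apply less_Suc_eq)
      next
        case 5
        show ?case by simp
      qed
    next
      case 5
      show ?case by simp
    qed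
  qed (auto)
  then show ?thesis
  proof (rule runs_mono, goal_cases)
    case (1 st')
    then show ?case using st lp by (auto simp: u_done_def intro: excess_ok_frame lp_done_frame)
  qed simp
qed

lemma runs_choose_boxes:
  assumes st: "u_done k st" "\<forall>s<m. nats st ''X'' s 0 = 0"
  shows "runs choose_boxes st (2 + m * (8 + 8 * NR + 4 * NR * m + 4 * m))
    (\<lambda>st'. excess_ok st' \<and> (\<forall>p<m. nats st' ''cd'' p 0 = chosen_box n m (excess n S) k p))"
proof -
  let ?D = "excess n S"
  let ?I = "\<lambda>p st'. (\<forall>q<p. nats st' ''cd'' q 0 = chosen_box n m ?D k q) \<and>
     (\<forall>s<m. nats st' ''X'' s 0 = of_bool (s \<in> stopped n m ?D k p))"
  have "runs choose_boxes st (2 + m * ((6 + 8 * NR + 4 * NR * m + 4 * m) + 2)) (?I m)"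
    unfolding choose_boxes_def
  proof (rule runs_for[where I = ?I and b = m and B = "6 + 8 * NR + 4 * NR * m + 4 * m"], goal_cases)
    case (2 st')
    then have "u_done k st'" using st(1) by (auto intro: u_done_frame)
    then show ?case by (simp add: u_done_def excess_ok_def input_ok_def)
  next
    case (3 j st v)
    show ?case by (simp add: upd_other)
  next
    case 4
    show ?case using st by simp
  next
    case (5 p st1)
    have u1: "u_done k st1" using st(1) 5(3) by (rule u_done_frame) auto
    define X where "X = stopped n m ?D k p"
    have X1: "\<forall>s<m. nats st1 ''X'' s 0 = of_bool (s \<in> X)" using 5(2) by (simp add: X_def)
    define f where "f j = (\<Sum>s<m. if s \<notin> X \<and> hit n m ?D k j s then est_cost n m ?D k s - ?D (picked_box k j) s else 0)" for j
    have best_round: "best_round n m ?D k X = argmax f NR" unfolding best_round_def f_def ..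
    show ?case
    proof (rule runs_Seq[where Ta = "3 + NR * ((3 + 4 * m) + 5)" and Tb = "3 + 4 * m"],
           rule runs_argmax_loop[where f = f and J = "\<lambda>_ _. True" and B = "3 + 4 * m" and N = NR], goal_cases)
      case (5 st')
      then have "u_done k st'" using u1 by (auto intro: u_done_frame)
      then show ?case by (intro input_ok_vals(3) excess_ok_input_ok) (simp add: u_done_def)
    next
      case (8 j st2)
      have u2: "u_done k st2" using u1 8(3) by (rule u_done_frame) auto
      have X2: "\<forall>s<m. nats st2 ''X'' s 0 = of_bool (s \<in> X)" using X1 8(3) by (simp add: frame_def)
      show ?case unfolding f_def
      proof (rule runs_mono, rule runs_sum_loop[where N = m and P = "\<lambda>s. s \<notin> X \<and> hit n m ?D k j s" and
            R = "\<lambda>s. est_cost n m ?D k s - ?D (picked_box k j) s" and T = "3 + 4 * m"], goal_cases)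
        case (1 st')
        then have "u_done k st'" using u2 by (auto intro: u_done_frame)
        then show ?case by (intro input_ok_vals(2) excess_ok_input_ok) (simp add: u_done_def)
      next
        case (2 s st')
        have u': "u_done k st'" using u2 2(2) by (rule u_done_frame) auto
        have j': "nats st' ''j'' 0 0 = j" using 8(4) 2(2) by (simp add: frame_def)
        have X': "nats st' ''X'' s 0 = of_bool (s \<in> X)" using X2 2(1,2) by (simp add: frame_def)
        have U': "reals st' ''U'' s 0 = est_cost n m ?D k s" using u' 2(1) by (simp add: u_done_def)
        have "bval (hit_test ''j'') st' = hit n m ?D k j s" "rval (RAt ''D'' (picked ''j'') (nv ''s'')) st' = ?D (picked_box k j) s"
          using hit_test_val[of st' k "''j''" j s] u' j' 2 8(1) by (simp_all add: u_done_def)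
        then show ?case using X' U' 2(3) by simp
      qed auto
    next
      case (10 st3)
      have u3: "u_done k st3" using u1 10(2) by (rule u_done_frame) auto
      have X3: "\<forall>s<m. nats st3 ''X'' s 0 = of_bool (s \<in> X)" using X1 10(2) by (simp add: frame_def)
      have p3: "nats st3 ''p'' 0 0 = p" using 5(4) 10(2) by (simp add: frame_def)
      have c3: "\<forall>q<p. nats st3 ''cd'' q 0 = chosen_box n m ?D k q" using 5(2) 10(2) by (simp add: frame_def)
      define j where "j = best_round n m ?D k X"
      have b3: "nats st3 ''bj'' 0 0 = j" using 10(1) best_round by (simp add: j_def)
      have j: "j < NR" unfolding j_def best_round by (rule argmax_less) (use n in \<open>simp add: rounds_def\<close>)
      have pk3: "nats st3 ''pk'' j 0 = picked_box k j" using u3 j by (simp add: u_done_def lp_done_def)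
      have chosen_box: "chosen_box n m ?D k p = picked_box k j" by (simp add: chosen_box_def j_def X_def)
      define st4 where "st4 = st3\<lparr>nats := upd (nats st3) ''cd'' p 0 (picked_box k j)\<rparr>"
      have fr4: "frame st3 st4 {''cd''} {}" by (simp add: st4_def frame_nupd frame_refl)
      have u4: "u_done k st4" using u3 fr4 by (rule u_done_frame) auto
      have X4: "\<forall>s<m. nats st4 ''X'' s 0 = of_bool (s \<in> X)" using X3 fr4 by (simp add: frame_def)
      have b4: "nats st4 ''bj'' 0 0 = j" using b3 fr4 by (simp add: frame_def)
      have c4: "\<forall>q<Suc p. nats st4 ''cd'' q 0 = chosen_box n m ?D k q"
        using c3 chosen_box by (auto simp: st4_def upd_apply less_Suc_eq)
      let ?body = "Cond (hit_test ''bj'') (NAssign ''X'' (nv ''s'') (NConst 0) (NConst 1)) Skip"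
      let ?J = "\<lambda>c st'. \<forall>s<m. nats st' ''X'' s 0 = of_bool (s \<in> X \<or> s < c \<and> hit n m ?D k j s)"
      have "runs (for_loop ''s'' m_expr ?body) st4 (2 + m * (2 + 2)) (?J m)"
      proof (rule runs_for[where I = ?J and b = m and B = 2], goal_cases)
        case (2 st')
        then have "u_done k st'" using u4 by (auto intro: u_done_frame)
        then show ?case by (intro input_ok_vals(2) excess_ok_input_ok) (simp add: u_done_def)
      next
        case (3 j st v)
        show ?case by (simp add: upd_other)
      next
        case (5 s st')
        have u': "u_done k st'" using u4 5(3) by (rule u_done_frame) auto
        have b': "nats st' ''bj'' 0 0 = j" using b4 5(3) by (simp add: frame_def)
        have "bval (hit_test ''bj'') st' = hit n m ?D k j s"
          using hit_test_val(1)[of st' k "''bj''" j s] u' b' j 5(1,4) by (simp add: u_done_def)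
        then show ?case using 5(2,4) by (auto simp: upd_apply less_Suc_eq simp del: bval.simps)
      qed (use X4 in auto)
      then have "runs (for_loop ''s'' m_expr ?body) st4 (2 + 4 * m) (?I (Suc p))"
      proof (rule runs_mono, goal_cases)
        case (1 st')
        have "\<forall>q<Suc p. nats st' ''cd'' q 0 = chosen_box n m ?D k q" using c4 1(1) by (simp add: frame_def)
        moreover have "s \<in> stopped n m ?D k (Suc p) \<longleftrightarrow> s \<in> X \<or> s < m \<and> hit n m ?D k j s" for s
          by (auto simp: X_def j_def)
        ultimately show ?case using 1(2) by (simp del: stopped.simps)
      qed simp
      then show ?case by (simp add: b3 p3 pk3 st4_def)
    qed (auto simp: algebra_simps)
  qed (auto simp: algebra_simps)
  then show ?thesis
  proof (rule runs_mono, goal_cases)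
    case (1 st')
    have "excess_ok st" using st by (simp add: u_done_def)
    then have "excess_ok st'" using 1(1) by (rule excess_ok_frame) auto
    then show ?case using 1(2) by blast
  qed simp
qed


lemma runs_build_order:
  assumes st: "input_ok st" and k: "nats st ''k'' 0 0 = k'" "k = Suc k'"
    and cd: "\<forall>p<m. nats st ''cd'' p 0 = chosen_box n m (excess n S) k p"
  shows "runs build_order st (7 + 6 * n + 6 * (m + n)) (\<lambda>st'.
    (\<forall>q<n. nats st' ''ord'' k' q = probe_order n S k ! q) \<and>
    (\<forall>i. i \<noteq> k' \<longrightarrow> nats st' ''ord'' i = nats st ''ord'' i))"
  unfolding build_order_def
proof (rule runs_Seq[where Ta = "2 + n * 3" and Tb = "5 + 3 * n + 6 * (m + n)"],
    rule runs_for[where b = n and B = 1 and I = "\<lambda>j st'. \<forall>p<m + j. nats st' ''cd'' p 0 = probe_seq n S k p"], goal_cases)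
  case (2 st')
  with st show ?case by (intro input_ok_vals(1)) (erule input_ok_frame, auto)
next
  case (3 j st v)
  show ?case by (simp add: upd_other)
next
  case 4
  show ?case using cd by (simp add: probe_seq_def)
next
  case (5 j st')
  then have "nats st' ''m'' 0 0 = m" using st by (simp add: frame_def input_ok_def)
  then show ?case using 5 by (auto simp: upd_apply less_Suc_eq probe_seq_def)
next
  case (7 st1)
  have i1: "input_ok st1" using st 7(2) by (rule input_ok_frame) auto
  have k1: "nats st1 ''k'' 0 0 = k'" using k 7(2) by (simp add: frame_def)
  have o1: "nats st1 ''ord'' = nats st ''ord''" using 7(2) by (simp add: frame_def)
  show ?case
  proof (rule runs_Seq[where Ta = "2 + n * 3" and Tb = "3 + 6 * (m + n)"],
      rule runs_for[where b = n and B = 1 and I = "\<lambda>j st'. \<forall>i\<in>{1..j}. nats st' ''used'' i 0 = 0"], goal_cases)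
    case (2 st')
    with i1 show ?case by (intro input_ok_vals(1)) (erule input_ok_frame, auto)
  next
    case (3 j st v)
    show ?case by (simp add: upd_other)
  next
    case (5 j st')
    then show ?case by (auto simp: upd_apply le_Suc_eq)
  next
    case (7 st2)
    have i2: "input_ok st2" using i1 7(2) by (rule input_ok_frame) auto
    have k2: "nats st2 ''k'' 0 0 = k'" using k1 7(2) by (simp add: frame_def)
    have o2: "nats st2 ''ord'' = nats st ''ord''" using 7(2) o1 by (simp add: frame_def)
    have c2: "\<forall>p<m + n. nats st2 ''cd'' p 0 = probe_seq n S k p"
      using \<open>\<forall>p<m + n. nats st1 ''cd'' p 0 = probe_seq n S k p\<close> 7(2) by (simp add: frame_def)
    define st3 where "st3 = st2\<lparr>nats := upd (nats st2) ''len'' 0 0 0\<rparr>"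
    have fr3: "frame st2 st3 {''len''} {}" by (simp add: st3_def frame_nupd frame_refl)
    have i3: "input_ok st3" using i2 fr3 by (rule input_ok_frame) auto
    \<comment> \<open>After j candidates the row holds the first j of them without repetitions, and
      \<open>used\<close> is the characteristic function of this prefix.\<close>
    define l where "l j = dedup (map (probe_seq n S k) [0..<j])" for j
    have l_Suc: "l (Suc j) = (if probe_seq n S k j \<in> set (l j) then l j else l j @ [probe_seq n S k j])" for j
      by (auto simp: l_def dedup_snoc)
    let ?I = "\<lambda>j st'. nats st' ''len'' 0 0 = length (l j) \<and> (\<forall>q<length (l j). nats st' ''ord'' k' q = l j ! q) \<and>
      (\<forall>i. i \<noteq> k' \<longrightarrow> nats st' ''ord'' i = nats st ''ord'' i) \<and>
      (\<forall>i\<in>{1..n}. nats st' ''used'' i 0 = of_bool (i \<in> set (l j)))"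
    let ?body = "Cond (NLess (NAt ''used'' (NAt ''cd'' (nv ''p'') (NConst 0)) (NConst 0)) (NConst 1))
           (Seq (NAssign ''ord'' (nv ''k'') (nv ''len'') (NAt ''cd'' (nv ''p'') (NConst 0)))
           (Seq (NAssign ''used'' (NAt ''cd'' (nv ''p'') (NConst 0)) (NConst 0) (NConst 1))
             (setn ''len'' (nsuc (nv ''len'')))))
           Skip"
    have "runs (for_loop ''p'' (RPlus m_expr n_expr) ?body) st3 (2 + (m + n) * (4 + 2)) (?I (m + n))"
    proof (rule runs_for[where b = "m + n" and B = 4 and I = ?I], goal_cases)
      case (2 st')
      then have "input_ok st'" using i3 by (auto intro: input_ok_frame)
      then show ?case by (simp add: input_ok_def)
    next
      case (3 j st v)
      show ?case by (simp add: upd_apply upd_other)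
    next
      case 4
      show ?case using 7(1) o2 by (simp add: l_def st3_def upd_apply upd_other)
    next
      case (5 j st')
      have k': "nats st' ''k'' 0 0 = k'" using k2 5(3) by (simp add: st3_def frame_def upd_other)
      have c': "nats st' ''cd'' j 0 = probe_seq n S k j" using c2 5(1,3) by (simp add: st3_def frame_def upd_other)
      have "probe_seq n S k j \<in> {1..n}"
        using 5(1) chosen_box_range[of m "excess n S" k j] by (auto simp: probe_seq_def)
      then have u': "nats st' ''used'' (probe_seq n S k j) 0 = of_bool (probe_seq n S k j \<in> set (l j))"
        using 5(2) by blast
      show ?case
      proof (cases "probe_seq n S k j \<in> set (l j)")
        case True
        then have "l (Suc j) = l j" by (simp add: l_Suc)
        then show ?thesis using 5(2,4) True u' c' by simp
      next
        case False
        then have "l (Suc j) = l j @ [probe_seq n S k j]" by (simp add: l_Suc)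
        then show ?thesis using 5(2,4) False u' c' k'
          by (auto simp: upd_apply nth_append less_Suc_eq upd_def fun_eq_iff)
      qed
    qed auto
    then have "runs (for_loop ''p'' (RPlus m_expr n_expr) ?body) st3 (2 + 6 * (m + n)) (\<lambda>st'.
      (\<forall>q<n. nats st' ''ord'' k' q = probe_order n S k ! q) \<and>
      (\<forall>i. i \<noteq> k' \<longrightarrow> nats st' ''ord'' i = nats st ''ord'' i))"
    proof (rule runs_mono, goal_cases)
      case (1 st')
      have "l (m + n) = probe_order n S k" by (simp add: l_def probe_order_def)
      then show ?case using 1(2) length_probe_order[of k] by simp
    qed simp
    then show ?case by (simp add: st3_def)
  qed auto
qed auto

end

section \<open>Evaluation and selection of thresholds\<close>

definition observe :: com where
  "observe = for_loop ''s'' m_expr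
     (traj (nv ''s'') (RAt ''cost'' (NAt ''ord'' (nv ''k'') (nv ''tt'')) (nv ''s'')) n_expr)"

lemma nat_writes_observe [simp]: "nat_writes observe = {''s'', ''tt''}"
  by (auto simp: observe_def)

lemma real_writes_observe [simp]: "real_writes observe = {''Y'', ''A''}"
  by (auto simp: observe_def)

text \<open>Time runs backwards: \<open>e\<close> starts with the cost of stopping at n and is
  overwritten whenever an earlier time stops, so the first stopping time wins without leaving the
  loop early. After q rounds \<open>e\<close> is \<open>stop_cost\<close> with q further probes
  possible. The inner test is the negation of \<open>stops\<close>.\<close>

definition evaluate :: com where
  "evaluate = Seq (setr ''acc'' (RNat (NConst 0)))
     (for_loop ''s'' m_expr
       (Seq (setr ''e'' (RPlus n_expr (RAt ''Y'' (nv ''s'') (nv ''n''))))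
       (Seq (for_loop ''q'' (RMinus n_expr (RNat (NConst 1)))
              (Cond (RLess (RNat (NConst 1))
                      (RTimes (RAt ''Y'' (nv ''s'') (NMinus (nv ''n'') (NPlus (nv ''q'') (NConst 1))))
                        (RMinus (rv ''al'') (RAt ''A'' (nv ''s'') (NMinus (nv ''n'') (NPlus (nv ''q'') (NConst 2)))))))
                Skip
                (setr ''e'' (RPlus (RNat (NMinus (nv ''n'') (NPlus (nv ''q'') (NConst 1))))
                  (RAt ''Y'' (nv ''s'') (NMinus (nv ''n'') (NPlus (nv ''q'') (NConst 1))))))))
         (setr ''acc'' (RPlus (rv ''acc'') (RMinus (RNat (NConst 0)) (rv ''e'')))))))"

lemma nat_writes_evaluate [simp]: "nat_writes evaluate = {''s'', ''q''}"
  by (auto simp: evaluate_def)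

lemma real_writes_evaluate [simp]: "real_writes evaluate = {''acc'', ''e''}"
  by (auto simp: evaluate_def)

definition choose_time :: com where
  "choose_time = argmax_loop ''bt'' ''t'' (RNat (nsuc (nv ''n''))) ''vc'' ''acc''
     (Seq (setr ''al'' (RAt ''A'' (nv ''u'') (nv ''t'')))
     (Seq (Cond (NLess (nv ''t'') (NConst 1)) (setr ''al'' (RNat (NConst 1))) Skip)
       evaluate))"

lemma nat_writes_choose_time [simp]: "nat_writes choose_time = {''s'', ''q'', ''bt'', ''t''}"
  by (auto simp: choose_time_def)

lemma real_writes_choose_time [simp]: "real_writes choose_time = {''acc'', ''e'', ''vc'', ''al''}"
  by (auto simp: choose_time_def)

text \<open>The next scenario overwrites \<open>bt\<close> and \<open>vc\<close>, so the best
  threshold and its value are copied out.\<close>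

definition choose_scenario :: com where
  "choose_scenario = argmax_loop ''bs'' ''u'' m_expr ''vd'' ''acd''
     (Seq choose_time
     (Seq (RAssign ''al2'' (nv ''u'') (NConst 0) (RAt ''A'' (nv ''u'') (nv ''bt'')))
     (Seq (Cond (NLess (nv ''bt'') (NConst 1)) (RAssign ''al2'' (nv ''u'') (NConst 0) (RNat (NConst 1))) Skip)
       (setr ''acd'' (RAt ''vc'' (nv ''bt'') (NConst 0))))))"

lemma nat_writes_choose_scenario [simp]: "nat_writes choose_scenario = {''s'', ''q'', ''bt'', ''t'', ''bs'', ''u''}"
  by (auto simp: choose_scenario_def)

lemma real_writes_choose_scenario [simp]: "real_writes choose_scenario = {''acc'', ''e'', ''vc'', ''al'', ''vd'', ''acd'', ''al2''}"
  by (auto simp: choose_scenario_def)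

context search
begin

definition traj_done :: "nat \<Rightarrow> store \<Rightarrow> bool" where
  "traj_done k st \<longleftrightarrow> input_ok st \<and> (\<forall>s<m. \<forall>t\<le>n. reals st ''Y'' s t = run_min (seen_cost n S k s) t \<and> reals st ''A'' s t = recip_sum (seen_cost n S k s) t)"

lemma traj_done_frame: "traj_done k st \<Longrightarrow> frame st st' X Y \<Longrightarrow> ''n'' \<notin> X \<Longrightarrow> ''m'' \<notin> X \<Longrightarrow> ''cost'' \<notin> Y \<Longrightarrow>
    ''Y'' \<notin> Y \<Longrightarrow> ''A'' \<notin> Y \<Longrightarrow> traj_done k st'"
  unfolding traj_done_def using input_ok_frame[of st st' X Y] by (simp add: frame_def)

lemma runs_observe:
  assumes st: "input_ok st" and k: "nats st ''k'' 0 0 = k'" and ord: "\<forall>q<n. nats st ''ord'' k' q = probe_order n S k ! q"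
  shows "runs observe st (2 + m * (7 + 6 * n)) (traj_done k)"
proof -
  let ?I = "\<lambda>c st'. \<forall>s<c. \<forall>t\<le>n. reals st' ''Y'' s t = run_min (seen_cost n S k s) t \<and> reals st' ''A'' s t = recip_sum (seen_cost n S k s) t"
  have "runs observe st (2 + m * ((5 + 6 * n) + 2)) (?I m)"
    unfolding observe_def
  proof (rule runs_for[where I = ?I and b = m and B = "5 + 6 * n"], goal_cases)
    case (2 st')
    with st show ?case by (intro input_ok_vals(2)) (erule input_ok_frame, auto)
  next
    case (5 s st1)
    have i1: "input_ok st1" using st 5(3) by (rule input_ok_frame) auto
    have k1: "nats st1 ''k'' 0 0 = k'" using k 5(3) by (simp add: frame_def)
    have o1: "\<forall>q<n. nats st1 ''ord'' k' q = probe_order n S k ! q" using ord 5(3) by (simp add: frame_def)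
    show ?case
    proof (rule runs_mono, rule runs_traj[where s = s and b = n and c = "seen_cost n S k s" and T = "5 + 6 * n"], goal_cases)
      case (1 st')
      then show ?case using 5 by (simp add: frame_def)
    next
      case (2 st')
      with i1 show ?case by (intro input_ok_vals(1)) (erule input_ok_frame, auto)
    next
      case (3 j st')
      then have i': "input_ok st'" using i1 by (auto intro: input_ok_frame)
      have "nats st' ''s'' 0 0 = s" "nats st' ''k'' 0 0 = k'" "nats st' ''ord'' k' j = probe_order n S k ! j"
        using 3 5 k1 o1 by (simp_all add: frame_def)
      moreover have "probe_order n S k ! j \<in> {1..n}" using set_probe_order[of k] nth_mem[of j "probe_order n S k"] 3 by (simp add: length_probe_order)
      ultimately show ?case using 3 5(1) i' by (simp add: input_ok_def seen_cost_def)
    next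
      case 4
      show ?case using n by simp
    next
      case 5
      show ?case by simp
    next
      case (6 st')
      then show ?case using 5(2) by (auto simp: less_Suc_eq)
    next
      case 7
      show ?case by simp
    qed
  qed auto
  then show ?thesis
  proof (rule runs_mono, goal_cases)
    case (1 st')
    then show ?case using st by (auto simp: traj_done_def intro: input_ok_frame)
  qed simp
qed

lemma runs_evaluate:
  assumes st: "traj_done k st" and threshold: "reals st ''al'' 0 0 = \<alpha>"
  shows "runs evaluate st (3 + m * (6 + 4 * n)) (\<lambda>st'. reals st' ''acc'' 0 0 = neg_total_cost n S k \<alpha>)"
proof -
  define st0 where "st0 = st\<lparr>reals := upd (reals st) ''acc'' 0 0 0\<rparr>"
  have fr0: "frame st st0 {} {''acc''}" by (simp add: st0_def frame_def upd_other)
  have t0: "traj_done k st0" using st fr0 by (rule traj_done_frame) auto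
  have a0: "reals st0 ''al'' 0 0 = \<alpha>" using threshold fr0 by (simp add: frame_def)
  let ?I = "\<lambda>c st'. reals st' ''acc'' 0 0 = (\<Sum>s<c. 0 - stop_cost (seen_cost n S k s) \<alpha> (n - 1) 1)"
  let ?in = "Cond (RLess (RNat (NConst 1))
                      (RTimes (RAt ''Y'' (nv ''s'') (NMinus (nv ''n'') (NPlus (nv ''q'') (NConst 1))))
                        (RMinus (rv ''al'') (RAt ''A'' (nv ''s'') (NMinus (nv ''n'') (NPlus (nv ''q'') (NConst 2)))))))
                Skip
                (setr ''e'' (RPlus (RNat (NMinus (nv ''n'') (NPlus (nv ''q'') (NConst 1))))
                  (RAt ''Y'' (nv ''s'') (NMinus (nv ''n'') (NPlus (nv ''q'') (NConst 1))))))"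
  let ?body = "Seq (setr ''e'' (RPlus n_expr (RAt ''Y'' (nv ''s'') (nv ''n''))))
       (Seq (for_loop ''q'' (RMinus n_expr (RNat (NConst 1))) ?in)
         (setr ''acc'' (RPlus (rv ''acc'') (RMinus (RNat (NConst 0)) (rv ''e'')))))"
  have "runs (for_loop ''s'' m_expr ?body) st0 (2 + m * ((4 + 4 * n) + 2)) (?I m)"
  proof (rule runs_for[where I = ?I and b = m and B = "4 + 4 * n"], goal_cases)
    case (2 st')
    then have "traj_done k st'" using t0 by (auto intro: traj_done_frame)
    then show ?case by (simp add: traj_done_def input_ok_def)
  next
    case 4
    show ?case by (simp add: st0_def upd_apply)
  next
    case (5 s st1)
    have t1: "traj_done k st1" using t0 5(3) by (rule traj_done_frame) auto
    have a1: "reals st1 ''al'' 0 0 = \<alpha>" using a0 5(3) by (simp add: frame_def)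
    have n1: "nats st1 ''n'' 0 0 = n" using t1 by (simp add: traj_done_def input_ok_def)
    have Yn: "reals st1 ''Y'' s n = run_min (seen_cost n S k s) n" using t1 5(1) by (simp add: traj_done_def)
    define st2 where "st2 = st1\<lparr>reals := upd (reals st1) ''e'' 0 0 (real n + run_min (seen_cost n S k s) n)\<rparr>"
    have fr2: "frame st1 st2 {} {''e''}" by (simp add: st2_def frame_def upd_other)
    have t2: "traj_done k st2" using t1 fr2 by (rule traj_done_frame) auto
    have a2: "reals st2 ''al'' 0 0 = \<alpha>" using a1 fr2 by (simp add: frame_def)
    have s2: "nats st2 ''s'' 0 0 = s" using 5(4) fr2 by (simp add: frame_def)
    have acc2: "reals st2 ''acc'' 0 0 = (\<Sum>s<s. 0 - stop_cost (seen_cost n S k s) \<alpha> (n - 1) 1)" using 5(2) fr2 by (simp add: frame_def)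
    let ?J = "\<lambda>q st'. reals st' ''e'' 0 0 = stop_cost (seen_cost n S k s) \<alpha> q (n - q)"
    have "runs (Seq (for_loop ''q'' (RMinus n_expr (RNat (NConst 1))) ?in)
         (setr ''acc'' (RPlus (rv ''acc'') (RMinus (RNat (NConst 0)) (rv ''e''))))) st2 (3 + 4 * n) (?I (Suc s))"
    proof (rule runs_Seq[where Ta = "2 + (n - 1) * 4" and Tb = 1],
        rule runs_for[where I = ?J and b = "n - 1" and B = 2], goal_cases)
      case (2 st')
      then have "traj_done k st'" using t2 by (auto intro: traj_done_frame)
      then show ?case using n by (simp add: traj_done_def input_ok_def of_nat_diff)
    next
      case 4
      show ?case by (simp add: st2_def upd_apply)
    next
      case (5 q st')
      have t': "traj_done k st'" using t2 5(3) by (rule traj_done_frame) auto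
      have n': "nats st' ''n'' 0 0 = n" using t' by (simp add: traj_done_def input_ok_def)
      have s': "nats st' ''s'' 0 0 = s" using s2 5(3) by (simp add: frame_def)
      have a': "reals st' ''al'' 0 0 = \<alpha>" using a2 5(3) by (simp add: frame_def)
      \<comment> \<open>The round tests time n - (q + 1) = Suc t, while \<open>stops\<close> reads
        the clock one step earlier, at t.\<close>
      obtain t where t: "n = Suc (Suc q + t)" using 5(1) by (metis Suc_eq_plus1 add_Suc less_diff_conv less_imp_Suc_add)
      have YA: "reals st' ''Y'' s (Suc t) = run_min (seen_cost n S k s) (Suc t)" "reals st' ''A'' s t = recip_sum (seen_cost n S k s) t"
        using t' \<open>s < m\<close> t unfolding traj_done_def by (metis le_add2 add_Suc_right le_SucI Suc_le_mono)+
      have e: "reals st' ''e'' 0 0 = stop_cost (seen_cost n S k s) \<alpha> q (Suc (Suc t))" using 5(2) t by simp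
      have d: "n - Suc q = Suc t" "n - Suc (Suc q) = t" using t by auto
      show ?case
        using e by (auto simp: n' s' a' 5(4) d YA stops_def upd_apply simp del: run_min.simps recip_sum.simps)
    next
      case (7 st3)
      have "reals st3 ''e'' 0 0 = stop_cost (seen_cost n S k s) \<alpha> (n - 1) 1" using 7(1) n by simp
      moreover have "reals st3 ''acc'' 0 0 = (\<Sum>s<s. 0 - stop_cost (seen_cost n S k s) \<alpha> (n - 1) 1)"
        using 7(2) acc2 by (simp add: frame_def)
      ultimately show ?case by (simp add: upd_apply)
    qed auto
    then show ?case by (simp add: 5(4) n1 Yn st2_def)
  qed auto
  then show ?thesis unfolding evaluate_def
    by (auto simp: st0_def neg_total_cost_def elim!: runs_mono)
qed

lemma runs_choose_time:
  assumes st: "traj_done k st" and u: "nats st ''u'' 0 0 = u" "u < m"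
  shows "runs choose_time st (3 + (n + 1) * (11 + m * (6 + 4 * n)))
    (\<lambda>st'. nats st' ''bt'' 0 0 = best_time n S k u \<and> (\<forall>t\<le>n. reals st' ''vc'' t 0 = neg_total_cost n S k (threshold n S k u t)))"
proof -
  let ?f = "\<lambda>t. neg_total_cost n S k (threshold n S k u t)"
  have "runs choose_time st (3 + (Suc n) * ((6 + m * (6 + 4 * n)) + 5))
    (\<lambda>st'. nats st' ''bt'' 0 0 = argmax ?f (Suc n) \<and> True \<and> (\<forall>i<Suc n. reals st' ''vc'' i 0 = ?f i))"
    unfolding choose_time_def
  proof (rule runs_argmax_loop[where J = "\<lambda>_ _. True" and N = "Suc n" and f = ?f and B = "6 + m * (6 + 4 * n)"], goal_cases)
    case (5 st')
    then have "traj_done k st'" using st by (auto intro: traj_done_frame)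
    then show ?case by (simp add: traj_done_def input_ok_def)
  next
    case (8 t st1)
    have t1: "traj_done k st1" using st 8(3) by (rule traj_done_frame) auto
    have u1: "nats st1 ''u'' 0 0 = u" using u 8(3) by (simp add: frame_def)
    have A1: "reals st1 ''A'' u t = recip_sum (seen_cost n S k u) t" using t1 u 8(1) by (simp add: traj_done_def)
    have *: "runs evaluate (st1\<lparr>reals := r\<rparr>) (3 + m * (6 + 4 * n)) (\<lambda>st'. reals st' ''acc'' 0 0 = neg_total_cost n S k a)"
      if "\<And>x. x \<noteq> ''al'' \<Longrightarrow> r x = reals st1 x" "r ''al'' 0 0 = a" for r a
    proof (rule runs_evaluate)
      have "frame st1 (st1\<lparr>reals := r\<rparr>) {} {''al''}" using that by (simp add: frame_def)
      with t1 show "traj_done k (st1\<lparr>reals := r\<rparr>)" by (rule traj_done_frame) auto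
    qed (use that in simp)
    show ?case
      by (auto simp: u1 A1 8(4) threshold_def upd_apply upd_other intro!: runs_mono[OF *])
  qed auto
  then show ?thesis
    by (rule runs_mono) (auto simp: best_time_def algebra_simps)
qed

lemma runs_choose_scenario:
  assumes st: "traj_done k st"
  shows "runs choose_scenario st (3 + m * (12 + (n + 1) * (11 + m * (6 + 4 * n))))
    (\<lambda>st'. nats st' ''bs'' 0 0 = best_scenario n S k \<and> reals st' ''al2'' (best_scenario n S k) 0 = guess_threshold n S k \<and>
      reals st' ''vd'' (best_scenario n S k) 0 = neg_total_cost n S k (guess_threshold n S k))"
proof -
  let ?f = "\<lambda>s. neg_total_cost n S k (scenario_threshold n S k s)"
  let ?J = "\<lambda>c st'. \<forall>s<c. reals st' ''al2'' s 0 = scenario_threshold n S k s"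
  let ?B = "3 + (n + 1) * (11 + m * (6 + 4 * n))"
  have "runs choose_scenario st (3 + m * ((?B + 4) + 5))
    (\<lambda>st'. nats st' ''bs'' 0 0 = argmax ?f m \<and> ?J m st' \<and> (\<forall>i<m. reals st' ''vd'' i 0 = ?f i))"
    unfolding choose_scenario_def
  proof (rule runs_argmax_loop[where J = ?J and N = m and f = ?f and B = "?B + 4"], goal_cases)
    case (5 st')
    then have "traj_done k st'" using st by (auto intro: traj_done_frame)
    then show ?case by (simp add: traj_done_def input_ok_def)
  next
    case (6 j s s')
    then show ?case by (simp add: frame_def)
  next
    case (8 s st1)
    have t1: "traj_done k st1" using st 8(3) by (rule traj_done_frame) auto
    show ?case
    proof (rule runs_Seq[where Tb = 4, OF runs_choose_time[OF t1 8(4,1)]], goal_cases)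
      case (1 st2)
      have t2: "traj_done k st2" using t1 1(2) by (rule traj_done_frame) auto
      have u2: "nats st2 ''u'' 0 0 = s" using 8(4) 1(2) by (simp add: frame_def)
      have J2: "?J s st2" using 8(2) 1(2) by (simp add: frame_def)
      have b: "best_time n S k s \<le> n" unfolding best_time_def
        using argmax_less[of "Suc n" "\<lambda>t. neg_total_cost n S k (threshold n S k s t)"] by (simp only: less_Suc_eq_le zero_less_Suc)
      then have A2: "reals st2 ''A'' s (best_time n S k s) = recip_sum (seen_cost n S k s) (best_time n S k s)" using t2 8(1) by (simp add: traj_done_def)
      have vc: "reals st2 ''vc'' (best_time n S k s) 0 = neg_total_cost n S k (scenario_threshold n S k s)" using 1(1) b by (simp add: scenario_threshold_def)
      have scenario_threshold: "scenario_threshold n S k s = (if best_time n S k s = 0 then 1 else recip_sum (seen_cost n S k s) (best_time n S k s))" by (simp add: scenario_threshold_def threshold_def)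
      show ?case using J2 1(1) vc by (auto simp: u2 A2 scenario_threshold upd_apply less_Suc_eq)
    next
      case 2
      show ?case by simp
    qed
  qed auto
  then show ?thesis
  proof (rule runs_mono, goal_cases)
    case (1 st')
    have "best_scenario n S k < m" unfolding best_scenario_def using m by (rule argmax_less)
    then show ?case using 1(2) by (simp add: best_scenario_def guess_threshold_def)
  qed simp
qed

end

section \<open>The complete algorithm\<close>

definition one_guess :: com where
  "one_guess = Seq ascend (Seq estimate (Seq choose_boxes (Seq build_order (Seq observe (Seq choose_scenario
     (Seq (RAssign ''al3'' (nv ''k'') (NConst 0) (RAt ''al2'' (nv ''bs'') (NConst 0)))
       (setr ''ace'' (RAt ''vd'' (nv ''bs'') (NConst 0)))))))))"

text \<open>With the budget equal to the sum of its parts, unification matches the bounds of the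
  pieces against \<open>guess_time\<close> and \<open>plan_time\<close>, which is why these are sums
  nested to the right in program order.\<close>

lemmas runs_Seq_exact = runs_Seq[OF _ _ order_refl]

lemma nat_writes_one_guess [simp]: "nat_writes one_guess = {''s'', ''j'', ''i'', ''bi'', ''pk'', ''X'', ''p'', ''bj'', ''cd'',
    ''used'', ''len'', ''ord'', ''tt'', ''q'', ''bt'', ''t'', ''bs'', ''u''}"
  by (auto simp: one_guess_def)

lemma real_writes_one_guess [simp]: "real_writes one_guess = {''V'', ''va'', ''acc'', ''H'', ''SD'', ''U'', ''vb'', ''Y'', ''A'', ''e'',
    ''vc'', ''al'', ''vd'', ''acd'', ''al2'', ''al3'', ''ace''}"
  by (auto simp: one_guess_def)

definition plan_prog :: com where
  "plan_prog = Seq compute_excess (Seq (argmax_loop ''bk'' ''k'' n_expr ''ve'' ''ace'' one_guess)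
     (Seq (setr ''alpha'' (RAt ''al3'' (nv ''bk'') (NConst 0)))
       (for_loop ''p'' n_expr (NAssign ''order'' (nv ''p'') (NConst 0) (NAt ''ord'' (nv ''bk'') (nv ''p''))))))"

text \<open>The clock is recomputed from all observed costs in row 0. Of the results of the plan
  only \<open>alpha\<close> is read; \<open>t\<close> and \<open>obs\<close> are set by
  \<open>reveal\<close>.\<close>

definition test_prog :: com where
  "test_prog = Seq (traj (NConst 0) (RAt ''obs'' (nv ''tt'') (NConst 0)) (RNat (nv ''t'')))
     (Cond (RLess (RNat (NConst 1))
             (RTimes (RAt ''Y'' (NConst 0) (nv ''t''))
               (RMinus (rv ''alpha'') (RAt ''A'' (NConst 0) (NMinus (nv ''t'') (NConst 1))))))
       (setn ''stop'' (NConst 0)) (setn ''stop'' (NConst 1)))"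

definition guess_time :: "nat \<Rightarrow> nat \<Rightarrow> nat" where
  "guess_time n m = (4 + 3 * m + rounds n * (8 + 8 * n + 4 * n * m + 5 * m)) + ((2 + m * (10 + 8 * rounds n)) +
     ((2 + m * (8 + 8 * rounds n + 4 * rounds n * m + 4 * m)) + ((7 + 6 * n + 6 * (m + n)) + ((2 + m * (7 + 6 * n)) +
     ((3 + m * (12 + (n + 1) * (11 + m * (6 + 4 * n)))) + 2)))))"

definition plan_time :: "nat \<Rightarrow> nat \<Rightarrow> nat" where
  "plan_time n m = (2 + m * (9 + 12 * n)) + ((3 + n * (guess_time n m + 5)) + (3 + 3 * n))"

context search
begin

definition guess_done :: "nat \<Rightarrow> store \<Rightarrow> bool" where
  "guess_done k st \<longleftrightarrow> reals st ''al3'' k 0 = guess_threshold n S (Suc k) \<and> (\<forall>q<n. nats st ''ord'' k q = probe_order n S (Suc k) ! q)"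

text \<open>The rows of other guesses stay intact, so that the results of all guesses are still
  present when the best one is selected.\<close>

lemma runs_one_guess:
  assumes st: "excess_ok st" and k: "nats st ''k'' 0 0 = k"
  shows "runs one_guess st (guess_time n m) (\<lambda>st'.
     reals st' ''ace'' 0 0 = neg_total_cost n S (Suc k) (guess_threshold n S (Suc k)) \<and> guess_done k st' \<and>
     (\<forall>i. i \<noteq> k \<longrightarrow> nats st' ''ord'' i = nats st ''ord'' i \<and> reals st' ''al3'' i = reals st ''al3'' i))"
  unfolding one_guess_def guess_time_def
proof (rule runs_Seq_exact[OF runs_ascend[OF st k refl]], goal_cases)
  case (1 st1)
  have d1: "excess_ok st1" using st 1(2) by (rule excess_ok_frame) auto
  have k1: "nats st1 ''k'' 0 0 = k" using k 1(2) by (simp add: frame_def)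
  have o1: "nats st1 ''ord'' = nats st ''ord''" "reals st1 ''al3'' = reals st ''al3''" using 1(2) by (simp_all add: frame_def)
  show ?case
  proof (rule runs_Seq_exact[OF runs_estimate[OF d1 1(1)]], goal_cases)
    case (1 st2)
    have d2: "excess_ok st2" using d1 1(2) by (rule excess_ok_frame) auto
    have k2: "nats st2 ''k'' 0 0 = k" using k1 1(2) by (simp add: frame_def)
    have o2: "nats st2 ''ord'' = nats st ''ord''" "reals st2 ''al3'' = reals st ''al3''" using o1 1(2) by (simp_all add: frame_def)
    show ?case
    proof (rule runs_Seq_exact[OF runs_choose_boxes[OF conjunct1[OF 1(1)] conjunct2[OF 1(1)]]], goal_cases)
      case (1 st3)
      have d3: "input_ok st3" using 1(1) excess_ok_input_ok by blast
      have k3: "nats st3 ''k'' 0 0 = k" using k2 1(2) by (simp add: frame_def)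
      have o3: "nats st3 ''ord'' = nats st ''ord''" "reals st3 ''al3'' = reals st ''al3''" using o2 1(2) by (simp_all add: frame_def)
      show ?case
      proof (rule runs_Seq_exact[OF runs_build_order[OF d3 k3 refl conjunct2[OF 1(1)]]], goal_cases)
        case (1 st4)
        have d4: "input_ok st4" using d3 1(2) by (rule input_ok_frame) auto
        have k4: "nats st4 ''k'' 0 0 = k" using k3 1(2) by (simp add: frame_def)
        have o4: "\<forall>q<n. nats st4 ''ord'' k q = probe_order n S (Suc k) ! q"
          "\<forall>i. i \<noteq> k \<longrightarrow> nats st4 ''ord'' i = nats st ''ord'' i" "reals st4 ''al3'' = reals st ''al3''"
          using o3 1 by (simp_all add: frame_def)
        show ?case
        proof (rule runs_Seq_exact[OF runs_observe[OF d4 k4 o4(1)]], goal_cases)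
          case (1 st5)
          have k5: "nats st5 ''k'' 0 0 = k" using k4 1(2) by (simp add: frame_def)
          have o5: "\<forall>q<n. nats st5 ''ord'' k q = probe_order n S (Suc k) ! q"
            "\<forall>i. i \<noteq> k \<longrightarrow> nats st5 ''ord'' i = nats st ''ord'' i" "reals st5 ''al3'' = reals st ''al3''"
            using o4 1(2) by (simp_all add: frame_def)
          show ?case
          proof (rule runs_Seq_exact[OF runs_choose_scenario[OF 1(1)]], goal_cases)
            case (1 st6)
            have k6: "nats st6 ''k'' 0 0 = k" using k5 1(2) by (simp add: frame_def)
            have o6: "\<forall>q<n. nats st6 ''ord'' k q = probe_order n S (Suc k) ! q"
              "\<forall>i. i \<noteq> k \<longrightarrow> nats st6 ''ord'' i = nats st ''ord'' i" "reals st6 ''al3'' = reals st ''al3''"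
              using o5 1(2) by (simp_all add: frame_def)
            show ?case using o6 k6 1(1) by (simp add: guess_done_def upd_apply upd_other upd_def)
          qed
        qed
      qed
    qed
  qed
qed

lemma runs_plan:
  assumes st: "input_ok st"
  shows "runs plan_prog st (plan_time n m) (\<lambda>st'.
    map (\<lambda>k. nats st' ''order'' k 0) [0..<n] = probe_order n S (Suc (best_guess n S)) \<and>
    reals st' ''alpha'' 0 0 = guess_threshold n S (Suc (best_guess n S)))"
  unfolding plan_prog_def plan_time_def
proof (rule runs_Seq_exact[OF runs_compute_excess[OF st]], goal_cases)
  case (1 st1)
  let ?J = "\<lambda>c st'. \<forall>k<c. guess_done k st'"
  let ?f = "\<lambda>k. neg_total_cost n S (Suc k) (guess_threshold n S (Suc k))"
  show ?case
  proof (rule runs_Seq_exact,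
      rule runs_argmax_loop[where J = ?J and f = ?f and N = n and B = "guess_time n m"], goal_cases)
    case (5 st')
    with 1(1) show ?case by (intro input_ok_vals(1) excess_ok_input_ok) (erule excess_ok_frame, auto)
  next
    case (6 j s s')
    then show ?case by (simp add: frame_def guess_done_def)
  next
    case (8 k st2)
    have d2: "excess_ok st2" using 1(1) 8(3) by (rule excess_ok_frame) auto
    show ?case
    proof (rule runs_mono[OF runs_one_guess[OF d2 8(4)]], goal_cases)
      case (1 st')
      then show ?case using 8(2) by (auto simp: less_Suc_eq guess_done_def)
    qed simp
  next
    case (10 st2)
    have d2: "excess_ok st2" using 1(1) 10(2) by (rule excess_ok_frame) auto
    have b: "nats st2 ''bk'' 0 0 = best_guess n S" using 10(1) by (simp add: best_guess_def)
    have "best_guess n S < n" unfolding best_guess_def by (rule argmax_less) (use n in simp)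
    then have g: "guess_done (best_guess n S) st2" using 10(1) by blast
    define st3 where "st3 = st2\<lparr>reals := upd (reals st2) ''alpha'' 0 0 (guess_threshold n S (Suc (best_guess n S)))\<rparr>"
    have fr3: "frame st2 st3 {} {''alpha''}" by (simp add: st3_def frame_def upd_other)
    have d3: "excess_ok st3" using d2 fr3 by (rule excess_ok_frame) auto
    have b3: "nats st3 ''bk'' 0 0 = best_guess n S" using b fr3 by (simp add: frame_def)
    have g3: "guess_done (best_guess n S) st3" using g fr3 by (simp add: frame_def guess_done_def)
    let ?c = "NAssign ''order'' (nv ''p'') (NConst 0) (NAt ''ord'' (nv ''bk'') (nv ''p''))"
    let ?I = "\<lambda>c st'. \<forall>q<c. nats st' ''order'' q 0 = probe_order n S (Suc (best_guess n S)) ! q"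
    have "runs (for_loop ''p'' n_expr ?c) st3 (2 + n * (1 + 2)) (?I n)"
    proof (rule runs_for[where I = ?I and b = n and B = 1], goal_cases)
      case (2 st')
      with d3 show ?case by (intro input_ok_vals(1) excess_ok_input_ok) (erule excess_ok_frame, auto)
    next
      case (3 j st v)
      show ?case by (simp add: upd_other)
    next
      case (5 q st')
      have "nats st' ''bk'' 0 0 = best_guess n S" using b3 5(3) by (simp add: frame_def)
      moreover have "guess_done (best_guess n S) st'" using g3 5(3) by (simp add: frame_def guess_done_def)
      ultimately show ?case using 5 by (auto simp: upd_apply less_Suc_eq guess_done_def)
    qed auto
    then have "runs (for_loop ''p'' n_expr ?c) st3 (2 + 3 * n) (\<lambda>st'.
      map (\<lambda>k. nats st' ''order'' k 0) [0..<n] = probe_order n S (Suc (best_guess n S)) \<and>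
      reals st' ''alpha'' 0 0 = guess_threshold n S (Suc (best_guess n S)))"
    proof (rule runs_mono, goal_cases)
      case (1 st')
      have "reals st' ''alpha'' 0 0 = guess_threshold n S (Suc (best_guess n S))" using 1(1) by (simp add: st3_def frame_def upd_apply)
      moreover have "map (\<lambda>k. nats st' ''order'' k 0) [0..<n] = probe_order n S (Suc (best_guess n S))"
        using 1(2) by (intro nth_equalityI) (auto simp: length_probe_order)
      ultimately show ?case by blast
    qed simp
    then show ?case using g by (simp add: b st3_def guess_done_def)
  qed auto
qed

lemma runs_test:
  assumes "nats st ''t'' 0 0 = j" "1 \<le> j" "\<forall>p<j. reals st ''obs'' p 0 = c p" "reals st ''alpha'' 0 0 = \<alpha>"
  shows "runs test_prog st (7 + 6 * j) (\<lambda>st'. stops c \<alpha> j \<longleftrightarrow> nats st' ''stop'' 0 0 \<noteq> 0)"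
  unfolding test_prog_def
proof (rule runs_Seq[where Ta = "5 + 6 * j" and Tb = 2], rule runs_traj[where s = 0 and b = j and c = c], goal_cases)
  case (2 st')
  then show ?case using assms by (simp add: frame_def)
next
  case (3 i st')
  then show ?case using assms by (simp add: frame_def)
next
  case (6 st')
  have "reals st' ''Y'' 0 j = run_min c j" "reals st' ''A'' 0 (j - 1) = recip_sum c (j - 1)" using 6(1) by simp_all
  moreover have "nats st' ''t'' 0 0 = j" "reals st' ''alpha'' 0 0 = \<alpha>" using 6(2) assms by (simp_all add: frame_def)
  ultimately show ?case by (auto simp: stops_def upd_apply)
qed (use assms in auto)

lemma input_ok_input_store: "input_ok (input_store n S \<omega>)"
  by (simp add: input_ok_def input_store_def)

lemma computes_best_strategy:
  assumes T: "plan_time n m \<le> T" "7 + 6 * n \<le> T"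
  shows "computes_pa plan_prog test_prog T n S \<omega> best_strategy"
proof -
  obtain t st where plan: "exec plan_prog (input_store n S \<omega>) t st" "t \<le> plan_time n m"
    and ord: "map (\<lambda>k. nats st ''order'' k 0) [0..<n] = probe_order n S (Suc (best_guess n S))"
    and threshold: "reals st ''alpha'' 0 0 = guess_threshold n S (Suc (best_guess n S))"
    using runs_plan[OF input_ok_input_store[of \<omega>]] unfolding runs_def by blast
  have test: "\<exists>t' st'. exec test_prog (reveal (observed (fst best_strategy) s j) st) t' st' \<and> t' \<le> T \<and>
      (snd best_strategy (observed (fst best_strategy) s j) \<longleftrightarrow> nats st' ''stop'' 0 0 \<noteq> 0)" if j: "j \<in> {1..n}" for s j
  proof -
    define xs where "xs = observed (fst best_strategy) s j"
    have len: "length xs = j" using j length_probe_order by (simp add: xs_def observed_def best_strategy_def)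
    have "runs test_prog (reveal xs st) (7 + 6 * j)
        (\<lambda>st'. stops (\<lambda>p. xs ! p) (guess_threshold n S (Suc (best_guess n S))) j \<longleftrightarrow> nats st' ''stop'' 0 0 \<noteq> 0)"
      by (rule runs_test) (use j len threshold in \<open>auto simp: reveal_def upd_apply\<close>)
    then obtain t' st' where "exec test_prog (reveal xs st) t' st'" "t' \<le> 7 + 6 * j"
      "stops (\<lambda>p. xs ! p) (guess_threshold n S (Suc (best_guess n S))) j \<longleftrightarrow> nats st' ''stop'' 0 0 \<noteq> 0"
      unfolding runs_def by blast
    moreover have "7 + 6 * j \<le> T" using j T by simp
    ultimately show ?thesis unfolding xs_def[symmetric]
      by (auto simp: best_strategy_def stop_rule_def len intro!: exI[of _ t'] exI[of _ st'])
  qed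
  show ?thesis unfolding computes_pa_def
    using plan T ord test by (intro exI[of _ t] exI[of _ st]) (auto simp: best_strategy_def)
qed

end

section \<open>Polynomial running time\<close>

text \<open>Closure under sums, products and powers spares the expansion of the time bound. From n
  \<ge> 1 follows n + m \<ge> 1, which allows exponents to be raised to a common one.\<close>

definition poly_bounded :: "(nat \<Rightarrow> nat \<Rightarrow> nat) \<Rightarrow> bool" where
  "poly_bounded f \<longleftrightarrow> (\<exists>C e. \<forall>n m. 1 \<le> n \<longrightarrow> f n m \<le> C * (n + m) ^ e)"

lemma poly_bounded_const: "poly_bounded (\<lambda>n m. c)"
  unfolding poly_bounded_def by (rule exI[of _ c], rule exI[of _ 0]) simp

lemma poly_bounded_fst: "poly_bounded (\<lambda>n m. n)"
  unfolding poly_bounded_def by (rule exI[of _ 1], rule exI[of _ 1]) simp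

lemma poly_bounded_snd: "poly_bounded (\<lambda>n m. m)"
  unfolding poly_bounded_def by (rule exI[of _ 1], rule exI[of _ 1]) simp

lemma poly_bounded_add:
  assumes "poly_bounded f" "poly_bounded g"
  shows "poly_bounded (\<lambda>n m. f n m + g n m)"
proof -
  obtain C e C' e' where b: "\<And>n m. 1 \<le> n \<Longrightarrow> f n m \<le> C * (n + m) ^ e" "\<And>n m. 1 \<le> n \<Longrightarrow> g n m \<le> C' * (n + m) ^ e'"
    using assms unfolding poly_bounded_def by metis
  have "f n m + g n m \<le> (C + C') * (n + m) ^ (e + e')" if n: "1 \<le> n" for n m
  proof -
    have "(n + m) ^ e \<le> (n + m) ^ (e + e')" "(n + m) ^ e' \<le> (n + m) ^ (e + e')"
      using n by (auto intro!: power_increasing)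
    then have "C * (n + m) ^ e \<le> C * (n + m) ^ (e + e')" "C' * (n + m) ^ e' \<le> C' * (n + m) ^ (e + e')"
      by (simp_all add: mult_left_mono)
    then show ?thesis using b[OF n, of m] unfolding distrib_right by linarith
  qed
  then show ?thesis unfolding poly_bounded_def by blast
qed

lemma poly_bounded_mult:
  assumes "poly_bounded f" "poly_bounded g"
  shows "poly_bounded (\<lambda>n m. f n m * g n m)"
proof -
  obtain C e C' e' where b: "\<And>n m. 1 \<le> n \<Longrightarrow> f n m \<le> C * (n + m) ^ e" "\<And>n m. 1 \<le> n \<Longrightarrow> g n m \<le> C' * (n + m) ^ e'"
    using assms unfolding poly_bounded_def by metis
  have "f n m * g n m \<le> (C * C') * (n + m) ^ (e + e')" if n: "1 \<le> n" for n m
    using mult_mono[OF b(1)[OF n, of m] b(2)[OF n, of m]] by (simp add: power_add mult_ac)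
  then show ?thesis unfolding poly_bounded_def by blast
qed

lemma poly_bounded_power: "poly_bounded f \<Longrightarrow> poly_bounded (\<lambda>n m. f n m ^ p)"
  by (induction p) (auto intro: poly_bounded_const poly_bounded_mult)

lemma poly_bounded_time: "poly_bounded (\<lambda>n m. plan_time n m + (7 + 6 * n))"
  unfolding plan_time_def guess_time_def rounds_def
  by (intro poly_bounded_add poly_bounded_mult poly_bounded_power poly_bounded_const poly_bounded_fst poly_bounded_snd)

theorem mainTheorem1:
  "\<exists>(plan :: com) (test :: com) (C :: nat) (k :: nat).
     \<forall>(n :: nat) (S :: scenario list). search_instance n S \<longrightarrow>
       (\<exists>D :: pa_strategy pmf.
          computes_randomized_pa plan test (C * (n + length S) ^ k) n S D \<and>
          expected_pa_cost S D \<le> exp 1 / (exp 1 - 1) * opt_na_cost n S)"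
proof -
  obtain C k where Ck: "\<And>n m. 1 \<le> n \<Longrightarrow> plan_time n m + (7 + 6 * n) \<le> C * (n + m) ^ k"
    using poly_bounded_time unfolding poly_bounded_def by metis
  have "computes_randomized_pa plan_prog test_prog (C * (n + length S) ^ k) n S (return_pmf (search.best_strategy n S)) \<and>
      expected_pa_cost S (return_pmf (search.best_strategy n S)) \<le> exp 1 / (exp 1 - 1) * opt_na_cost n S"
    if "search_instance n S" for n S
  proof -
    interpret search n S by unfold_locales (rule that)
    have T: "plan_time n m \<le> C * (n + m) ^ k" "7 + 6 * n \<le> C * (n + m) ^ k"
      using Ck[OF n, of m] by auto
    \<comment> \<open>A constant function of the coin flips pushes the uniform distribution forward
      to a point mass.\<close>
    have "computes_randomized_pa plan_prog test_prog (C * (n + m) ^ k) n S (return_pmf best_strategy)"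
      unfolding computes_randomized_pa_def
      by (intro exI[of _ "\<lambda>_. best_strategy"] conjI allI impI is_pa_best_strategy computes_best_strategy[OF T]) (simp add: map_pmf_const)
    moreover have "expected_pa_cost S (return_pmf best_strategy) = pa_cost S best_strategy"
      by (simp add: expected_pa_cost_def)
    ultimately show ?thesis using best_strategy_cost by simp
  qed
  then show ?thesis by blast
qed

end
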